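(* Consider the system $x(k+1)=A(k)x(k)+B(k)u(k)$, $x(0)=x_0\in\mathbb{R}^n$, composed of $N$ subsystems with the random matrices $A(k)$ satisfying the independence assumptions in the context. Fix $T>0$, let $Q(k)\in\mathcal{S}_+^n$ for $0\le k\le T$ and $R(k)=\mathrm{diag}(R_{11}(k),\dots,R_{NN}(k))\in\mathcal{S}_{++}^m$ for $0\le k\le T-1$ with $R_{ii}(k)\in\mathbb{R}^{m_i\times m_i}$, and let $$J_T(x_0,\{u(k)\}_{k=0}^{T-1})=\mathbb{E}\Big\{x(T)^\top Q(T)x(T)+\sum_{k=0}^{T-1}\Big(x(k)^\top Q(k)x(k)+\sum_{j=1}^N u_j(k)^\top R_{jj}(k)u_j(k)\Big)\Big\}.$$ Then the solution of the problem of minimizing $J_T$ over all control laws with limited model information (defined in the context) is given by $$u(k)=-(R(k)+B(k)^\top P(k+1)B(k))^{-1}B(k)^\top P(k+1)\bar A(k)x(k)-\begin{bmatrix}(R_{11}(k)+B_1(k)^\top P(k+1)B_1(k))^{-1}B_1(k)^\top P(k+1)\tilde A_1(k)\\ \vdots\\ (R_{NN}(k)+B_N(k)^\top P(k+1)B_N(k))^{-1}B_N(k)^\top P(k+1)\tilde A_N(k)\end{bmatrix}x(k),$$ where the matrices $\{P(k)\}_{k=0}^T$ are given by the backward difference equation $$P(k)=Q(k)+\mathbf{R}(\bar A(k),P(k+1),B(k),R(k))+\sum_{i=1}^N\mathbb{E}\{\mathbf{R}(\tilde A_i(k),P(k+1),B_i(k),R_{ii}(k))\}$$ with boundary condition $P(T)=Q(T)$.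 Furthermore, $\inf_{\{u(k)\}_{k=0}^{T-1}}J_T(x_0,\{u(k)\}_{k=0}^{T-1})=x_0^\top P(0)x_0$, the infimum being over control laws with limited model information.
   Context: Notation: $\mathcal{S}_{+}^n$ ($\mathcal{S}_{++}^n$) is the set of symmetric positive semidefinite (positive definite) matrices in $\mathbb{R}^{n\times n}$. The discrete Riccati operator is $\mathbf{R}(A,P,B,R)=A^\top(P-PB(R+B^\top PB)^{-1}B^\top P)A$ for $A\in\mathbb{R}^{n\times n}$, $P\in\mathcal{S}_+^n$, $B\in\mathbb{R}^{n\times m}$, $R\in\mathcal{S}_{++}^m$ (for any positive integers $n,m$). System: there are $N$ subsystems, subsystem $i$ having state $x_i(k)\in\mathbb{R}^{n_i}$, input $u_i(k)\in\mathbb{R}^{m_i}$ and dynamics $x_i(k+1)=\sum_{j=1}^N A_{ij}(k)x_j(k)+B_{ii}(k)u_i(k)$. Put $n=\sum_i n_i$, $m=\sum_i m_i$, $x(k)=[x_1(k)^\top\cdots x_N(k)^\top]^\top$, $u(k)=[u_1(k)^\top\cdots u_N(k)^\top]^\top$; then $x(k+1)=A(k)x(k)+B(k)u(k)$, with $A(k)=[A_{ij}(k)]_{i,j}$ and $B(k)=\mathrm{diag}(B_{11}(k),\dots,B_{NN}(k))$. The matrices $B_{ii}(k)$ and the initial state $x_0$ are deterministic; the $A_{ij}(k)\in\mathbb{R}^{n_i\times n_j}$ are random with finite first and second moments. Independence assumptions: the block rows $[A_{i1}(k)\;\cdots\;A_{iN}(k)]$, $1\le i\le N$, $k\ge0$,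 are mutually independent, both in time $k$ and across subsystems $i$ (blocks within the same block row at the same time may be dependent). Write $\bar A(k)=\mathbb{E}\{A(k)\}$, $\tilde A_{ij}(k)=A_{ij}(k)-\mathbb{E}\{A_{ij}(k)\}$. $B_i(k)\in\mathbb{R}^{n\times m_i}$ is the $i$-th block column of $B(k)$ (its $i$-th block is $B_{ii}(k)$ and all other blocks are zero). $\tilde A_i(k)\in\mathbb{R}^{n\times n}$ has $i$-th block row $[\tilde A_{i1}(k)\;\cdots\;\tilde A_{iN}(k)]$ and all other block rows zero. Control laws with limited model information: the design of controller $i$ may use the exact local realizations $A_{i1}(k),\dots,A_{iN}(k)$ together with the first- and second-order moments $\mathbb{E}\{A(k)\}$, $\mathbb{E}\{\tilde A(k)\otimes\tilde A(k)\}$ for all $k$ (where $\tilde A(k)=A(k)-\bar A(k)$), and the controller measures the full state. That is, at each time $k$, $u_i(k)=\psi_i(A_{i1}(k),\dots,A_{iN}(k);x(0),\dots,x(k))$ for $1\le i\le N$, where $\psi_i$ (possibly depending on $k$) is an arbitrary measurable mapping into $\mathbb{R}^{m_i}$, not necessarily linear. *)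

theory Defs
  imports "HOL-Probability.Probability" "Jordan_Normal_Form.Gauss_Jordan_Elimination"
begin

hide_type (open) Finite_Cartesian_Product.vec
hide_const (open) Finite_Cartesian_Product.vec Finite_Cartesian_Product.mat
  Finite_Cartesian_Product.transpose Finite_Cartesian_Product.row Finite_Cartesian_Product.column
no_notation vec_nth (infixl \<open>$\<close> 90)

definition psd_mat :: "nat \<Rightarrow> real mat \<Rightarrow> bool" where
  "psd_mat d S \<longleftrightarrow> S \<in> carrier_mat d d \<and> transpose_mat S = S \<and>
     (\<forall>x \<in> carrier_vec d. 0 \<le> x \<bullet> (S *\<^sub>v x))"

definition pd_mat :: "nat \<Rightarrow> real mat \<Rightarrow> bool" where
  "pd_mat d S \<longleftrightarrow> S \<in> carrier_mat d d \<and> transpose_mat S = S \<and>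
     (\<forall>x \<in> carrier_vec d. x \<noteq> 0\<^sub>v d \<longrightarrow> 0 < x \<bullet> (S *\<^sub>v x))"

text \<open>Only meaningful for invertible matrices, as \<^const>\<open>mat_inverse\<close> is \<^const>\<open>None\<close> otherwise.\<close>
definition inv_mat :: "real mat \<Rightarrow> real mat" where
  "inv_mat S = the (mat_inverse S)"

definition riccati :: "real mat \<Rightarrow> real mat \<Rightarrow> real mat \<Rightarrow> real mat \<Rightarrow> real mat" where
  "riccati A P B R =
     transpose_mat A *
     (P - P * B * inv_mat (R + transpose_mat B * P * B) * transpose_mat B * P) * A"

definition gain :: "real mat \<Rightarrow> real mat \<Rightarrow> real mat \<Rightarrow> real mat" where
  "gain P B R = inv_mat (R + transpose_mat B * P * B) * transpose_mat B * P"


text \<open>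
  Subsystems are numbered \<open>0, \<dots>, N - 1\<close>.  For block sizes \<open>d\<close>, block \<open>i\<close> occupies the
  indices \<open>offset d i, \<dots>, offset d i + d i - 1\<close>, and \<open>offset d N\<close> is the total dimension.
\<close>
definition offset :: "(nat \<Rightarrow> nat) \<Rightarrow> nat \<Rightarrow> nat" where
  "offset d i = (\<Sum>j<i. d j)"

definition block_row :: "(nat \<Rightarrow> nat) \<Rightarrow> nat \<Rightarrow> real mat \<Rightarrow> real mat" where
  "block_row d i S = mat (d i) (dim_col S) (\<lambda>(a, b). S $$ (offset d i + a, b))"

definition block_col :: "(nat \<Rightarrow> nat) \<Rightarrow> nat \<Rightarrow> real mat \<Rightarrow> real mat" where
  "block_col d i S = mat (dim_row S) (d i) (\<lambda>(a, b). S $$ (a, offset d i + b))"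

text \<open>All rows of \<open>S\<close> outside block row \<open>i\<close> are replaced by zero.\<close>
definition only_block_row :: "(nat \<Rightarrow> nat) \<Rightarrow> nat \<Rightarrow> real mat \<Rightarrow> real mat" where
  "only_block_row d i S = mat (dim_row S) (dim_col S)
     (\<lambda>(a, b). if offset d i \<le> a \<and> a < offset d i + d i then S $$ (a, b) else 0)"

definition diag_blocks :: "nat \<Rightarrow> (nat \<Rightarrow> real mat) \<Rightarrow> real mat" where
  "diag_blocks N f = diag_block_mat (map f [0..<N])"

definition stack_mat :: "nat \<Rightarrow> nat \<Rightarrow> (nat \<Rightarrow> real mat) \<Rightarrow> real mat" where
  "stack_mat nc N f = foldr (@\<^sub>r) (map f [0..<N]) (0\<^sub>m 0 nc)"

definition stack_vec :: "nat \<Rightarrow> (nat \<Rightarrow> real vec) \<Rightarrow> real vec" where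
  "stack_vec N f = foldr (@\<^sub>v) (map f [0..<N]) (0\<^sub>v 0)"

definition mat_sum :: "nat \<Rightarrow> nat \<Rightarrow> (nat \<Rightarrow> real mat) \<Rightarrow> nat set \<Rightarrow> real mat" where
  "mat_sum nr nc f I = mat nr nc (\<lambda>p. \<Sum>i\<in>I. f i $$ p)"


text \<open>
  The Borel sigma-algebras of the spaces of vectors and matrices of a fixed size, which are
  transported from the product spaces along the entry maps.
\<close>
definition vec_borel :: "nat \<Rightarrow> real vec measure" where
  "vec_borel d = vimage_algebra (carrier_vec d) (\<lambda>v. \<lambda>a\<in>{..<d}. v $ a)
     (\<Pi>\<^sub>M a\<in>{..<d}. borel)"

definition mat_borel :: "nat \<Rightarrow> nat \<Rightarrow> real mat measure" where
  "mat_borel nr nc = vimage_algebra (carrier_mat nr nc) (\<lambda>S. \<lambda>p\<in>{..<nr} \<times> {..<nc}. S $$ p)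
     (\<Pi>\<^sub>M p\<in>{..<nr} \<times> {..<nc}. borel)"

definition expect_mat :: "'w measure \<Rightarrow> nat \<Rightarrow> nat \<Rightarrow> ('w \<Rightarrow> real mat) \<Rightarrow> real mat" where
  "expect_mat M nr nc X = mat nr nc (\<lambda>p. \<integral>\<omega>. X \<omega> $$ p \<partial>M)"

text \<open>The centred matrix, with all rows outside block row \<open>i\<close> set to zero.\<close>
definition centred_row :: "'w measure \<Rightarrow> nat \<Rightarrow> (nat \<Rightarrow> nat) \<Rightarrow> nat \<Rightarrow> ('w \<Rightarrow> real mat)
    \<Rightarrow> 'w \<Rightarrow> real mat" where
  "centred_row M N n i X \<omega> =
     only_block_row n i (X \<omega> - expect_mat M (offset n N) (offset n N) X)"


text \<open>
  \<open>\<psi> k i S xs\<close> is the input of subsystem \<open>i\<close> at time \<open>k\<close>, where \<open>S\<close> is the \<open>i\<close>-th block row of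
  the current system matrix and \<open>xs\<close>, defined on \<open>{..k}\<close>, is the state trajectory up to time \<open>k\<close>.
  The law may depend in an arbitrary way on all deterministic data, in particular on the moments.
\<close>
type_synonym control_law = "nat \<Rightarrow> nat \<Rightarrow> real mat \<Rightarrow> (nat \<Rightarrow> real vec) \<Rightarrow> real vec"

definition limited_info_laws ::
    "nat \<Rightarrow> (nat \<Rightarrow> nat) \<Rightarrow> (nat \<Rightarrow> nat) \<Rightarrow> nat \<Rightarrow> control_law set" where
  "limited_info_laws N n m T = {\<psi>. \<forall>k<T. \<forall>i<N.
     (\<lambda>(S, xs). \<psi> k i S xs) \<in>
       mat_borel (n i) (offset n N) \<Otimes>\<^sub>M (\<Pi>\<^sub>M t\<in>{..k}. vec_borel (offset n N))
       \<rightarrow>\<^sub>M vec_borel (m i)}"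

lemma restrict_fundef_cong [fundef_cong]:
  "I = J \<Longrightarrow> (\<And>i. i \<in> J \<Longrightarrow> f i = g i) \<Longrightarrow> restrict f I = restrict g J"
  by (auto simp: restrict_def)

text \<open>
  The closed-loop state for one realization \<open>A\<close> of the sequence of system matrices;
  \<open>B\<close> is the sequence of the full input matrices.
\<close>
fun state :: "nat \<Rightarrow> (nat \<Rightarrow> nat) \<Rightarrow> (nat \<Rightarrow> real mat) \<Rightarrow> (nat \<Rightarrow> real mat) \<Rightarrow> real vec
    \<Rightarrow> control_law \<Rightarrow> nat \<Rightarrow> real vec" where
  "state N n A B x0 \<psi> 0 = x0"
| "state N n A B x0 \<psi> (Suc k) =
     A k *\<^sub>v state N n A B x0 \<psi> k +
     B k *\<^sub>v stack_vec N (\<lambda>i. \<psi> k i (block_row n i (A k))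
                             (restrict (\<lambda>t. state N n A B x0 \<psi> t) {..k}))"

definition input :: "nat \<Rightarrow> (nat \<Rightarrow> nat) \<Rightarrow> (nat \<Rightarrow> real mat) \<Rightarrow> (nat \<Rightarrow> real mat) \<Rightarrow> real vec
    \<Rightarrow> control_law \<Rightarrow> nat \<Rightarrow> nat \<Rightarrow> real vec" where
  "input N n A B x0 \<psi> k i =
     \<psi> k i (block_row n i (A k)) (restrict (\<lambda>t. state N n A B x0 \<psi> t) {..k})"

text \<open>
  The integrand is nonnegative if \<open>Q\<close> and \<open>R\<close> are positive semidefinite, so its expectation
  always exists in \<open>[0, \<infinity>]\<close>.  The Bochner integral would be \<open>0\<close> in the infinite case.
\<close>
definition cost :: "'w measure \<Rightarrow> nat \<Rightarrow> (nat \<Rightarrow> nat) \<Rightarrow> nat \<Rightarrow> (nat \<Rightarrow> 'w \<Rightarrow> real mat)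
    \<Rightarrow> (nat \<Rightarrow> real mat) \<Rightarrow> (nat \<Rightarrow> real mat) \<Rightarrow> (nat \<Rightarrow> nat \<Rightarrow> real mat) \<Rightarrow> real vec
    \<Rightarrow> control_law \<Rightarrow> ereal" where
  "cost M N n T A B Q R x0 \<psi> = enn2ereal (\<integral>\<^sup>+\<omega>.
     (let x = state N n (\<lambda>k. A k \<omega>) B x0 \<psi>; u = input N n (\<lambda>k. A k \<omega>) B x0 \<psi>
      in ennreal (x T \<bullet> (Q T *\<^sub>v x T) +
           (\<Sum>k<T. x k \<bullet> (Q k *\<^sub>v x k) + (\<Sum>j<N. u k j \<bullet> (R k j *\<^sub>v u k j))))) \<partial>M)"

end

theory Submission
  imports Defs "Jordan_Normal_Form.Determinant"
begin

text \<open>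
  The proof is dynamic programming. What has to be shown at each time is that the one-step problem
  with successor cost \<open>P\<close> has a quadratic optimal value, although the input blocks are chosen under
  different information: block \<open>i\<close> may depend on the state \<open>x\<close> and on block row \<open>i\<close> of \<open>A\<close> only.

  Let \<open>y\<^sub>i\<close> be the product of the \<open>i\<close>-th centred block row with \<open>x\<close>, let \<open>u\<close> be the claimed optimal
  input and let \<open>u + e\<close> be any admissible input. Completing the square around \<open>u\<close>
  (\<open>one_step_cost_expand\<close>) writes the cost of \<open>u + e\<close> as
  \<open>e \<bullet> H e + 2 (e \<bullet> g) + u \<bullet> g + A x \<bullet> P (A x + B u)\<close>, where \<open>H = R + B\<^sup>T P B\<close> is positive definite
  and \<open>g\<close> is half the gradient at \<open>u\<close>. By the choice of the gains, the mean part of \<open>g\<close> vanishes and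
  \<open>g\<close> is a sum of linear images of the vectors \<open>y\<^sub>j\<close> in which the image of \<open>y\<^sub>i\<close> has block \<open>i\<close> equal
  to zero. So block \<open>i\<close> of \<open>g\<close> only involves \<open>y\<^sub>j\<close> with \<open>j \<noteq> i\<close>; these have mean zero and are
  independent of every function of block row \<open>i\<close>. Hence \<open>e \<bullet> g\<close> and \<open>u \<bullet> g\<close> both have expectation
  zero (\<open>grad_orthogonal\<close>): decentralisation costs nothing at first order. The same independence
  makes the expectation of the last term a sum of Riccati forms (\<open>uncontrolled_term\<close>). The expected
  cost is therefore the value form plus the expectation of \<open>e \<bullet> H e\<close>, which gives optimality and
  almost sure uniqueness (\<open>one_step_optimal\<close>).

  Arbitrary measurable laws need not be square integrable. If the expected one-step cost is finite,
  then coercivity of \<open>R\<close> makes the input square integrable (\<open>pd_coercive\<close>); if it is infinite, there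
  is nothing to compare. All costs along the closed loop are therefore nonnegative integrals with
  values in \<open>[0, \<infinity>]\<close>.

  The trajectory up to time \<open>k\<close> is a measurable function of the earlier block rows, hence independent
  of \<open>A k\<close>, and integrals over the closed loop can be computed by freezing it (\<open>past_integral\<close>).
  Thus the cost accumulated before time \<open>k\<close> plus the optimal value from \<open>k\<close> on is nondecreasing in
  \<open>k\<close>, and it is constant exactly for the laws that agree almost surely with the claimed one
  (\<open>bellman_step\<close>).
\<close>

unbundle no inner_syntax

section \<open>Positive definite matrices and Riccati operators\<close>

lemmas mv_carrier = mult_mat_vec_carrier

lemma mult_mat_uminus_vec:
  fixes A :: "real mat"
  assumes "A \<in> carrier_mat r c" "v \<in> carrier_vec c"
  shows "A *\<^sub>v (- v) = - (A *\<^sub>v v)"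
  using assms by (intro eq_vecI) auto

lemma pd_form_nonneg:
  assumes "pd_mat k S" "v \<in> carrier_vec k"
  shows "0 \<le> v \<bullet> (S *\<^sub>v v)"
  using assms by (cases "v = 0\<^sub>v k") (auto simp: pd_mat_def less_imp_le)

lemma pd_mat_inverse:
  assumes "pd_mat k S"
  shows inv_mat_carrier: "inv_mat S \<in> carrier_mat k k"
    and inv_mat_right: "S * inv_mat S = 1\<^sub>m k"
    and inv_mat_left: "inv_mat S * S = 1\<^sub>m k"
proof -
  have S: "S \<in> carrier_mat k k" using assms by (simp add: pd_mat_def)
  have "det S \<noteq> 0"
  proof
    assume "det S = 0"
    then obtain v where v: "v \<in> carrier_vec k" "v \<noteq> 0\<^sub>v k" "S *\<^sub>v v = 0\<^sub>v k"
      using det_0_iff_vec_prod_zero_field[OF S] by auto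
    then have "0 < v \<bullet> (S *\<^sub>v v)" using assms unfolding pd_mat_def by blast
    then show False using v(1) unfolding v(3) by simp
  qed
  from det_non_zero_imp_unit[OF S this, of "()"] mat_inverse(1)[OF S, of "()"]
  obtain T where T: "mat_inverse S = Some T" by (cases "mat_inverse S") auto
  then show "inv_mat S \<in> carrier_mat k k" "S * inv_mat S = 1\<^sub>m k" "inv_mat S * S = 1\<^sub>m k"
    using mat_inverse(2)[OF S T] by (auto simp: inv_mat_def)
qed

lemma inv_mat_sym:
  assumes "pd_mat k S"
  shows "transpose_mat (inv_mat S) = inv_mat S"
proof -
  note I = pd_mat_inverse[OF assms]
  have S: "S \<in> carrier_mat k k" and sym: "S\<^sup>T = S" using assms by (auto simp: pd_mat_def)
  have "transpose_mat (inv_mat S) = transpose_mat (inv_mat S) * (S * inv_mat S)"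
    using I by simp
  also have "\<dots> = transpose_mat (inv_mat S) * S\<^sup>T * inv_mat S"
    using I(1) S by (subst assoc_mult_mat[of _ k k _ k _ k]) (auto simp: sym)
  also have "transpose_mat (inv_mat S) * S\<^sup>T = transpose_mat (S * inv_mat S)"
    using transpose_mult[OF S I(1)] by simp
  also have "\<dots> = 1\<^sub>m k" using I(2) by simp
  finally show ?thesis using I(1) by simp
qed

lemma sym_form_swap:
  fixes P :: "real mat"
  assumes "P \<in> carrier_mat k k" "P\<^sup>T = P" "v \<in> carrier_vec k" "w \<in> carrier_vec k"
  shows "v \<bullet> (P *\<^sub>v w) = w \<bullet> (P *\<^sub>v v)"
proof -
  have "v \<bullet> (P *\<^sub>v w) = (P\<^sup>T *\<^sub>v v) \<bullet> w"
    using transpose_vec_mult_scalar[of P k k w v] assms by simp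
  also have "\<dots> = w \<bullet> (P *\<^sub>v v)"
    using assms by (simp add: comm_scalar_prod[of _ k])
  finally show ?thesis .
qed

lemma transpose_form:
  fixes B :: "real mat"
  assumes "B \<in> carrier_mat r c" "v \<in> carrier_vec c" "w \<in> carrier_vec r"
  shows "v \<bullet> (B\<^sup>T *\<^sub>v w) = (B *\<^sub>v v) \<bullet> w"
  using transpose_vec_mult_scalar[OF assms] assms
  by (metis comm_scalar_prod mv_carrier transpose_carrier_mat)

lemma congruence_sym:
  fixes P :: "real mat"
  assumes "P \<in> carrier_mat d d" "P\<^sup>T = P" "B \<in> carrier_mat d q"
  shows "transpose_mat (B\<^sup>T * P * B) = B\<^sup>T * P * B"
proof -
  have "transpose_mat (B\<^sup>T * P * B) = B\<^sup>T * transpose_mat (B\<^sup>T * P)"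
    using assms by (subst transpose_mult[of _ q d _ q]) auto
  also have "transpose_mat (B\<^sup>T * P) = P\<^sup>T * B"
    using assms by (subst transpose_mult[of _ q d _ d]) auto
  finally show ?thesis using assms by (simp add: assoc_mult_mat[of _ q d _ d _ q])
qed

lemma congruence_form:
  fixes P :: "real mat"
  assumes "P \<in> carrier_mat d d" "B \<in> carrier_mat d q" "v \<in> carrier_vec q" "w \<in> carrier_vec q"
  shows "v \<bullet> (B\<^sup>T * P * B *\<^sub>v w) = (B *\<^sub>v v) \<bullet> (P *\<^sub>v (B *\<^sub>v w))"
proof -
  have "B\<^sup>T * P * B *\<^sub>v w = B\<^sup>T *\<^sub>v (P *\<^sub>v (B *\<^sub>v w))"
    using assms by (simp add: assoc_mult_mat_vec[of _ q d _ q] assoc_mult_mat_vec[of _ q d _ d])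
  then show ?thesis using assms by (simp add: transpose_form[of _ d q])
qed

lemma hessian_form:
  fixes P R :: "real mat"
  assumes "R \<in> carrier_mat q q" "P \<in> carrier_mat d d" "B \<in> carrier_mat d q"
    "v \<in> carrier_vec q" "w \<in> carrier_vec q"
  shows "v \<bullet> ((R + B\<^sup>T * P * B) *\<^sub>v w)
    = v \<bullet> (R *\<^sub>v w) + (B *\<^sub>v v) \<bullet> (P *\<^sub>v (B *\<^sub>v w))"
proof -
  define H where "H = B\<^sup>T * P * B"
  have H: "H \<in> carrier_mat q q" unfolding H_def
    by (intro mult_carrier_mat[of _ q d] mult_carrier_mat[of _ q d _ d]) (use assms in auto)
  have "v \<bullet> ((R + H) *\<^sub>v w) = v \<bullet> (R *\<^sub>v w) + v \<bullet> (H *\<^sub>v w)"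
    using assms H by (simp add: add_mult_distrib_mat_vec[of _ q q] scalar_prod_add_distrib[of _ q])
  then show ?thesis unfolding H_def using congruence_form[OF assms(2-5)] by simp
qed

text \<open>\<open>R + B\<^sup>T P B\<close> is half the Hessian of the one-step cost with respect to the input.\<close>

lemma pd_hessian:
  assumes R: "pd_mat q R" and P: "psd_mat d P" and B: "B \<in> carrier_mat d q"
  shows "pd_mat q (R + B\<^sup>T * P * B)"
proof -
  have c: "R \<in> carrier_mat q q" "P \<in> carrier_mat d d" "R\<^sup>T = R" "P\<^sup>T = P"
    using R P by (auto simp: pd_mat_def psd_mat_def)
  have "transpose_mat (R + B\<^sup>T * P * B) = R + B\<^sup>T * P * B"
    using c B by (subst transpose_add[of _ q q]) (auto simp: congruence_sym[of P d B q] simp del: assoc_mult_mat)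
  moreover have "0 < x \<bullet> ((R + B\<^sup>T * P * B) *\<^sub>v x)"
    if x: "x \<in> carrier_vec q" "x \<noteq> 0\<^sub>v q" for x
  proof -
    have "x \<bullet> ((R + B\<^sup>T * P * B) *\<^sub>v x)
        = x \<bullet> (R *\<^sub>v x) + (B *\<^sub>v x) \<bullet> (P *\<^sub>v (B *\<^sub>v x))"
      by (rule hessian_form[OF c(1,2) B x(1) x(1)])
    moreover have "0 < x \<bullet> (R *\<^sub>v x)" using R x by (auto simp: pd_mat_def)
    moreover have "0 \<le> (B *\<^sub>v x) \<bullet> (P *\<^sub>v (B *\<^sub>v x))" using P B x by (auto simp: psd_mat_def)
    ultimately show ?thesis by linarith
  qed
  ultimately show ?thesis using c B by (auto simp: pd_mat_def)
qed

lemma pd_congruence: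
  assumes S: "pd_mat q S" and E: "E \<in> carrier_mat q r" "E\<^sup>T * E = 1\<^sub>m r"
  shows "pd_mat r (E\<^sup>T * S * E)"
proof -
  have c: "S \<in> carrier_mat q q" "S\<^sup>T = S" using S by (auto simp: pd_mat_def)
  have "0 < x \<bullet> (E\<^sup>T * S * E *\<^sub>v x)" if x: "x \<in> carrier_vec r" "x \<noteq> 0\<^sub>v r" for x
  proof -
    have "E *\<^sub>v x \<noteq> 0\<^sub>v q"
    proof
      assume a: "E *\<^sub>v x = 0\<^sub>v q"
      have "x = E\<^sup>T *\<^sub>v (E *\<^sub>v x)"
        using E x by (simp flip: assoc_mult_mat_vec[of _ r q _ r])
      then show False using a E x by auto
    qed
    then have "0 < (E *\<^sub>v x) \<bullet> (S *\<^sub>v (E *\<^sub>v x))" using S E x by (auto simp: pd_mat_def)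
    then show ?thesis using congruence_form[of S q E r x x] c E x by simp
  qed
  then show ?thesis using c E congruence_sym[of S q E r] by (auto simp: pd_mat_def)
qed

text \<open>
  This is Cauchy-Schwarz in the inner product given by \<open>S\<close>, for \<open>u\<close> and the solution \<open>v\<close> of
  \<open>S v = e\<^sub>a\<close>. The constant is the \<open>a\<close>-th diagonal entry of the inverse of \<open>S\<close>.
\<close>

lemma pd_coercive:
  assumes S: "pd_mat q S" and a: "a < q"
  shows "\<exists>c>0. \<forall>u\<in>carrier_vec q. (u $ a)\<^sup>2 \<le> c * (u \<bullet> (S *\<^sub>v u))"
proof -
  have c: "S \<in> carrier_mat q q" "S\<^sup>T = S" using S by (auto simp: pd_mat_def)
  note I = pd_mat_inverse[OF S]
  define v where "v = inv_mat S *\<^sub>v unit_vec q a"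
  have v: "v \<in> carrier_vec q" using I(1) by (auto simp: v_def)
  have Sv: "S *\<^sub>v v = unit_vec q a"
    unfolding v_def using I c by (simp flip: assoc_mult_mat_vec[of _ q q _ q])
  have va: "v \<bullet> (S *\<^sub>v v) = v $ a" using v a by (simp add: Sv)
  have "v \<noteq> 0\<^sub>v q"
  proof
    assume "v = 0\<^sub>v q"
    then have "unit_vec q a = (0\<^sub>v q :: real vec)" unfolding Sv[symmetric] using c by auto
    then have "unit_vec q a $ a = (0\<^sub>v q :: real vec) $ a" by simp
    then show False using a by simp
  qed
  then have pos: "0 < v $ a" using S v va by (metis pd_mat_def)
  have "(u $ a)\<^sup>2 \<le> v $ a * (u \<bullet> (S *\<^sub>v u))" if u: "u \<in> carrier_vec q" for u
  proof -
    \<comment> \<open>This \<open>t\<close> minimizes the form at \<open>u - t v\<close>.\<close>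
    define t where "t = u $ a / v $ a"
    define z where "z = u - t \<cdot>\<^sub>v v"
    have uSv: "u \<bullet> (S *\<^sub>v v) = u $ a" using u a by (simp add: Sv)
    have "0 \<le> z \<bullet> (S *\<^sub>v z)" using pd_form_nonneg[OF S] u v by (simp add: z_def)
    also have "z \<bullet> (S *\<^sub>v z) = u \<bullet> (S *\<^sub>v u) - t * (u \<bullet> (S *\<^sub>v v)) - t * (v \<bullet> (S *\<^sub>v u)) + t\<^sup>2 * (v \<bullet> (S *\<^sub>v v))"
      unfolding z_def using u v c
      by (simp add: mult_minus_distrib_mat_vec[of _ q q] minus_scalar_prod_distrib[of _ q]
          scalar_prod_minus_distrib[of _ q] mult_mat_vec[of _ q q] algebra_simps power2_eq_square)
    also have "v \<bullet> (S *\<^sub>v u) = u \<bullet> (S *\<^sub>v v)" using sym_form_swap[OF c v u] .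
    finally have "0 \<le> u \<bullet> (S *\<^sub>v u) - 2 * t * u $ a + t\<^sup>2 * v $ a"
      unfolding uSv va by (simp add: algebra_simps)
    moreover have "t * v $ a = u $ a" using pos by (simp add: t_def)
    ultimately have "t * u $ a \<le> u \<bullet> (S *\<^sub>v u)" by (simp add: power2_eq_square mult.assoc)
    then have "v $ a * (t * u $ a) \<le> v $ a * (u \<bullet> (S *\<^sub>v u))" using pos by simp
    moreover have "v $ a * (t * u $ a) = (u $ a)\<^sup>2" using pos by (simp add: t_def power2_eq_square)
    ultimately show ?thesis by simp
  qed
  then show ?thesis using pos by blast
qed

lemma gain_carrier:
  assumes "pd_mat q (R + B\<^sup>T * P * B)" "P \<in> carrier_mat d d" "B \<in> carrier_mat d q"
  shows "gain P B R \<in> carrier_mat q d"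
  using inv_mat_carrier[OF assms(1)] assms by (auto simp: gain_def)

text \<open>
  The input \<open>- K y\<close> with \<open>K\<close> the gain is a stationary point of the one-step cost
  \<open>s \<bullet> R s + (y + B s) \<bullet> P (y + B s)\<close>.
\<close>

lemma gain_stationary:
  assumes S: "pd_mat q (R + B\<^sup>T * P * B)" and P: "P \<in> carrier_mat d d"
    and B: "B \<in> carrier_mat d q" and R: "R \<in> carrier_mat q q" and y: "y \<in> carrier_vec d"
  shows "R *\<^sub>v (- (gain P B R *\<^sub>v y)) + B\<^sup>T *\<^sub>v (P *\<^sub>v (y + B *\<^sub>v (- (gain P B R *\<^sub>v y)))) = 0\<^sub>v q"
proof -
  let ?S = "R + B\<^sup>T * P * B" and ?I = "inv_mat (R + B\<^sup>T * P * B)"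
  define s where "s = - (gain P B R *\<^sub>v y)"
  have K: "gain P B R \<in> carrier_mat q d" by (rule gain_carrier[OF S P B])
  then have s: "s \<in> carrier_vec q" using y by (simp add: s_def)
  have I: "?I \<in> carrier_mat q q" by (rule inv_mat_carrier[OF S])
  have w: "B\<^sup>T *\<^sub>v (P *\<^sub>v y) \<in> carrier_vec q" using B P y by simp
  have "gain P B R *\<^sub>v y = ?I *\<^sub>v (B\<^sup>T *\<^sub>v (P *\<^sub>v y))"
    unfolding gain_def using I B P y
    by (simp add: assoc_mult_mat_vec[of _ q d _ d] assoc_mult_mat_vec[of _ q q _ d])
  then have "?S *\<^sub>v (gain P B R *\<^sub>v y) = ?S * ?I *\<^sub>v (B\<^sup>T *\<^sub>v (P *\<^sub>v y))"
    using I R B P w by (simp add: assoc_mult_mat_vec[of _ q q _ q])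
  also have "\<dots> = B\<^sup>T *\<^sub>v (P *\<^sub>v y)" using w by (simp add: inv_mat_right[OF S])
  finally have 1: "?S *\<^sub>v s = - (B\<^sup>T *\<^sub>v (P *\<^sub>v y))"
    unfolding s_def using K R B y by (subst mult_mat_uminus_vec[of _ q q]) auto
  have "?S *\<^sub>v s = R *\<^sub>v s + B\<^sup>T *\<^sub>v (P *\<^sub>v (B *\<^sub>v s))"
    using R B P s by (simp add: add_mult_distrib_mat_vec[of _ q q] assoc_mult_mat_vec[of _ q d _ q]
        assoc_mult_mat_vec[of _ d d _ q])
  moreover have "B\<^sup>T *\<^sub>v (P *\<^sub>v (y + B *\<^sub>v s))
      = B\<^sup>T *\<^sub>v (P *\<^sub>v y) + B\<^sup>T *\<^sub>v (P *\<^sub>v (B *\<^sub>v s))"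
    using B P s y by (simp add: mult_add_distrib_mat_vec[of _ d d] mult_add_distrib_mat_vec[of _ q d])
  ultimately have "R *\<^sub>v s + B\<^sup>T *\<^sub>v (P *\<^sub>v (y + B *\<^sub>v s))
      = ?S *\<^sub>v s + B\<^sup>T *\<^sub>v (P *\<^sub>v y)"
    using R B P s y by (intro eq_vecI) auto
  also have "\<dots> = 0\<^sub>v q" unfolding 1 using w by simp
  finally show ?thesis unfolding s_def .
qed

lemma riccati_carrier:
  assumes S: "pd_mat q (R + B\<^sup>T * P * B)" and P: "P \<in> carrier_mat d d"
    and B: "B \<in> carrier_mat d q" and A: "A \<in> carrier_mat d d"
  shows "riccati A P B R \<in> carrier_mat d d"
  using inv_mat_carrier[OF S] assms by (auto simp: riccati_def)

text \<open>
  The Riccati form is the form of \<open>P\<close> between the uncontrolled successor of \<open>v\<close> and the optimally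
  controlled successor of \<open>w\<close>.
\<close>

lemma riccati_form:
  assumes S: "pd_mat q (R + B\<^sup>T * P * B)" and P: "P \<in> carrier_mat d d"
    and B: "B \<in> carrier_mat d q" and A: "A \<in> carrier_mat d d"
    and v: "v \<in> carrier_vec d" and w: "w \<in> carrier_vec d"
  shows "v \<bullet> (riccati A P B R *\<^sub>v w) =
    (A *\<^sub>v v) \<bullet> (P *\<^sub>v (A *\<^sub>v w + B *\<^sub>v (- (gain P B R *\<^sub>v (A *\<^sub>v w)))))"
proof -
  let ?I = "inv_mat (R + B\<^sup>T * P * B)"
  have I: "?I \<in> carrier_mat q q" by (rule inv_mat_carrier[OF S])
  have K: "gain P B R \<in> carrier_mat q d" by (rule gain_carrier[OF S P B])
  have Aw: "A *\<^sub>v w \<in> carrier_vec d" using A w by simp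
  have eq: "P * B * ?I * B\<^sup>T * P = P * (B * gain P B R)"
    unfolding gain_def using I B P
    by (simp add: assoc_mult_mat[of _ d d _ q _ q] assoc_mult_mat[of _ d q _ q _ d]
        assoc_mult_mat[of _ d d _ q _ d] assoc_mult_mat[of _ d q _ d _ d] assoc_mult_mat[of _ d d _ d _ d]
        assoc_mult_mat[of _ q q _ d _ d])
  have c: "P - P * (B * gain P B R) \<in> carrier_mat d d"
    using P B K by (intro minus_carrier_mat mult_carrier_mat[of _ d d] mult_carrier_mat[of _ d q]) auto
  have "riccati A P B R = A\<^sup>T * (P - P * (B * gain P B R)) * A"
    unfolding riccati_def eq ..
  then have "v \<bullet> (riccati A P B R *\<^sub>v w) = (A *\<^sub>v v) \<bullet> ((P - P * (B * gain P B R)) *\<^sub>v (A *\<^sub>v w))"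
    using congruence_form[OF c A v w] by simp
  also have "(P - P * (B * gain P B R)) *\<^sub>v (A *\<^sub>v w)
      = P *\<^sub>v (A *\<^sub>v w) - P *\<^sub>v (B *\<^sub>v (gain P B R *\<^sub>v (A *\<^sub>v w)))"
    using P B K Aw by (simp add: minus_mult_distrib_mat_vec[of _ d d] assoc_mult_mat_vec[of _ d d _ d]
        assoc_mult_mat_vec[of _ d q _ d])
  also have "\<dots> = P *\<^sub>v (A *\<^sub>v w - B *\<^sub>v (gain P B R *\<^sub>v (A *\<^sub>v w)))"
    using P B K Aw by (simp add: mult_minus_distrib_mat_vec[of _ d d])
  also have "A *\<^sub>v w - B *\<^sub>v (gain P B R *\<^sub>v (A *\<^sub>v w)) = A *\<^sub>v w + B *\<^sub>v (- (gain P B R *\<^sub>v (A *\<^sub>v w)))"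
    using B K Aw A w by (simp add: mult_mat_uminus_vec[of _ d q] minus_add_uminus_vec[of _ d])
  finally show ?thesis .
qed

lemma riccati_sym:
  assumes S: "pd_mat q (R + B\<^sup>T * P * B)" and P: "P \<in> carrier_mat d d" "P\<^sup>T = P"
    and B: "B \<in> carrier_mat d q" and A: "A \<in> carrier_mat d d"
  shows "transpose_mat (riccati A P B R) = riccati A P B R"
proof -
  let ?I = "inv_mat (R + B\<^sup>T * P * B)"
  have I: "?I \<in> carrier_mat q q" "transpose_mat ?I = ?I"
    by (rule inv_mat_carrier[OF S], rule inv_mat_sym[OF S])
  define C where "C = B\<^sup>T * P"
  have C: "C \<in> carrier_mat q d" using B P by (simp add: C_def)
  have tC: "C\<^sup>T = P * B"
    unfolding C_def using B P by (subst transpose_mult[of _ q d _ d]) auto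
  have eq: "P * B * ?I * B\<^sup>T * P = C\<^sup>T * ?I * C"
    unfolding tC unfolding C_def
    by (rule assoc_mult_mat[of _ d q _ d _ d]) (use I B P in auto)
  have "transpose_mat (P - C\<^sup>T * ?I * C) = P - C\<^sup>T * ?I * C"
    using P C I congruence_sym[of ?I q C d] by (subst transpose_minus[of _ d d]) (auto simp del: assoc_mult_mat)
  then show ?thesis unfolding riccati_def eq using A P C I
    by (intro congruence_sym[of _ d]) auto
qed

text \<open>
  Completion of the square: the one-step cost of the input \<open>s + e\<close>, expanded around an arbitrary
  input \<open>s\<close>, where \<open>g\<close> is half the gradient at \<open>s\<close> and \<open>y\<close> the uncontrolled successor.
\<close>

lemma one_step_cost_expand:
  fixes P R B :: "real mat"
  assumes P: "P \<in> carrier_mat d d" "P\<^sup>T = P" and R: "R \<in> carrier_mat q q" "R\<^sup>T = R"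
    and B: "B \<in> carrier_mat d q" and y: "y \<in> carrier_vec d"
    and s: "s \<in> carrier_vec q" and e: "e \<in> carrier_vec q"
    and g: "g = R *\<^sub>v s + B\<^sup>T *\<^sub>v (P *\<^sub>v (y + B *\<^sub>v s))"
  shows "(s + e) \<bullet> (R *\<^sub>v (s + e)) + (y + B *\<^sub>v (s + e)) \<bullet> (P *\<^sub>v (y + B *\<^sub>v (s + e)))
    = e \<bullet> ((R + B\<^sup>T * P * B) *\<^sub>v e) + 2 * (e \<bullet> g) + s \<bullet> g + y \<bullet> (P *\<^sub>v (y + B *\<^sub>v s))"
proof -
  define c where "c = y + B *\<^sub>v s"
  have c: "c \<in> carrier_vec d" using y B s by (simp add: c_def)
  have Be: "B *\<^sub>v e \<in> carrier_vec d" "B *\<^sub>v s \<in> carrier_vec d" using B e s by auto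
  have eq: "y + B *\<^sub>v (s + e) = c + B *\<^sub>v e"
    unfolding c_def using y B s e by (simp add: mult_add_distrib_mat_vec[of _ d q])
  have 1: "(s + e) \<bullet> (R *\<^sub>v (s + e)) = s \<bullet> (R *\<^sub>v s) + 2 * (e \<bullet> (R *\<^sub>v s)) + e \<bullet> (R *\<^sub>v e)"
    using R s e sym_form_swap[OF R s e]
    by (simp add: mult_add_distrib_mat_vec[of _ q q] add_scalar_prod_distrib[of _ q] scalar_prod_add_distrib[of _ q])
  have 2: "(c + B *\<^sub>v e) \<bullet> (P *\<^sub>v (c + B *\<^sub>v e)) =
      c \<bullet> (P *\<^sub>v c) + 2 * ((B *\<^sub>v e) \<bullet> (P *\<^sub>v c)) + (B *\<^sub>v e) \<bullet> (P *\<^sub>v (B *\<^sub>v e))"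
    using P c Be sym_form_swap[OF P c Be(1)]
    by (simp add: mult_add_distrib_mat_vec[of _ d d] add_scalar_prod_distrib[of _ d] scalar_prod_add_distrib[of _ d])
  have 3: "v \<bullet> g = v \<bullet> (R *\<^sub>v s) + (B *\<^sub>v v) \<bullet> (P *\<^sub>v c)" if "v \<in> carrier_vec q" for v
    unfolding g c_def[symmetric] using that R B P s c
    by (simp add: scalar_prod_add_distrib[of _ q] transpose_form[of B d q])
  have 4: "e \<bullet> ((R + B\<^sup>T * P * B) *\<^sub>v e) = e \<bullet> (R *\<^sub>v e) + (B *\<^sub>v e) \<bullet> (P *\<^sub>v (B *\<^sub>v e))"
    by (rule hessian_form[OF R(1) P(1) B e e])
  have 5: "c \<bullet> (P *\<^sub>v c) = y \<bullet> (P *\<^sub>v c) + (B *\<^sub>v s) \<bullet> (P *\<^sub>v c)"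
    using y Be P c by (subst c_def) (simp add: add_scalar_prod_distrib[of _ d])
  show ?thesis unfolding eq 1 2 4 3[OF e] 3[OF s] c_def[symmetric] using 5 by simp
qed

lemma real_scalar_prod_nonneg: "0 \<le> v \<bullet> v" for v :: "real vec"
  by (auto simp: scalar_prod_def intro!: sum_nonneg)

lemma real_scalar_prod_eq_0:
  fixes v :: "real vec"
  assumes "v \<in> carrier_vec c" "v \<bullet> v = 0"
  shows "v = 0\<^sub>v c"
proof (rule eq_vecI)
  fix a assume "a < dim_vec (0\<^sub>v c :: real vec)"
  moreover have "\<forall>a\<in>{0..<dim_vec v}. v $ a * v $ a = 0"
    using assms(2) unfolding scalar_prod_def by (subst (asm) sum_nonneg_eq_0_iff) auto
  ultimately show "v $ a = 0\<^sub>v c $ a" using assms(1) by auto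
qed (use assms in auto)

section \<open>Block structure\<close>

lemma offset_Suc [simp]: "offset d (Suc i) = offset d i + d i"
  by (simp add: offset_def)

lemma offset_0 [simp]: "offset d 0 = 0"
  by (simp add: offset_def)

lemma offset_mono: "i \<le> j \<Longrightarrow> offset d i \<le> offset d j"
  unfolding offset_def by (rule sum_mono2) auto

lemma offset_add_le: "i < N \<Longrightarrow> offset d i + d i \<le> offset d N"
  using offset_mono[of "Suc i" N d] by simp

lemma offset_add_less: "i < N \<Longrightarrow> b < d i \<Longrightarrow> offset d i + b < offset d N"
  using offset_add_le[of i N d] by simp

text \<open>The next two lemmas say that every index lies in exactly one block.\<close>

lemma offset_cases:
  assumes "a < offset d N"
  obtains i b where "i < N" "b < d i" "a = offset d i + b"
proof -
  have "\<exists>i<N. \<exists>b<d i. a = offset d i + b" using assms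
  proof (induction N)
    case (Suc N)
    show ?case
    proof (cases "a < offset d N")
      case True
      then show ?thesis using Suc.IH less_SucI by blast
    next
      case False
      then show ?thesis using Suc.prems by (intro exI[of _ N] conjI exI[of _ "a - offset d N"]) auto
    qed
  qed simp
  then show ?thesis using that by blast
qed

lemma offset_inj:
  assumes "offset d i + b = offset d j + c" "b < d i" "c < d j"
  shows "i = j" "b = c"
proof -
  have False if "i < j" "offset d i + b = offset d j + c" "b < d i" for i j b c
    using that offset_add_less[of i j b d] by simp
  from this[of i j b c] this[of j i c b] assms show "i = j" by (cases i j rule: linorder_cases) auto
  then show "b = c" using assms by simp
qed

lemma stack_vec_0 [simp]: "stack_vec 0 f = 0\<^sub>v 0"
  by (simp add: stack_vec_def)

lemma foldr_append_vec:
  "foldr (@\<^sub>v) xs v = foldr (@\<^sub>v) xs (0\<^sub>v 0) @\<^sub>v (v :: real vec)"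
proof (induction xs)
  case Nil
  show ?case by (intro eq_vecI) auto
next
  case (Cons x xs)
  show ?case by (simp only: foldr.simps o_apply Cons[of] , intro eq_vecI) auto
qed

lemma stack_vec_Suc [simp]: "stack_vec (Suc N) f = stack_vec N f @\<^sub>v f N"
proof -
  have "f N @\<^sub>v 0\<^sub>v 0 = f N" by (intro eq_vecI) auto
  then show ?thesis
    unfolding stack_vec_def by (simp add: foldr_append_vec[of _ "f N"])
qed

lemma stack_vec_cong: "(\<And>i. i < N \<Longrightarrow> f i = g i) \<Longrightarrow> stack_vec N f = stack_vec N g"
  by (induction N) auto

lemma stack_vec_carrier:
  "(\<And>i. i < N \<Longrightarrow> f i \<in> carrier_vec (d i)) \<Longrightarrow> stack_vec N f \<in> carrier_vec (offset d N)"
  by (induction N) auto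

lemma stack_vec_index:
  assumes "\<And>i. i < N \<Longrightarrow> f i \<in> carrier_vec (d i)" "i < N" "b < d i"
  shows "stack_vec N f $ (offset d i + b) = f i $ b"
  using assms
proof (induction N)
  case (Suc N)
  have c: "stack_vec N f \<in> carrier_vec (offset d N)" "f N \<in> carrier_vec (d N)"
    using Suc.prems by (auto intro: stack_vec_carrier)
  show ?case
  proof (cases "i = N")
    case True
    then show ?thesis using Suc.prems(3) by (simp add: carrier_vecD[OF c(1)] carrier_vecD[OF c(2)])
  next
    case False
    then have "i < N" using Suc.prems by simp
    then show ?thesis using Suc offset_add_less[of i N b d]
      by (simp add: carrier_vecD[OF c(1)] carrier_vecD[OF c(2)])
  qed
qed simp

lemma stack_vec_add:
  assumes "\<And>i. i < N \<Longrightarrow> f i \<in> carrier_vec (d i)" "\<And>i. i < N \<Longrightarrow> g i \<in> carrier_vec (d i)"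
  shows "stack_vec N f + stack_vec N g = stack_vec N (\<lambda>i. f i + g i)"
  using assms
proof (induction N)
  case (Suc N)
  have "stack_vec N f \<in> carrier_vec (offset d N)" "stack_vec N g \<in> carrier_vec (offset d N)"
    using Suc.prems by (auto intro: stack_vec_carrier)
  then show ?case using Suc by (simp add: append_vec_add[of _ "offset d N" _ _ "d N"])
qed (auto intro!: eq_vecI)

lemma stack_vec_uminus:
  assumes f: "\<And>i. i < N \<Longrightarrow> f i \<in> carrier_vec (d i)"
  shows "- stack_vec N f = stack_vec N (\<lambda>i. - f i)"
  using f
proof (induction N)
  case (Suc N)
  have "stack_vec N f \<in> carrier_vec (offset d N)" "f N \<in> carrier_vec (d N)"
    using Suc.prems by (auto intro: stack_vec_carrier)
  then have "- (stack_vec N f @\<^sub>v f N) = - stack_vec N f @\<^sub>v - f N" by (intro eq_vecI) auto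
  then show ?case using Suc by simp
qed (auto intro!: eq_vecI)

lemma append_rows_index:
  fixes X Y :: "real mat"
  assumes "X \<in> carrier_mat r1 c" "Y \<in> carrier_mat r2 c" "i < r1 + r2" "j < c"
  shows "(X @\<^sub>r Y) $$ (i, j) = (if i < r1 then X $$ (i, j) else Y $$ (i - r1, j))"
  using assms unfolding append_rows_def by (subst index_mat_four_block(1)) auto

text \<open>The carrier and the entries of the stack of the matrices number \<open>s\<close> to \<open>N - 1\<close>, by induction from the top.\<close>

lemma stack_mat_aux:
  fixes f :: "nat \<Rightarrow> real mat"
  assumes f: "\<And>i. i < N \<Longrightarrow> f i \<in> carrier_mat (d i) c" and s: "s \<le> N"
  defines "F \<equiv> \<lambda>s. foldr (@\<^sub>r) (map f [s..<N]) (0\<^sub>m 0 c)"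
  shows "F s \<in> carrier_mat (offset d N - offset d s) c \<and>
    (\<forall>i b l. s \<le> i \<longrightarrow> i < N \<longrightarrow> b < d i \<longrightarrow> l < c \<longrightarrow> F s $$ (offset d i - offset d s + b, l) = f i $$ (b, l))"
  using s
proof (induction rule: inc_induct)
  case base
  show ?case by (simp add: F_def)
next
  case (step s)
  have F: "F s = f s @\<^sub>r F (Suc s)" using step.hyps by (simp add: F_def upt_conv_Cons)
  have fs: "f s \<in> carrier_mat (d s) c" and Fs: "F (Suc s) \<in> carrier_mat (offset d N - offset d (Suc s)) c"
    using f step by auto
  have dim: "d s + (offset d N - offset d (Suc s)) = offset d N - offset d s"
    using offset_mono[of "Suc s" N d] step.hyps by simp
  have "F s $$ (offset d i - offset d s + b, l) = f i $$ (b, l)"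
    if i: "s \<le> i" "i < N" "b < d i" "l < c" for i b l
  proof (cases "i = s")
    case True
    then show ?thesis unfolding F using i by (subst append_rows_index[OF fs Fs]) auto
  next
    case False
    then have le: "Suc s \<le> i" using i by simp
    have "offset d i - offset d s + b = d s + (offset d i - offset d (Suc s) + b)"
      using offset_mono[OF le, of d] by simp
    moreover have "offset d i - offset d (Suc s) + b < offset d N - offset d (Suc s)"
      using offset_mono[OF le, of d] offset_add_less[of i N b d] i by simp
    ultimately show ?thesis
      unfolding F using append_rows_index[OF fs Fs, of "offset d i - offset d s + b" l] step.IH i le by simp
  qed
  then show ?case using carrier_append_rows[OF fs Fs] unfolding dim F by blast
qed

lemma stack_mat_carrier:
  "(\<And>i. i < N \<Longrightarrow> f i \<in> carrier_mat (d i) c) \<Longrightarrow> stack_mat c N f \<in> carrier_mat (offset d N) c"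
  using stack_mat_aux[of N f d c 0] by (simp add: stack_mat_def)

lemma stack_mat_index:
  assumes "\<And>i. i < N \<Longrightarrow> f i \<in> carrier_mat (d i) c" "i < N" "b < d i" "l < c"
  shows "stack_mat c N f $$ (offset d i + b, l) = f i $$ (b, l)"
  using stack_mat_aux[of N f d c 0] assms by (simp add: stack_mat_def)

lemma stack_mat_mult_vec:
  assumes f: "\<And>i. i < N \<Longrightarrow> f i \<in> carrier_mat (d i) c" and x: "x \<in> carrier_vec c"
  shows "stack_mat c N f *\<^sub>v x = stack_vec N (\<lambda>i. f i *\<^sub>v x)"
proof (rule eq_vecI)
  note S = carrier_matD[OF stack_mat_carrier[of N f d c, OF f]]
  have fx: "f i *\<^sub>v x \<in> carrier_vec (d i)" if "i < N" for i using mv_carrier[OF f[OF that] x] .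
  note V = carrier_vecD[OF stack_vec_carrier[of N _ d, OF fx]]
  show "dim_vec (stack_mat c N f *\<^sub>v x) = dim_vec (stack_vec N (\<lambda>i. f i *\<^sub>v x))" by (simp add: S V)
  fix a assume "a < dim_vec (stack_vec N (\<lambda>i. f i *\<^sub>v x))"
  then have "a < offset d N" by (simp add: V)
  then obtain j b where a: "j < N" "b < d j" "a = offset d j + b" by (rule offset_cases)
  have "(stack_mat c N f *\<^sub>v x) $ a = (f j *\<^sub>v x) $ b"
    using a \<open>a < offset d N\<close> x stack_mat_index[of N f d c j b] f
    by (simp add: S scalar_prod_def carrier_matD[OF f[OF a(1)]])
  then show "(stack_mat c N f *\<^sub>v x) $ a = stack_vec N (\<lambda>i. f i *\<^sub>v x) $ a"
    unfolding a(3) using a stack_vec_index[of N "\<lambda>i. f i *\<^sub>v x" d j b] fx by simp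
qed

lemma block_row_carrier [simp]: "S \<in> carrier_mat r c \<Longrightarrow> block_row d i S \<in> carrier_mat (d i) c"
  by (simp add: block_row_def)

lemma stack_mat_block_row:
  assumes "S \<in> carrier_mat (offset d N) c"
  shows "stack_mat c N (\<lambda>i. block_row d i S) = S"
proof -
  have c: "stack_mat c N (\<lambda>i. block_row d i S) \<in> carrier_mat (offset d N) c"
    using assms by (intro stack_mat_carrier) auto
  show ?thesis
  proof (rule eq_matI)
    fix a l assume "a < dim_row S" "l < dim_col S"
    then have a: "a < offset d N" "l < c" using assms by auto
    then obtain j b where j: "j < N" "b < d j" "a = offset d j + b" by (blast elim: offset_cases)
    show "stack_mat c N (\<lambda>i. block_row d i S) $$ (a, l) = S $$ (a, l)"
      unfolding j(3) using assms j(1,2) a by (subst stack_mat_index[of N _ d c]) (auto simp: block_row_def)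
  qed (use c assms in auto)
qed

section \<open>Block diagonal matrices\<close>

lemma diag_blocks_carrier:
  assumes "\<And>i. i < N \<Longrightarrow> f i \<in> carrier_mat (r i) (c i)"
  shows "diag_blocks N f \<in> carrier_mat (offset r N) (offset c N)"
proof -
  have "map dim_row (map f [0..<N]) = map r [0..<N]" "map dim_col (map f [0..<N]) = map c [0..<N]"
    using carrier_matD[OF assms] by auto
  then show ?thesis unfolding diag_blocks_def
    by (intro carrier_matI) (auto simp: dim_diag_block_mat offset_def interv_sum_list_conv_sum_set_nat atLeast0LessThan)
qed

lemma diag_blocks_form:
  assumes "\<And>i. i < N \<Longrightarrow> F i \<in> carrier_mat (d i) (d i)"
    and "\<And>i. i < N \<Longrightarrow> v i \<in> carrier_vec (d i)" "\<And>i. i < N \<Longrightarrow> w i \<in> carrier_vec (d i)"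
  shows "stack_vec N v \<bullet> (diag_blocks N F *\<^sub>v stack_vec N w) = (\<Sum>i<N. v i \<bullet> (F i *\<^sub>v w i))"
  using assms
proof (induction N)
  case 0
  then show ?case by (simp add: diag_blocks_def scalar_prod_def)
next
  case (Suc N)
  let ?D = "diag_blocks N F"
  have D: "?D \<in> carrier_mat (offset d N) (offset d N)" "F N \<in> carrier_mat (d N) (d N)"
    using Suc.prems(1) by (auto intro: diag_blocks_carrier)
  have vw: "stack_vec N v \<in> carrier_vec (offset d N)" "v N \<in> carrier_vec (d N)"
     "stack_vec N w \<in> carrier_vec (offset d N)" "w N \<in> carrier_vec (d N)"
    using Suc.prems(2,3) by (auto intro: stack_vec_carrier)
  have "diag_blocks (Suc N) F = four_block_mat ?D (0\<^sub>m (offset d N) (d N)) (0\<^sub>m (d N) (offset d N)) (F N)"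
    unfolding diag_blocks_def using D
    by (simp add: diag_block_mat_last Let_def diag_blocks_def)
  then have "diag_blocks (Suc N) F *\<^sub>v (stack_vec N w @\<^sub>v w N) = (?D *\<^sub>v stack_vec N w) @\<^sub>v (F N *\<^sub>v w N)"
    using D vw by (simp only: mult_mat_vec_split)
  then show ?case
    using Suc scalar_prod_append[OF vw(1,2) mv_carrier[OF D(1) vw(3)] mv_carrier[OF D(2) vw(4)]]
    by simp
qed

text \<open>
  The matrix of the isometric embedding of block \<open>i\<close> into the total space. Its transpose extracts
  block \<open>i\<close> of a vector, which turns all statements about blocks into matrix identities.
\<close>

definition block_embed :: "(nat \<Rightarrow> nat) \<Rightarrow> nat \<Rightarrow> nat \<Rightarrow> real mat" where
  "block_embed d N i = mat (offset d N) (d i) (\<lambda>(a, b). if a = offset d i + b then 1 else 0)"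

lemma block_embed_carrier [simp]: "block_embed d N i \<in> carrier_mat (offset d N) (d i)"
  by (simp add: block_embed_def)

lemma dim_block_embed [simp]:
  "dim_row (block_embed d N i) = offset d N" "dim_col (block_embed d N i) = d i"
  by (simp_all add: block_embed_def)

lemma col_block_embed:
  "i < N \<Longrightarrow> b < d i \<Longrightarrow> col (block_embed d N i) b = unit_vec (offset d N) (offset d i + b)"
  by (intro eq_vecI) (auto simp: block_embed_def unit_vec_def)

lemma block_embed_transpose_mult:
  assumes "i < N" "v \<in> carrier_vec (offset d N)"
  shows "(block_embed d N i)\<^sup>T *\<^sub>v v = vec (d i) (\<lambda>b. v $ (offset d i + b))"
  using assms offset_add_less[of i N _ d] block_embed_carrier[of d N i]
  by (intro eq_vecI) (auto simp: col_block_embed)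

lemma block_embed_isometry:
  assumes "i < N"
  shows "(block_embed d N i)\<^sup>T * block_embed d N i = 1\<^sub>m (d i)"
proof (rule eq_matI)
  fix a b assume "a < dim_row (1\<^sub>m (d i))" "b < dim_col (1\<^sub>m (d i))"
  then show "((block_embed d N i)\<^sup>T * block_embed d N i) $$ (a, b) = 1\<^sub>m (d i) $$ (a, b)"
    using assms block_embed_carrier[of d N i] offset_add_less[of i N _ d]
    by (auto simp: col_block_embed)
qed (use block_embed_carrier[of d N i] in auto)

lemma block_embed_mult_index:
  assumes "i < N" "w \<in> carrier_vec (d i)" "j < N" "b < d j"
  shows "(block_embed d N i *\<^sub>v w) $ (offset d j + b) = (if j = i then w $ b else 0)"
proof -
  have "(block_embed d N i *\<^sub>v w) $ (offset d j + b) =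
      (\<Sum>c<d i. (if offset d j + b = offset d i + c then 1 else 0) * w $ c)"
    using assms offset_add_less[of j N b d] by (simp add: block_embed_def scalar_prod_def atLeast0LessThan)
  also have "\<dots> = (\<Sum>c<d i. if j = i \<and> c = b then w $ b else 0)"
  proof (intro sum.cong refl)
    fix c assume "c \<in> {..<d i}"
    then have "offset d j + b = offset d i + c \<longleftrightarrow> j = i \<and> c = b"
      using offset_inj[of d j b i c] assms by auto
    then show "(if offset d j + b = offset d i + c then 1 else 0) * w $ c = (if j = i \<and> c = b then w $ b else 0)"
      by auto
  qed
  also have "\<dots> = (if j = i then w $ b else 0)" using assms by (auto simp: sum.delta)
  finally show ?thesis .
qed

lemma block_col_eq:
  assumes "B \<in> carrier_mat r (offset d N)" "i < N"
  shows "block_col d i B = B * block_embed d N i"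
  using assms offset_add_less[of i N _ d] block_embed_carrier[of d N i]
  by (intro eq_matI) (auto simp: block_col_def col_block_embed)

lemma block_row_mult_vec:
  assumes "S \<in> carrier_mat (offset d N) c" "x \<in> carrier_vec c" "i < N"
  shows "block_row d i S *\<^sub>v x = (block_embed d N i)\<^sup>T *\<^sub>v (S *\<^sub>v x)"
  using assms offset_add_less[of i N _ d] block_row_carrier[of S "offset d N" c d i]
  by (subst block_embed_transpose_mult) (auto intro!: eq_vecI simp: block_row_def scalar_prod_def)

lemma only_block_row_mult_vec:
  assumes "S \<in> carrier_mat (offset d N) c" "i < N" "x \<in> carrier_vec c"
  shows "only_block_row d i S *\<^sub>v x = block_embed d N i *\<^sub>v (block_row d i S *\<^sub>v x)"
proof (rule eq_vecI)
  fix a assume "a < dim_vec (block_embed d N i *\<^sub>v (block_row d i S *\<^sub>v x))"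
  then have "a < offset d N" by (simp add: block_embed_def)
  then obtain j b where a: "j < N" "b < d j" "a = offset d j + b" by (rule offset_cases)
  have lt: "a < offset d N" using a offset_add_less by blast
  have iff: "(offset d i \<le> a \<and> a < offset d i + d i) \<longleftrightarrow> j = i"
  proof
    assume "offset d i \<le> a \<and> a < offset d i + d i"
    then show "j = i" using offset_inj(1)[of d j b i "a - offset d i"] a by force
  qed (use a in auto)
  have w: "block_row d i S *\<^sub>v x \<in> carrier_vec (d i)" using assms by (auto intro: mv_carrier[OF block_row_carrier])
  show "(only_block_row d i S *\<^sub>v x) $ a = (block_embed d N i *\<^sub>v (block_row d i S *\<^sub>v x)) $ a"
    unfolding a(3) block_embed_mult_index[OF assms(2) w a(1,2)] unfolding a(3)[symmetric]
    using assms lt a iff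
    by (auto simp: only_block_row_def block_row_def scalar_prod_def)
qed (use assms in \<open>auto simp: only_block_row_def block_embed_def\<close>)

section \<open>Finite sums of vectors\<close>

text \<open>
  The sum of \<open>f 0, \<dots>, f (N - 1)\<close>. The dimension \<open>d\<close> is an argument because vectors of all dimensions
  share one type, which has no common zero.
\<close>

definition vec_sum :: "nat \<Rightarrow> (nat \<Rightarrow> real vec) \<Rightarrow> nat \<Rightarrow> real vec" where
  "vec_sum d f N = vec d (\<lambda>a. \<Sum>i<N. f i $ a)"

lemma vec_sum_carrier [simp]: "vec_sum d f N \<in> carrier_vec d"
  by (simp add: vec_sum_def)

lemma vec_sum_form:
  assumes "G \<in> carrier_mat r c" "\<And>i. i < N \<Longrightarrow> f i \<in> carrier_vec r" "w \<in> carrier_vec c"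
  shows "vec_sum r f N \<bullet> (G *\<^sub>v w) = (\<Sum>i<N. f i \<bullet> (G *\<^sub>v w))"
proof -
  have "vec_sum r f N \<bullet> (G *\<^sub>v w) = (\<Sum>a<r. \<Sum>i<N. f i $ a * (G *\<^sub>v w) $ a)"
    using assms(1) by (auto simp: scalar_prod_def vec_sum_def sum_distrib_right atLeast0LessThan intro!: sum.cong)
  also have "\<dots> = (\<Sum>i<N. f i \<bullet> (G *\<^sub>v w))"
    using assms(1) by (subst sum.swap) (auto simp: scalar_prod_def atLeast0LessThan simp del: index_mult_mat_vec)
  finally show ?thesis .
qed

lemma scalar_prod_vec_sum:
  assumes "\<And>i. i < N \<Longrightarrow> f i \<in> carrier_vec c" "w \<in> carrier_vec c"
  shows "w \<bullet> vec_sum c f N = (\<Sum>i<N. w \<bullet> f i)"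
proof -
  have "w \<bullet> vec_sum c f N = (\<Sum>a<c. \<Sum>i<N. w $ a * f i $ a)"
    by (simp add: scalar_prod_def vec_sum_def sum_distrib_left atLeast0LessThan)
  also have "\<dots> = (\<Sum>i<N. w \<bullet> f i)"
    using carrier_vecD[OF assms(1)] by (subst sum.swap) (simp add: scalar_prod_def atLeast0LessThan)
  finally show ?thesis .
qed

lemma mult_mat_vec_sum:
  assumes "G \<in> carrier_mat r c" "\<And>i. i < N \<Longrightarrow> f i \<in> carrier_vec c"
  shows "G *\<^sub>v vec_sum c f N = vec_sum r (\<lambda>i. G *\<^sub>v f i) N"
proof (rule eq_vecI)
  fix a assume "a < dim_vec (vec_sum r (\<lambda>i. G *\<^sub>v f i) N)"
  then have a: "a < r" by (simp add: vec_sum_def)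
  then have "(G *\<^sub>v vec_sum c f N) $ a = row G a \<bullet> vec_sum c f N" using assms by simp
  also have "\<dots> = (\<Sum>i<N. row G a \<bullet> f i)"
    using assms(1) a by (intro scalar_prod_vec_sum assms(2)) auto
  finally show "(G *\<^sub>v vec_sum c f N) $ a = vec_sum r (\<lambda>i. G *\<^sub>v f i) N $ a"
    using a assms(1) by (simp add: vec_sum_def)
qed (use assms in \<open>auto simp: vec_sum_def\<close>)

lemma vec_sum_add:
  assumes "\<And>i. i < N \<Longrightarrow> f i \<in> carrier_vec c" "\<And>i. i < N \<Longrightarrow> g i \<in> carrier_vec c"
  shows "vec_sum c f N + vec_sum c g N = vec_sum c (\<lambda>i. f i + g i) N"
proof (rule eq_vecI)
  fix a assume "a < dim_vec (vec_sum c (\<lambda>i. f i + g i) N)"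
  then have "a < c" by (simp add: vec_sum_def)
  then show "(vec_sum c f N + vec_sum c g N) $ a = vec_sum c (\<lambda>i. f i + g i) N $ a"
    using carrier_vecD[OF assms(2)] by (simp add: vec_sum_def flip: sum.distrib)
qed (simp add: vec_sum_def)

lemma stack_vec_eq_vec_sum:
  assumes "\<And>i. i < N \<Longrightarrow> f i \<in> carrier_vec (d i)"
  shows "stack_vec N f = vec_sum (offset d N) (\<lambda>i. block_embed d N i *\<^sub>v f i) N"
proof (rule eq_vecI)
  fix a assume "a < dim_vec (vec_sum (offset d N) (\<lambda>i. block_embed d N i *\<^sub>v f i) N)"
  then have "a < offset d N" by (simp add: vec_sum_def)
  then obtain j b where a: "j < N" "b < d j" "a = offset d j + b" by (rule offset_cases)
  have "(\<Sum>i<N. (block_embed d N i *\<^sub>v f i) $ a) = (\<Sum>i<N. if j = i then f i $ b else 0)"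
    unfolding a(3) using assms a by (intro sum.cong refl block_embed_mult_index) auto
  also have "\<dots> = f j $ b" using a by (simp add: sum.delta')
  finally show "stack_vec N f $ a = vec_sum (offset d N) (\<lambda>i. block_embed d N i *\<^sub>v f i) N $ a"
    using \<open>a < offset d N\<close> stack_vec_index[of N f d j b] a assms by (simp add: vec_sum_def)
qed (use carrier_vecD[OF stack_vec_carrier[of N f d, OF assms]] in \<open>auto simp: vec_sum_def\<close>)

lemma stack_vec_scalar_prod:
  assumes "\<And>i. i < N \<Longrightarrow> f i \<in> carrier_vec (d i)" "g \<in> carrier_vec (offset d N)"
  shows "stack_vec N f \<bullet> g = (\<Sum>i<N. f i \<bullet> ((block_embed d N i)\<^sup>T *\<^sub>v g))"
proof -
  have "stack_vec N f \<bullet> g = (\<Sum>i<N. (block_embed d N i *\<^sub>v f i) \<bullet> (1\<^sub>m (offset d N) *\<^sub>v g))"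
    using assms vec_sum_form[of "1\<^sub>m (offset d N)" "offset d N" "offset d N" N "\<lambda>i. block_embed d N i *\<^sub>v f i" g]
    by (simp add: stack_vec_eq_vec_sum[of N f d] mv_carrier[OF block_embed_carrier])
  also have "\<dots> = (\<Sum>i<N. f i \<bullet> ((block_embed d N i)\<^sup>T *\<^sub>v g))"
    using assms by (intro sum.cong refl) (simp add: transpose_form[OF block_embed_carrier])
  finally show ?thesis .
qed

lemma mult_vec_eq_vec_sum:
  assumes "S \<in> carrier_mat (offset d N) c" "x \<in> carrier_vec c"
  shows "S *\<^sub>v x = vec_sum (offset d N) (\<lambda>i. only_block_row d i S *\<^sub>v x) N"
proof -
  have "S *\<^sub>v x = stack_mat c N (\<lambda>i. block_row d i S) *\<^sub>v x"
    using assms by (simp add: stack_mat_block_row)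
  also have "\<dots> = stack_vec N (\<lambda>i. block_row d i S *\<^sub>v x)"
    using assms by (intro stack_mat_mult_vec[of _ _ d]) auto
  also have "\<dots> = vec_sum (offset d N) (\<lambda>i. block_embed d N i *\<^sub>v (block_row d i S *\<^sub>v x)) N"
    using assms by (intro stack_vec_eq_vec_sum mv_carrier[OF block_row_carrier]) auto
  also have "\<dots> = vec_sum (offset d N) (\<lambda>i. only_block_row d i S *\<^sub>v x) N"
    unfolding vec_sum_def using assms by (simp add: only_block_row_mult_vec)
  finally show ?thesis .
qed

lemma form_expand:
  fixes Z :: "real mat"
  assumes "Z \<in> carrier_mat r c" "v \<in> carrier_vec r" "w \<in> carrier_vec c"
  shows "v \<bullet> (Z *\<^sub>v w) = (\<Sum>a<r. \<Sum>b<c. v $ a * w $ b * Z $$ (a, b))"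
  using assms by (auto simp: scalar_prod_def atLeast0LessThan sum_distrib_left intro!: sum.cong)

lemma mat_sum_form:
  assumes v: "v \<in> carrier_vec r" and w: "w \<in> carrier_vec c" and F: "\<And>i. i < N \<Longrightarrow> F i \<in> carrier_mat r c"
  shows "v \<bullet> (mat_sum r c F {..<N} *\<^sub>v w) = (\<Sum>i<N. v \<bullet> (F i *\<^sub>v w))"
proof -
  have S: "mat_sum r c F {..<N} \<in> carrier_mat r c" by (simp add: mat_sum_def)
  have "v \<bullet> (mat_sum r c F {..<N} *\<^sub>v w) = (\<Sum>a<r. \<Sum>b<c. \<Sum>i<N. v $ a * w $ b * F i $$ (a, b))"
    unfolding form_expand[OF S v w] by (simp add: mat_sum_def sum_distrib_left)
  also have "\<dots> = (\<Sum>a<r. \<Sum>i<N. \<Sum>b<c. v $ a * w $ b * F i $$ (a, b))"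
    by (intro sum.cong refl sum.swap)
  also have "\<dots> = (\<Sum>i<N. \<Sum>a<r. \<Sum>b<c. v $ a * w $ b * F i $$ (a, b))" by (rule sum.swap)
  also have "\<dots> = (\<Sum>i<N. v \<bullet> (F i *\<^sub>v w))" by (intro sum.cong refl form_expand[symmetric] F v w) auto
  finally show ?thesis .
qed

lemma unit_vec_form:
  fixes X :: "real mat"
  assumes "X \<in> carrier_mat r c" "a < r" "b < c"
  shows "unit_vec r a \<bullet> (X *\<^sub>v unit_vec c b) = X $$ (a, b)"
  using assms by simp

lemma mat_eq_by_forms:
  fixes X Y :: "real mat"
  assumes "X \<in> carrier_mat r c" "Y \<in> carrier_mat r c"
    and "\<And>v w. v \<in> carrier_vec r \<Longrightarrow> w \<in> carrier_vec c \<Longrightarrow> v \<bullet> (X *\<^sub>v w) = v \<bullet> (Y *\<^sub>v w)"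
  shows "X = Y"
proof (rule eq_matI)
  fix a b assume "a < dim_row Y" "b < dim_col Y"
  then have "a < r" "b < c" using assms(2) by auto
  then show "X $$ (a, b) = Y $$ (a, b)"
    using assms(3)[of "unit_vec r a" "unit_vec c b"] unit_vec_form[OF assms(1)] unit_vec_form[OF assms(2)] by simp
qed (use assms in auto)

lemma diag_blocks_block:
  assumes "\<And>i. i < N \<Longrightarrow> F i \<in> carrier_mat (d i) (d i)" "i < N"
  shows "(block_embed d N i)\<^sup>T * diag_blocks N F * block_embed d N i = F i"
proof (rule mat_eq_by_forms)
  let ?D = "diag_blocks N F"
  have D: "?D \<in> carrier_mat (offset d N) (offset d N)" using assms by (intro diag_blocks_carrier)
  show "(block_embed d N i)\<^sup>T * ?D * block_embed d N i \<in> carrier_mat (d i) (d i)"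
    by (intro mult_carrier_mat[of _ _ "offset d N"]) (use D block_embed_carrier in auto)
  show "F i \<in> carrier_mat (d i) (d i)" using assms by simp
  fix v w :: "real vec" assume vw: "v \<in> carrier_vec (d i)" "w \<in> carrier_vec (d i)"
  \<comment> \<open>\<open>s v\<close> is the family of blocks of the embedded vector.\<close>
  define s where "s v j = (if j = i then v else 0\<^sub>v (d j))" for v :: "real vec" and j
  have s: "s v j \<in> carrier_vec (d j)" if "v \<in> carrier_vec (d i)" for v j using that by (simp add: s_def)
  have E: "block_embed d N i *\<^sub>v v = stack_vec N (s v)" if v: "v \<in> carrier_vec (d i)" for v
  proof (rule eq_vecI)
    fix a assume "a < dim_vec (stack_vec N (s v))"
    then have "a < offset d N" using carrier_vecD[OF stack_vec_carrier[of N "s v" d]] s[OF v] by auto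
    then obtain j b where a: "j < N" "b < d j" "a = offset d j + b" by (rule offset_cases)
    then show "(block_embed d N i *\<^sub>v v) $ a = stack_vec N (s v) $ a"
      using v assms(2) s[OF v] by (simp add: block_embed_mult_index stack_vec_index) (simp add: s_def)
  qed (use carrier_vecD[OF stack_vec_carrier[of N "s v" d, OF s[OF v]]] in \<open>auto simp: block_embed_def\<close>)
  have "v \<bullet> ((block_embed d N i)\<^sup>T * ?D * block_embed d N i *\<^sub>v w)
      = stack_vec N (s v) \<bullet> (?D *\<^sub>v stack_vec N (s w))"
    using congruence_form[OF D block_embed_carrier vw] vw by (simp add: E)
  also have "\<dots> = (\<Sum>j<N. s v j \<bullet> (F j *\<^sub>v s w j))"
    using assms s vw by (intro diag_blocks_form) auto
  also have "\<dots> = (\<Sum>j<N. if i = j then v \<bullet> (F i *\<^sub>v w) else 0)"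
    using assms vw by (intro sum.cong) (auto simp: s_def intro!: scalar_prod_left_zero mv_carrier)
  also have "\<dots> = v \<bullet> (F i *\<^sub>v w)" using assms(2) by (simp add: sum.delta')
  finally show "v \<bullet> ((block_embed d N i)\<^sup>T * ?D * block_embed d N i *\<^sub>v w) = v \<bullet> (F i *\<^sub>v w)" .
qed

section \<open>Borel measurability of vector and matrix operations\<close>

lemma space_vec_borel [simp]: "space (vec_borel d) = carrier_vec d"
  by (simp add: vec_borel_def)

lemma space_mat_borel [simp]: "space (mat_borel r c) = carrier_mat r c"
  by (simp add: mat_borel_def)

text \<open>The two Borel structures are instances of one construction, with the entries as coordinates.\<close>

lemma measurable_entries_iff:
  fixes entry :: "'b \<Rightarrow> 'i \<Rightarrow> real"
  shows "f \<in> M \<rightarrow>\<^sub>M vimage_algebra C (\<lambda>v. \<lambda>p\<in>I. entry v p) (\<Pi>\<^sub>M p\<in>I. borel) \<longleftrightarrow>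
    (\<forall>w\<in>space M. f w \<in> C) \<and> (\<forall>p\<in>I. (\<lambda>w. entry (f w) p) \<in> borel_measurable M)"
proof safe
  let ?V = "vimage_algebra C (\<lambda>v. \<lambda>p\<in>I. entry v p) (\<Pi>\<^sub>M p\<in>I. borel :: real measure)"
  assume f: "f \<in> M \<rightarrow>\<^sub>M ?V"
  show "f w \<in> C" if "w \<in> space M" for w using measurable_space[OF f that] by simp
  have e: "(\<lambda>v. \<lambda>p\<in>I. entry v p) \<in> ?V \<rightarrow>\<^sub>M (\<Pi>\<^sub>M p\<in>I. borel)"
    by (rule measurable_vimage_algebra1) (auto simp: space_PiM)
  fix p assume p: "p \<in> I"
  show "(\<lambda>w. entry (f w) p) \<in> borel_measurable M"
    using measurable_compose[OF f measurable_compose[OF e measurable_component_singleton[OF p]]] p by simp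
qed (auto intro!: measurable_vimage_algebra2 measurable_restrict)

lemma measurable_vec_borel_iff:
  "f \<in> M \<rightarrow>\<^sub>M vec_borel d \<longleftrightarrow>
    (\<forall>w\<in>space M. f w \<in> carrier_vec d) \<and> (\<forall>a<d. (\<lambda>w. f w $ a) \<in> borel_measurable M)"
  unfolding vec_borel_def measurable_entries_iff by auto

lemma measurable_mat_borel_iff:
  "f \<in> M \<rightarrow>\<^sub>M mat_borel r c \<longleftrightarrow>
    (\<forall>w\<in>space M. f w \<in> carrier_mat r c) \<and> (\<forall>a<r. \<forall>b<c. (\<lambda>w. f w $$ (a, b)) \<in> borel_measurable M)"
  unfolding mat_borel_def measurable_entries_iff by auto

lemmas measurable_vec_borelI = measurable_vec_borel_iff[THEN iffD2, OF conjI]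
lemmas measurable_mat_borelI = measurable_mat_borel_iff[THEN iffD2, OF conjI]

lemma measurable_vec_entry: "f \<in> M \<rightarrow>\<^sub>M vec_borel d \<Longrightarrow> a < d \<Longrightarrow> (\<lambda>w. f w $ a) \<in> borel_measurable M"
  by (simp add: measurable_vec_borel_iff)

lemma measurable_mat_entry:
  "f \<in> M \<rightarrow>\<^sub>M mat_borel r c \<Longrightarrow> a < r \<Longrightarrow> b < c \<Longrightarrow> (\<lambda>w. f w $$ (a, b)) \<in> borel_measurable M"
  by (simp add: measurable_mat_borel_iff)

lemma measurable_vecD: "f \<in> M \<rightarrow>\<^sub>M vec_borel d \<Longrightarrow> w \<in> space M \<Longrightarrow> f w \<in> carrier_vec d"
  by (simp add: measurable_vec_borel_iff)

lemma measurable_matD: "f \<in> M \<rightarrow>\<^sub>M mat_borel r c \<Longrightarrow> w \<in> space M \<Longrightarrow> f w \<in> carrier_mat r c"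
  by (simp add: measurable_mat_borel_iff)

lemmas measurable_vec_dim = carrier_vecD[OF measurable_vecD]
lemmas measurable_mat_dim = carrier_matD[OF measurable_matD]

lemma measurable_vec_const: "v \<in> carrier_vec d \<Longrightarrow> (\<lambda>_. v) \<in> M \<rightarrow>\<^sub>M vec_borel d"
  by (rule measurable_vec_borelI) auto

lemma measurable_mat_const: "S \<in> carrier_mat r c \<Longrightarrow> (\<lambda>_. S) \<in> M \<rightarrow>\<^sub>M mat_borel r c"
  by (rule measurable_mat_borelI) auto

lemma measurable_vec_by_entries:
  assumes "\<And>w. w \<in> space M \<Longrightarrow> h w \<in> carrier_vec d"
    and "\<And>a. a < d \<Longrightarrow> g a \<in> borel_measurable M"
    and "\<And>a w. a < d \<Longrightarrow> w \<in> space M \<Longrightarrow> h w $ a = g a w"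
  shows "h \<in> M \<rightarrow>\<^sub>M vec_borel d"
  using assms by (auto simp: measurable_vec_borel_iff cong: measurable_cong)

lemma measurable_mat_by_entries:
  assumes "\<And>w. w \<in> space M \<Longrightarrow> h w \<in> carrier_mat r c"
    and "\<And>a b. a < r \<Longrightarrow> b < c \<Longrightarrow> g a b \<in> borel_measurable M"
    and "\<And>a b w. a < r \<Longrightarrow> b < c \<Longrightarrow> w \<in> space M \<Longrightarrow> h w $$ (a, b) = g a b w"
  shows "h \<in> M \<rightarrow>\<^sub>M mat_borel r c"
  using assms by (auto simp: measurable_mat_borel_iff cong: measurable_cong)

lemma measurable_vec_add:
  assumes f: "f \<in> M \<rightarrow>\<^sub>M vec_borel d" and g: "g \<in> M \<rightarrow>\<^sub>M vec_borel d"
  shows "(\<lambda>w. f w + g w) \<in> M \<rightarrow>\<^sub>M vec_borel d"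
  by (rule measurable_vec_by_entries[where g = "\<lambda>a w. f w $ a + g w $ a"])
    (simp_all add: measurable_vecD[OF f] measurable_vecD[OF g] measurable_vec_entry[OF f] measurable_vec_entry[OF g]
      borel_measurable_add borel_measurable_diff measurable_vec_dim[OF g])

lemma measurable_vec_minus:
  assumes f: "f \<in> M \<rightarrow>\<^sub>M vec_borel d" and g: "g \<in> M \<rightarrow>\<^sub>M vec_borel d"
  shows "(\<lambda>w. f w - g w) \<in> M \<rightarrow>\<^sub>M vec_borel d"
  by (rule measurable_vec_by_entries[where g = "\<lambda>a w. f w $ a - g w $ a"])
    (simp_all add: measurable_vecD[OF f] measurable_vecD[OF g] measurable_vec_entry[OF f] measurable_vec_entry[OF g]
      borel_measurable_add borel_measurable_diff measurable_vec_dim[OF g])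

lemma measurable_vec_uminus:
  assumes f: "f \<in> M \<rightarrow>\<^sub>M vec_borel d"
  shows "(\<lambda>w. - f w) \<in> M \<rightarrow>\<^sub>M vec_borel d"
  by (rule measurable_vec_by_entries[where g = "\<lambda>a w. - f w $ a"])
    (simp_all add: measurable_vecD[OF f] measurable_vec_entry[OF f] measurable_vec_dim[OF f])

lemma measurable_scalar_prod:
  assumes f: "f \<in> M \<rightarrow>\<^sub>M vec_borel d" and g: "g \<in> M \<rightarrow>\<^sub>M vec_borel d"
  shows "(\<lambda>w. f w \<bullet> g w) \<in> borel_measurable M"
proof -
  have "(\<lambda>w. \<Sum>a<d. f w $ a * g w $ a) \<in> borel_measurable M"
    by (intro borel_measurable_sum borel_measurable_times measurable_vec_entry[OF f] measurable_vec_entry[OF g]) auto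
  then show ?thesis
    by (rule measurable_cong[THEN iffD1, rotated])
      (simp add: scalar_prod_def atLeast0LessThan measurable_vec_dim[OF g])
qed

lemma measurable_mult_mat_vec:
  assumes S: "S \<in> M \<rightarrow>\<^sub>M mat_borel r c" and f: "f \<in> M \<rightarrow>\<^sub>M vec_borel c"
  shows "(\<lambda>w. S w *\<^sub>v f w) \<in> M \<rightarrow>\<^sub>M vec_borel r"
proof (rule measurable_vec_by_entries)
  show "(\<lambda>w. \<Sum>b<c. S w $$ (a, b) * f w $ b) \<in> borel_measurable M" if "a < r" for a
    using that by (intro borel_measurable_sum borel_measurable_times measurable_vec_entry[OF f] measurable_mat_entry[OF S]) auto
qed (auto intro: mv_carrier[OF measurable_matD[OF S] measurable_vecD[OF f]]
    simp: scalar_prod_def atLeast0LessThan measurable_vec_dim[OF f] measurable_mat_dim[OF S])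

lemma measurable_const_mult_vec:
  assumes "G \<in> carrier_mat r c" "f \<in> M \<rightarrow>\<^sub>M vec_borel c"
  shows "(\<lambda>w. G *\<^sub>v f w) \<in> M \<rightarrow>\<^sub>M vec_borel r"
  using assms by (intro measurable_mult_mat_vec[of "\<lambda>_. G"] measurable_mat_const)

lemma measurable_block_row:
  assumes S: "S \<in> M \<rightarrow>\<^sub>M mat_borel (offset d N) c" and i: "i < N"
  shows "(\<lambda>w. block_row d i (S w)) \<in> M \<rightarrow>\<^sub>M mat_borel (d i) c"
  by (rule measurable_mat_by_entries[where g = "\<lambda>a b w. S w $$ (offset d i + a, b)"])
    (simp_all add: block_row_def measurable_mat_dim[OF S] measurable_mat_entry[OF S] offset_add_less[OF i])

lemma measurable_stack_vec:
  assumes f: "\<And>i. i < N \<Longrightarrow> f i \<in> M \<rightarrow>\<^sub>M vec_borel (d i)"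
  shows "(\<lambda>w. stack_vec N (\<lambda>i. f i w)) \<in> M \<rightarrow>\<^sub>M vec_borel (offset d N)"
proof (rule measurable_vec_borelI; intro ballI allI impI)
  fix a assume "a < offset d N"
  then obtain j b where a: "j < N" "b < d j" "a = offset d j + b" by (rule offset_cases)
  show "(\<lambda>w. stack_vec N (\<lambda>i. f i w) $ a) \<in> borel_measurable M"
    using measurable_vec_entry[OF f[OF a(1)] a(2)]
    by (rule measurable_cong[THEN iffD1, rotated])
      (use a measurable_vecD[OF f] in \<open>simp add: stack_vec_index[of N _ d]\<close>)
qed (use measurable_vecD[OF f] in \<open>auto intro!: stack_vec_carrier\<close>)

lemma measurable_stack_mat:
  assumes f: "\<And>i. i < N \<Longrightarrow> f i \<in> M \<rightarrow>\<^sub>M mat_borel (d i) c"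
  shows "(\<lambda>w. stack_mat c N (\<lambda>i. f i w)) \<in> M \<rightarrow>\<^sub>M mat_borel (offset d N) c"
proof (rule measurable_mat_borelI; intro ballI allI impI)
  fix a l assume "a < offset d N" and l: "l < c"
  then obtain j b where a: "j < N" "b < d j" "a = offset d j + b" by (blast elim: offset_cases)
  show "(\<lambda>w. stack_mat c N (\<lambda>i. f i w) $$ (a, l)) \<in> borel_measurable M"
    using measurable_mat_entry[OF f[OF a(1)] a(2) l]
    by (rule measurable_cong[THEN iffD1, rotated])
      (use a l measurable_matD[OF f] in \<open>simp add: stack_mat_index[of N _ d]\<close>)
qed (use measurable_matD[OF f] in \<open>auto intro!: stack_mat_carrier\<close>)

section \<open>Square integrable random vectors\<close>

lemmas lint_congs = Bochner_Integration.integrable_cong Bochner_Integration.integral_cong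

text \<open>A random vector of dimension \<open>d\<close> all of whose entries have a finite second moment.\<close>

definition square_integrable_vec :: "'w measure \<Rightarrow> nat \<Rightarrow> ('w \<Rightarrow> real vec) \<Rightarrow> bool" where
  "square_integrable_vec M d X \<longleftrightarrow>
     X \<in> M \<rightarrow>\<^sub>M vec_borel d \<and> (\<forall>a<d. integrable M (\<lambda>w. (X w $ a)\<^sup>2))"

lemma integrable_prod_of_squares:
  fixes f g :: "'w \<Rightarrow> real"
  assumes [measurable]: "f \<in> borel_measurable M" "g \<in> borel_measurable M"
    and "integrable M (\<lambda>w. (f w)\<^sup>2)" "integrable M (\<lambda>w. (g w)\<^sup>2)"
  shows "integrable M (\<lambda>w. f w * g w)"
proof (rule Bochner_Integration.integrable_bound)
  show "integrable M (\<lambda>w. (f w)\<^sup>2 + (g w)\<^sup>2)" using assms by auto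
  show "AE w in M. norm (f w * g w) \<le> norm ((f w)\<^sup>2 + (g w)\<^sup>2)"
  proof (rule AE_I2)
    fix w
    have "2 * (\<bar>f w\<bar> * \<bar>g w\<bar>) \<le> (f w)\<^sup>2 + (g w)\<^sup>2"
      using sum_squares_bound[of "\<bar>f w\<bar>" "\<bar>g w\<bar>"] by simp
    moreover have "0 \<le> \<bar>f w\<bar> * \<bar>g w\<bar>" by simp
    ultimately have "\<bar>f w\<bar> * \<bar>g w\<bar> \<le> (f w)\<^sup>2 + (g w)\<^sup>2" by linarith
    then show "norm (f w * g w) \<le> norm ((f w)\<^sup>2 + (g w)\<^sup>2)" by (simp add: abs_mult)
  qed
qed simp

lemma integral_double_sum:
  fixes f :: "nat \<Rightarrow> nat \<Rightarrow> 'w \<Rightarrow> real"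
  assumes "\<And>a b. a < r \<Longrightarrow> b < c \<Longrightarrow> integrable M (f a b)"
  shows "integrable M (\<lambda>w. \<Sum>a<r. \<Sum>b<c. f a b w)"
    and "(\<integral>w. (\<Sum>a<r. \<Sum>b<c. f a b w) \<partial>M) = (\<Sum>a<r. \<Sum>b<c. \<integral>w. f a b w \<partial>M)"
proof -
  have i: "integrable M (\<lambda>w. \<Sum>b<c. f a b w)" if "a < r" for a
    using assms that by (intro Bochner_Integration.integrable_sum) auto
  show "integrable M (\<lambda>w. \<Sum>a<r. \<Sum>b<c. f a b w)"
    by (rule Bochner_Integration.integrable_sum) (use i in auto)
  have "(\<integral>w. (\<Sum>a<r. \<Sum>b<c. f a b w) \<partial>M) = (\<Sum>a<r. \<integral>w. (\<Sum>b<c. f a b w) \<partial>M)"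
    by (rule Bochner_Integration.integral_sum) (use i in auto)
  also have "\<dots> = (\<Sum>a<r. \<Sum>b<c. \<integral>w. f a b w \<partial>M)"
    using assms by (intro sum.cong refl Bochner_Integration.integral_sum) auto
  finally show "(\<integral>w. (\<Sum>a<r. \<Sum>b<c. f a b w) \<partial>M) = (\<Sum>a<r. \<Sum>b<c. \<integral>w. f a b w \<partial>M)" .
qed

lemma square_integrable_cong:
  "(\<And>w. w \<in> space M \<Longrightarrow> X w = Y w) \<Longrightarrow> square_integrable_vec M d X = square_integrable_vec M d Y"
  unfolding square_integrable_vec_def by (simp cong: measurable_cong lint_congs)

lemma square_integrable_form:
  assumes X: "square_integrable_vec M r X" and Y: "square_integrable_vec M c Y" and G: "G \<in> carrier_mat r c"
  shows "integrable M (\<lambda>w. X w \<bullet> (G *\<^sub>v Y w))" (is ?int)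
    and "(\<integral>w. X w \<bullet> (G *\<^sub>v Y w) \<partial>M) = (\<Sum>a<r. \<Sum>b<c. (\<integral>w. X w $ a * Y w $ b \<partial>M) * G $$ (a, b))" (is ?eq)
proof -
  have XM: "X \<in> M \<rightarrow>\<^sub>M vec_borel r" and YM: "Y \<in> M \<rightarrow>\<^sub>M vec_borel c"
    using X Y by (auto simp: square_integrable_vec_def)
  have i: "integrable M (\<lambda>w. X w $ a * Y w $ b)" if "a < r" "b < c" for a b
    using X Y that measurable_vec_entry[OF XM] measurable_vec_entry[OF YM]
    by (intro integrable_prod_of_squares) (auto simp: square_integrable_vec_def)
  have eq: "X w \<bullet> (G *\<^sub>v Y w) = (\<Sum>a<r. \<Sum>b<c. X w $ a * Y w $ b * G $$ (a, b))" if "w \<in> space M" for w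
    by (rule form_expand[OF G measurable_vecD[OF XM that] measurable_vecD[OF YM that]])
  have i2: "integrable M (\<lambda>w. X w $ a * Y w $ b * G $$ (a, b))" if "a < r" "b < c" for a b
    using i[OF that] by simp
  show ?int ?eq
    using integral_double_sum[of r c M "\<lambda>a b w. X w $ a * Y w $ b * G $$ (a, b)", OF i2] i
    by (simp_all add: eq cong: lint_congs)
qed

lemma square_integrable_mult:
  assumes X: "square_integrable_vec M c X" and G: "G \<in> carrier_mat r c"
  shows "square_integrable_vec M r (\<lambda>w. G *\<^sub>v X w)"
proof -
  have XM: "X \<in> M \<rightarrow>\<^sub>M vec_borel c" using X by (simp add: square_integrable_vec_def)
  have "integrable M (\<lambda>w. ((G *\<^sub>v X w) $ a)\<^sup>2)" if a: "a < r" for a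
  proof -
    \<comment> \<open>The square of entry \<open>a\<close> is a quadratic form of rank one in \<open>X\<close>.\<close>
    define H where "H = mat c c (\<lambda>(b, b'). G $$ (a, b) * G $$ (a, b'))"
    have "X w \<bullet> (H *\<^sub>v X w) = ((G *\<^sub>v X w) $ a)\<^sup>2" if "w \<in> space M" for w
    proof -
      have x: "dim_vec (X w) = c" using measurable_vecD[OF XM that] by simp
      have "((G *\<^sub>v X w) $ a)\<^sup>2 = (\<Sum>b<c. G $$ (a, b) * X w $ b) * (\<Sum>b'<c. G $$ (a, b') * X w $ b')"
        using G a x by (simp add: scalar_prod_def atLeast0LessThan power2_eq_square)
      also have "\<dots> = X w \<bullet> (H *\<^sub>v X w)"
        using x unfolding scalar_prod_def H_def atLeast0LessThan sum_product
        by (auto simp: scalar_prod_def sum_distrib_left atLeast0LessThan ac_simps intro!: sum.cong)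
      finally show ?thesis by simp
    qed
    moreover have "integrable M (\<lambda>w. X w \<bullet> (H *\<^sub>v X w))"
      by (rule square_integrable_form[OF X X]) (simp add: H_def)
    ultimately show ?thesis by (simp cong: lint_congs)
  qed
  then show ?thesis using measurable_const_mult_vec[OF G XM] by (simp add: square_integrable_vec_def)
qed

lemma square_integrable_add:
  assumes X: "square_integrable_vec M d X" and Y: "square_integrable_vec M d Y"
  shows "square_integrable_vec M d (\<lambda>w. X w + Y w)"
proof -
  have XM: "X \<in> M \<rightarrow>\<^sub>M vec_borel d" and YM: "Y \<in> M \<rightarrow>\<^sub>M vec_borel d"
    using X Y by (auto simp: square_integrable_vec_def)
  have "integrable M (\<lambda>w. ((X w + Y w) $ a)\<^sup>2)" if a: "a < d" for a
  proof -
    have "integrable M (\<lambda>w. X w $ a * Y w $ a)"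
      using X Y a measurable_vec_entry[OF XM] measurable_vec_entry[OF YM]
      by (intro integrable_prod_of_squares) (auto simp: square_integrable_vec_def)
    then have "integrable M (\<lambda>w. (X w $ a)\<^sup>2 + 2 * (X w $ a * Y w $ a) + (Y w $ a)\<^sup>2)"
      using X Y a by (auto simp: square_integrable_vec_def)
    moreover have "(X w $ a)\<^sup>2 + 2 * (X w $ a * Y w $ a) + (Y w $ a)\<^sup>2 = ((X w + Y w) $ a)\<^sup>2" if "w \<in> space M" for w
      using measurable_vecD[OF YM that] a by (simp add: power2_sum)
    ultimately show ?thesis by (simp cong: lint_congs)
  qed
  then show ?thesis using measurable_vec_add[OF XM YM] by (simp add: square_integrable_vec_def)
qed

lemma (in prob_space) square_integrable_const:
  "v \<in> carrier_vec d \<Longrightarrow> square_integrable_vec M d (\<lambda>_. v)"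
  by (simp add: square_integrable_vec_def measurable_vec_const)

lemma square_integrable_uminus:
  assumes X: "square_integrable_vec M d X"
  shows "square_integrable_vec M d (\<lambda>w. - X w)"
proof -
  have XM: "X \<in> M \<rightarrow>\<^sub>M vec_borel d" using X by (simp add: square_integrable_vec_def)
  have "((- X w) $ a)\<^sup>2 = (X w $ a)\<^sup>2" if "w \<in> space M" "a < d" for w a
    using measurable_vecD[OF XM that(1)] that by simp
  then show ?thesis using X measurable_vec_uminus[OF XM]
    by (simp add: square_integrable_vec_def cong: lint_congs)
qed

lemma square_integrable_stack:
  assumes X: "\<And>i. i < N \<Longrightarrow> square_integrable_vec M (d i) (X i)"
  shows "square_integrable_vec M (offset d N) (\<lambda>w. stack_vec N (\<lambda>i. X i w))"
proof -
  have XM: "X i \<in> M \<rightarrow>\<^sub>M vec_borel (d i)" if "i < N" for i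
    using X[OF that] by (simp add: square_integrable_vec_def)
  have "integrable M (\<lambda>w. (stack_vec N (\<lambda>i. X i w) $ a)\<^sup>2)" if lt: "a < offset d N" for a
  proof -
    obtain j b where a: "j < N" "b < d j" "a = offset d j + b" using lt by (blast elim: offset_cases)
    have "stack_vec N (\<lambda>i. X i w) $ a = X j w $ b" if "w \<in> space M" for w
      using a measurable_vecD[OF XM that] by (simp add: stack_vec_index[of N _ d])
    then show ?thesis using X a by (simp add: square_integrable_vec_def cong: lint_congs)
  qed
  then show ?thesis using measurable_stack_vec[of N X M d] XM by (simp add: square_integrable_vec_def)
qed

lemma (in prob_space) square_integrable_imp_integrable:
  assumes X: "square_integrable_vec M d X" and a: "a < d"
  shows "integrable M (\<lambda>w. X w $ a)"
proof -
  have XM: "X \<in> M \<rightarrow>\<^sub>M vec_borel d" using X by (simp add: square_integrable_vec_def)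
  show ?thesis
    using integrable_prod_of_squares[of "\<lambda>w. X w $ a" M "\<lambda>_. 1"] X a measurable_vec_entry[OF XM a]
    by (simp add: square_integrable_vec_def)
qed

text \<open>A bilinear form of two entrywise independent vectors has expectation zero if one is centred.\<close>

lemma (in prob_space) form_expectation_zero:
  assumes X: "square_integrable_vec M r X" and Y: "square_integrable_vec M c Y" and G: "G \<in> carrier_mat r c"
    and indep: "\<And>a b. a < r \<Longrightarrow> b < c \<Longrightarrow> indep_var borel (\<lambda>w. X w $ a) borel (\<lambda>w. Y w $ b)"
    and mean: "\<And>b. b < c \<Longrightarrow> (\<integral>w. Y w $ b \<partial>M) = 0"
  shows "(\<integral>w. X w \<bullet> (G *\<^sub>v Y w) \<partial>M) = 0"
proof -
  have "(\<integral>w. X w $ a * Y w $ b \<partial>M) = 0" if "a < r" "b < c" for a b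
    using indep_var_lebesgue_integral[OF indep[OF that] square_integrable_imp_integrable[OF X that(1)]
        square_integrable_imp_integrable[OF Y that(2)]] that mean by simp
  then show ?thesis unfolding square_integrable_form(2)[OF X Y G] by simp
qed

lemma (in prob_space) form_expectation_zero_const:
  assumes v: "v \<in> carrier_vec r" and Y: "square_integrable_vec M c Y" and G: "G \<in> carrier_mat r c"
    and mean: "\<And>b. b < c \<Longrightarrow> (\<integral>w. Y w $ b \<partial>M) = 0"
  shows "(\<integral>w. v \<bullet> (G *\<^sub>v Y w) \<partial>M) = 0"
  unfolding square_integrable_form(2)[OF square_integrable_const[OF v] Y G]
  using mean by simp

lemma (in prob_space) expect_mat_form:
  assumes X: "\<And>w. w \<in> space M \<Longrightarrow> X w \<in> carrier_mat r c"
    and i: "\<And>a b. a < r \<Longrightarrow> b < c \<Longrightarrow> integrable M (\<lambda>w. X w $$ (a, b))"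
    and v: "v \<in> carrier_vec r" and y: "y \<in> carrier_vec c"
  shows "(\<integral>w. v \<bullet> (X w *\<^sub>v y) \<partial>M) = v \<bullet> (expect_mat M r c X *\<^sub>v y)"
proof -
  have E: "expect_mat M r c X \<in> carrier_mat r c" by (simp add: expect_mat_def)
  have "(\<integral>w. v \<bullet> (X w *\<^sub>v y) \<partial>M) = (\<integral>w. (\<Sum>a<r. \<Sum>b<c. v $ a * y $ b * X w $$ (a, b)) \<partial>M)"
    by (intro lint_congs(2) refl form_expand X v y)
  also have "\<dots> = (\<Sum>a<r. \<Sum>b<c. v $ a * y $ b * (\<integral>w. X w $$ (a, b) \<partial>M))"
    using i by (subst integral_double_sum(2)) auto
  also have "\<dots> = v \<bullet> (expect_mat M r c X *\<^sub>v y)"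
    unfolding form_expand[OF E v y] by (simp add: expect_mat_def)
  finally show ?thesis .
qed

section \<open>The one-step problem\<close>

text \<open>
  The data of one time step: the random system matrix \<open>A\<close> with independent block rows, the input
  matrix \<open>B\<close>, the input weights \<open>Rd i\<close> and the successor cost \<open>P\<close>. The total dimensions of state and
  input are \<open>d\<close> and \<open>q\<close>, and \<open>w\<close> stands for an outcome.
\<close>

locale one_step = prob_space M
  for M :: "'w measure" +
  fixes N :: nat and n m :: "nat \<Rightarrow> nat" and A :: "'w \<Rightarrow> real mat" and B P :: "real mat"
    and Rd :: "nat \<Rightarrow> real mat" and d q :: nat
  defines "d \<equiv> offset n N" and "q \<equiv> offset m N"
  assumes A_meas: "A \<in> M \<rightarrow>\<^sub>M mat_borel d d"
    and A_int: "\<And>a b. a < d \<Longrightarrow> b < d \<Longrightarrow> integrable M (\<lambda>w. A w $$ (a, b))"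
    and A_sq: "\<And>a b. a < d \<Longrightarrow> b < d \<Longrightarrow> integrable M (\<lambda>w. (A w $$ (a, b))\<^sup>2)"
    and A_indep: "indep_vars (\<lambda>i. mat_borel (n i) d) (\<lambda>i w. block_row n i (A w)) {..<N}"
    and B_carrier: "B \<in> carrier_mat d q"
    and Rd_carrier: "\<And>i. i < N \<Longrightarrow> Rd i \<in> carrier_mat (m i) (m i)"
    and R_pd: "pd_mat q (diag_blocks N Rd)"
    and P_psd: "psd_mat d P"
begin

text \<open>
  \<open>Bi i\<close> is the \<open>i\<close>-th block column of \<open>B\<close>, \<open>K\<close> and \<open>Ki i\<close> are the gains for the mean and for the
  \<open>i\<close>-th centred block row \<open>Atil i\<close>, and \<open>ric i\<close> is the Riccati operator at \<open>Atil i\<close>.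
\<close>

abbreviation "R \<equiv> diag_blocks N Rd"
abbreviation "E i \<equiv> block_embed m N i"
abbreviation "Bi i \<equiv> block_col m i B"
abbreviation "K \<equiv> gain P B R"
abbreviation "Ki i \<equiv> gain P (Bi i) (Rd i)"
abbreviation "Abar \<equiv> expect_mat M d d A"
abbreviation "Atil i w \<equiv> centred_row M N n i A w"
abbreviation "hess \<equiv> R + B\<^sup>T * P * B"
abbreviation "ric i w \<equiv> riccati (Atil i w) P (Bi i) (Rd i)"
abbreviation "block_laws i \<equiv> mat_borel (n i) d \<rightarrow>\<^sub>M vec_borel (m i)"
abbreviation "blk i w \<equiv> block_row n i (A w)"

text \<open>The claimed optimal input in state \<open>x\<close>.\<close>

definition ustar :: "'w \<Rightarrow> real vec \<Rightarrow> real vec" where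
  "ustar w x = - (K * Abar *\<^sub>v x) - stack_mat d N (\<lambda>i. Ki i * Atil i w) *\<^sub>v x"

text \<open>The matrix of the optimal value of the step, without the cost of the current state.\<close>

definition cost_to_go :: "real mat" where
  "cost_to_go = riccati Abar P B R +
     mat_sum d d (\<lambda>i. expect_mat M d d (ric i)) {..<N}"

lemma P_carrier: "P \<in> carrier_mat d d" and P_sym: "P\<^sup>T = P"
  and P_nonneg: "v \<in> carrier_vec d \<Longrightarrow> 0 \<le> v \<bullet> (P *\<^sub>v v)"
  using P_psd by (auto simp: psd_mat_def)

lemma R_carrier: "R \<in> carrier_mat q q" and R_sym: "R\<^sup>T = R"
  using R_pd by (auto simp: pd_mat_def)

lemma E_carrier: "E i \<in> carrier_mat q (m i)"
  by (simp add: q_def)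

lemma tB_carrier: "B\<^sup>T \<in> carrier_mat q d" and tE_carrier: "(E i)\<^sup>T \<in> carrier_mat (m i) q"
  using B_carrier E_carrier by auto

lemma Bi_eq: "i < N \<Longrightarrow> Bi i = B * E i"
  using B_carrier unfolding q_def by (rule block_col_eq)

lemma Bi_carrier: "i < N \<Longrightarrow> Bi i \<in> carrier_mat d (m i)"
  using mult_carrier_mat[OF B_carrier E_carrier] Bi_eq by simp

lemma Rd_eq: "i < N \<Longrightarrow> (E i)\<^sup>T * R * E i = Rd i"
  using Rd_carrier by (intro diag_blocks_block)

lemma Rd_pd: "i < N \<Longrightarrow> pd_mat (m i) (Rd i)"
  using pd_congruence[OF R_pd E_carrier] block_embed_isometry[of i N m] Rd_eq by metis

lemma hess_pd: "pd_mat q hess"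
  by (rule pd_hessian[OF R_pd P_psd B_carrier])

lemma block_hess_pd: "i < N \<Longrightarrow> pd_mat (m i) (Rd i + (Bi i)\<^sup>T * P * Bi i)"
  by (rule pd_hessian[OF Rd_pd P_psd Bi_carrier])

lemma K_carrier: "K \<in> carrier_mat q d"
  by (rule gain_carrier[OF hess_pd P_carrier B_carrier])

lemma Ki_carrier: "i < N \<Longrightarrow> Ki i \<in> carrier_mat (m i) d"
  by (rule gain_carrier[OF block_hess_pd P_carrier Bi_carrier])

lemma Abar_carrier: "Abar \<in> carrier_mat d d"
  by (simp add: expect_mat_def)

lemma A_carrier: "w \<in> space M \<Longrightarrow> A w \<in> carrier_mat d d"
  by (rule measurable_matD[OF A_meas])

lemma Atil_eq: "Atil i w = only_block_row n i (A w - Abar)"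
  by (simp add: centred_row_def d_def)

lemma Atil_carrier: "Atil i w \<in> carrier_mat d d"
  unfolding Atil_eq using Abar_carrier by (simp add: only_block_row_def)

lemma Atil_mult:
  assumes "w \<in> space M" "x \<in> carrier_vec d" "i < N"
  shows "Atil i w *\<^sub>v x = block_embed n N i *\<^sub>v (blk i w *\<^sub>v x - block_row n i Abar *\<^sub>v x)"
    and "Atil i w *\<^sub>v x = block_embed n N i * (block_embed n N i)\<^sup>T *\<^sub>v (A w *\<^sub>v x + (- (Abar *\<^sub>v x)))"
proof -
  note A = A_carrier[OF assms(1)] and x = assms(2)
  have E: "block_embed n N i \<in> carrier_mat d (n i)" by (simp add: d_def)
  have D: "A w - Abar \<in> carrier_mat d d" using Abar_carrier by (rule minus_carrier_mat)
  have b: "block_row n i S *\<^sub>v x = (block_embed n N i)\<^sup>T *\<^sub>v (S *\<^sub>v x)" if "S \<in> carrier_mat d d" for S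
    using that x assms(3) unfolding d_def by (rule block_row_mult_vec)
  have 1: "Atil i w *\<^sub>v x = block_embed n N i *\<^sub>v ((block_embed n N i)\<^sup>T *\<^sub>v ((A w - Abar) *\<^sub>v x))"
    unfolding Atil_eq using only_block_row_mult_vec[of "A w - Abar" n N d i x] D assms b[OF D] by (simp add: d_def)
  have 2: "(A w - Abar) *\<^sub>v x = A w *\<^sub>v x - Abar *\<^sub>v x"
    using A Abar_carrier x by (rule minus_mult_distrib_mat_vec)
  show "Atil i w *\<^sub>v x = block_embed n N i *\<^sub>v (blk i w *\<^sub>v x - block_row n i Abar *\<^sub>v x)"
    unfolding 1 2 b[OF A] b[OF Abar_carrier] using A Abar_carrier x E
    by (subst mult_minus_distrib_mat_vec[of _ "n i" d]) auto
  have "A w *\<^sub>v x - Abar *\<^sub>v x = A w *\<^sub>v x + (- (Abar *\<^sub>v x))"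
    using A Abar_carrier x by (intro minus_add_uminus_vec[of _ d]) auto
  then show "Atil i w *\<^sub>v x = block_embed n N i * (block_embed n N i)\<^sup>T *\<^sub>v (A w *\<^sub>v x + (- (Abar *\<^sub>v x)))"
    unfolding 1 2 using A Abar_carrier x E by (subst assoc_mult_mat_vec[of _ d "n i" _ d]) auto
qed

lemma A_mult_decomp:
  assumes "w \<in> space M" "x \<in> carrier_vec d"
  shows "A w *\<^sub>v x = Abar *\<^sub>v x + vec_sum d (\<lambda>i. Atil i w *\<^sub>v x) N"
proof -
  note A = A_carrier[OF assms(1)]
  have D: "A w - Abar \<in> carrier_mat d d" using Abar_carrier by (rule minus_carrier_mat)
  have "(A w - Abar) *\<^sub>v x = vec_sum d (\<lambda>i. Atil i w *\<^sub>v x) N"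
    unfolding Atil_eq using mult_vec_eq_vec_sum[of "A w - Abar" n N d x] D assms(2) by (simp add: d_def)
  moreover have "(A w - Abar) *\<^sub>v x = A w *\<^sub>v x - Abar *\<^sub>v x"
    using A Abar_carrier assms(2) by (rule minus_mult_distrib_mat_vec)
  ultimately have "vec_sum d (\<lambda>i. Atil i w *\<^sub>v x) N = A w *\<^sub>v x - Abar *\<^sub>v x" by simp
  then show ?thesis using A Abar_carrier assms(2) by (intro eq_vecI) auto
qed

lemma A_mult_square_integrable:
  assumes x: "x \<in> carrier_vec d"
  shows "square_integrable_vec M d (\<lambda>w. A w *\<^sub>v x)"
proof -
  have "integrable M (\<lambda>w. ((A w *\<^sub>v x) $ a)\<^sup>2)" if a: "a < d" for a
  proof -
    \<comment> \<open>Entry \<open>a\<close> of \<open>A x\<close> is a linear function of row \<open>a\<close> of \<open>A\<close>.\<close>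
    define Z where "Z w = vec d (\<lambda>b. A w $$ (a, b))" for w
    define G where "G = mat 1 d (\<lambda>(_, b). x $ b)"
    have "Z \<in> M \<rightarrow>\<^sub>M vec_borel d"
      using measurable_mat_entry[OF A_meas a] by (intro measurable_vec_borelI) (auto simp: Z_def)
    then have "square_integrable_vec M d Z"
      using A_sq a by (simp add: square_integrable_vec_def Z_def)
    then have "integrable M (\<lambda>w. ((G *\<^sub>v Z w) $ 0)\<^sup>2)"
      using square_integrable_mult[of M d Z G 1] by (simp add: square_integrable_vec_def G_def)
    moreover have "(G *\<^sub>v Z w) $ 0 = (A w *\<^sub>v x) $ a" if "w \<in> space M" for w
      using A_carrier[OF that] a x by (simp add: G_def Z_def scalar_prod_def mult.commute)
    ultimately show ?thesis by (simp cong: lint_congs)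
  qed
  then show ?thesis
    using measurable_mult_mat_vec[OF A_meas measurable_vec_const[OF x]] by (simp add: square_integrable_vec_def)
qed

text \<open>The centred term \<open>Atil i w *\<^sub>v x\<close> as a function of block row \<open>i\<close> alone.\<close>

definition yfun :: "nat \<Rightarrow> real vec \<Rightarrow> real mat \<Rightarrow> real vec" where
  "yfun i x S = block_embed n N i *\<^sub>v (S *\<^sub>v x - block_row n i Abar *\<^sub>v x)"

lemma yfun_blk: "w \<in> space M \<Longrightarrow> x \<in> carrier_vec d \<Longrightarrow> i < N \<Longrightarrow> yfun i x (blk i w) = Atil i w *\<^sub>v x"
  using Atil_mult(1) by (simp add: yfun_def)

lemma yfun_measurable:
  assumes x: "x \<in> carrier_vec d" and i: "i < N"
  shows "yfun i x \<in> mat_borel (n i) d \<rightarrow>\<^sub>M vec_borel d"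
  unfolding yfun_def
proof (rule measurable_const_mult_vec)
  show "(\<lambda>S. S *\<^sub>v x - block_row n i Abar *\<^sub>v x) \<in> mat_borel (n i) d \<rightarrow>\<^sub>M vec_borel (n i)"
    using x mv_carrier[OF block_row_carrier[OF Abar_carrier] x]
    by (intro measurable_vec_minus measurable_mult_mat_vec[of "\<lambda>S. S" _ _ d] measurable_vec_const) auto
qed (simp add: d_def)

lemma y_square_integrable:
  assumes x: "x \<in> carrier_vec d" and i: "i < N"
  shows "square_integrable_vec M d (\<lambda>w. Atil i w *\<^sub>v x)"
proof -
  define G where "G = block_embed n N i * (block_embed n N i)\<^sup>T"
  have G: "G \<in> carrier_mat d d" unfolding G_def d_def by (intro mult_carrier_mat[of _ _ "n i"]) auto
  have "square_integrable_vec M d (\<lambda>w. G *\<^sub>v (A w *\<^sub>v x + (- (Abar *\<^sub>v x))))"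
    using x Abar_carrier by (intro square_integrable_mult[OF _ G] square_integrable_add A_mult_square_integrable square_integrable_const) auto
  then show ?thesis
    by (rule square_integrable_cong[THEN iffD1, rotated]) (simp add: Atil_mult(2)[OF _ x i] G_def)
qed

lemma y_mean:
  assumes x: "x \<in> carrier_vec d" and i: "i < N" and a: "a < d"
  shows "(\<integral>w. (Atil i w *\<^sub>v x) $ a \<partial>M) = 0"
proof -
  define G where "G = block_embed n N i * (block_embed n N i)\<^sup>T"
  have G: "G \<in> carrier_mat d d" unfolding G_def d_def by (intro mult_carrier_mat[of _ _ "n i"]) auto
  define v where "v = G\<^sup>T *\<^sub>v unit_vec d a"
  have v: "v \<in> carrier_vec d" using G by (simp add: v_def)
  have c: "Abar *\<^sub>v x \<in> carrier_vec d" by (rule mv_carrier[OF Abar_carrier x])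
  have eq: "(Atil i w *\<^sub>v x) $ a = v \<bullet> (A w *\<^sub>v x) - v \<bullet> (Abar *\<^sub>v x)" if w: "w \<in> space M" for w
  proof -
    have Ax: "A w *\<^sub>v x \<in> carrier_vec d" by (rule mv_carrier[OF A_carrier[OF w] x])
    then have z: "A w *\<^sub>v x + - (Abar *\<^sub>v x) \<in> carrier_vec d" using c by simp
    have "(Atil i w *\<^sub>v x) $ a = unit_vec d a \<bullet> (G *\<^sub>v (A w *\<^sub>v x + - (Abar *\<^sub>v x)))"
      unfolding Atil_mult(2)[OF w x i] G_def[symmetric] using mv_carrier[OF G z] a by simp
    also have "\<dots> = v \<bullet> (A w *\<^sub>v x + - (Abar *\<^sub>v x))"
      unfolding v_def by (rule transpose_vec_mult_scalar[OF G z unit_vec_carrier, symmetric])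
    also have "\<dots> = v \<bullet> (A w *\<^sub>v x) + v \<bullet> - (Abar *\<^sub>v x)"
      using v c Ax by (intro scalar_prod_add_distrib[of _ d]) auto
    also have "v \<bullet> - (Abar *\<^sub>v x) = - (v \<bullet> (Abar *\<^sub>v x))"
      by (rule scalar_prod_uminus_right) (simp only: carrier_vecD[OF v] carrier_vecD[OF c])
    finally show ?thesis by simp
  qed
  have "integrable M (\<lambda>w. v \<bullet> (1\<^sub>m d *\<^sub>v (A w *\<^sub>v x)))"
    by (rule square_integrable_form(1)[OF square_integrable_const[OF v] A_mult_square_integrable[OF x] one_carrier_mat])
  then have "integrable M (\<lambda>w. v \<bullet> (A w *\<^sub>v x))"
    using mv_carrier[OF A_carrier x] by (simp cong: lint_congs)
  then show ?thesis
    using expect_mat_form[OF A_carrier A_int v x]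
    by (simp add: eq prob_space cong: lint_congs)
qed

lemma blk_measurable: "i < N \<Longrightarrow> blk i \<in> M \<rightarrow>\<^sub>M mat_borel (n i) d"
  using A_indep by (auto simp: indep_vars_def)

text \<open>
  A function of one block row is orthogonal to every linear function of a centred block row
  with a different number.
\<close>

lemma cross_term_zero:
  assumes f: "f \<in> mat_borel (n i) d \<rightarrow>\<^sub>M vec_borel r"
    and X: "square_integrable_vec M r (\<lambda>w. f (blk i w))"
    and ij: "i < N" "j < N" "i \<noteq> j" and x: "x \<in> carrier_vec d" and G: "G \<in> carrier_mat r d"
  shows "(\<integral>w. f (blk i w) \<bullet> (G *\<^sub>v (Atil j w *\<^sub>v x)) \<partial>M) = 0"
proof -
  let ?Y = "\<lambda>w. yfun j x (blk j w)"
  have Y: "square_integrable_vec M d ?Y"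
    using y_square_integrable[OF x ij(2)]
    by (rule square_integrable_cong[THEN iffD1, rotated]) (simp add: yfun_blk[OF _ x ij(2)])
  have "(\<integral>w. f (blk i w) \<bullet> (G *\<^sub>v ?Y w) \<partial>M) = 0"
  proof (rule form_expectation_zero[OF X Y G])
    fix a b assume ab: "a < r" "b < d"
    have "indep_var (Pi\<^sub>M {i} (\<lambda>i. mat_borel (n i) d)) (\<lambda>w. \<lambda>i\<in>{i}. blk i w)
        (Pi\<^sub>M {j} (\<lambda>i. mat_borel (n i) d)) (\<lambda>w. \<lambda>i\<in>{j}. blk i w)"
      using ij by (intro indep_var_restrict[OF A_indep]) auto
    then have "indep_var borel ((\<lambda>h. f (h i) $ a) \<circ> (\<lambda>w. \<lambda>i\<in>{i}. blk i w))
        borel ((\<lambda>h. yfun j x (h j) $ b) \<circ> (\<lambda>w. \<lambda>i\<in>{j}. blk i w))"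
    proof (rule indep_var_compose)
      show "(\<lambda>h. f (h i) $ a) \<in> borel_measurable (Pi\<^sub>M {i} (\<lambda>i. mat_borel (n i) d))"
        using measurable_compose[OF measurable_component_singleton[of i "{i}" "\<lambda>i. mat_borel (n i) d"]
            measurable_vec_entry[OF f ab(1)]] by simp
      show "(\<lambda>h. yfun j x (h j) $ b) \<in> borel_measurable (Pi\<^sub>M {j} (\<lambda>i. mat_borel (n i) d))"
        using measurable_compose[OF measurable_component_singleton[of j "{j}" "\<lambda>i. mat_borel (n i) d"]
            measurable_vec_entry[OF yfun_measurable[OF x ij(2)] ab(2)]] by simp
    qed
    then show "indep_var borel (\<lambda>w. f (blk i w) $ a) borel (\<lambda>w. ?Y w $ b)"
      by (simp add: comp_def)
  next
    fix b assume "b < d"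
    then show "(\<integral>w. ?Y w $ b \<partial>M) = 0"
      using y_mean[OF x ij(2)] by (simp add: yfun_blk[OF _ x ij(2)] cong: lint_congs)
  qed
  then show ?thesis by (simp add: yfun_blk[OF _ x ij(2)] cong: lint_congs)
qed

section \<open>The gradient at the optimal input\<close>

lemma Atil_mult_carrier: "x \<in> carrier_vec d \<Longrightarrow> Atil i w *\<^sub>v x \<in> carrier_vec d"
  by (rule mv_carrier[OF Atil_carrier])

text \<open>
  The optimal input splits into the deterministic part \<open>ubar x\<close> and the blocks \<open>util i x\<close>, which
  are linear in the centred terms and have mean zero.
\<close>

definition ubar :: "real vec \<Rightarrow> real vec" where
  "ubar x = - (K *\<^sub>v (Abar *\<^sub>v x))"

definition util :: "nat \<Rightarrow> real vec \<Rightarrow> 'w \<Rightarrow> real vec" where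
  "util i x w = - (Ki i *\<^sub>v (Atil i w *\<^sub>v x))"

text \<open>Block \<open>i\<close> of the optimal input as a function of block row \<open>i\<close> alone.\<close>

definition ufun :: "nat \<Rightarrow> real vec \<Rightarrow> real mat \<Rightarrow> real vec" where
  "ufun i x S = (E i)\<^sup>T *\<^sub>v ubar x - Ki i *\<^sub>v yfun i x S"

lemma ubar_carrier: "x \<in> carrier_vec d \<Longrightarrow> ubar x \<in> carrier_vec q"
  unfolding ubar_def using mv_carrier[OF K_carrier mv_carrier[OF Abar_carrier]] by simp

lemma util_carrier: "x \<in> carrier_vec d \<Longrightarrow> i < N \<Longrightarrow> util i x w \<in> carrier_vec (m i)"
  unfolding util_def using mv_carrier[OF Ki_carrier Atil_mult_carrier] by simp

lemma block_ubar_carrier: "x \<in> carrier_vec d \<Longrightarrow> (E i)\<^sup>T *\<^sub>v ubar x \<in> carrier_vec (m i)"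
  using mv_carrier[OF tE_carrier ubar_carrier] .

lemma ufun_measurable:
  assumes x: "x \<in> carrier_vec d" and i: "i < N"
  shows "ufun i x \<in> block_laws i"
  unfolding ufun_def
  by (intro measurable_vec_minus measurable_const_mult_vec[OF Ki_carrier[OF i]] measurable_vec_const
      yfun_measurable block_ubar_carrier x i)

lemma ufun_blk:
  assumes "w \<in> space M" "x \<in> carrier_vec d" "i < N"
  shows "ufun i x (blk i w) = (E i)\<^sup>T *\<^sub>v ubar x + util i x w"
  unfolding ufun_def yfun_blk[OF assms] util_def
  using block_ubar_carrier[OF assms(2), of i] mv_carrier[OF Ki_carrier[OF assms(3)] Atil_mult_carrier[OF assms(2)]]
  by (intro minus_add_uminus_vec[of _ "m i"]) auto

lemma stack_blocks_eq:
  assumes "v \<in> carrier_vec q"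
  shows "stack_vec N (\<lambda>i. (E i)\<^sup>T *\<^sub>v v) = v"
proof (rule eq_vecI)
  have c: "(E i)\<^sup>T *\<^sub>v v \<in> carrier_vec (m i)" for i
    using mv_carrier[OF tE_carrier assms] .
  then have c2: "stack_vec N (\<lambda>i. (E i)\<^sup>T *\<^sub>v v) \<in> carrier_vec q"
    unfolding q_def by (intro stack_vec_carrier)
  then show "dim_vec (stack_vec N (\<lambda>i. (E i)\<^sup>T *\<^sub>v v)) = dim_vec v" using assms by (simp only: carrier_vecD)
  fix a assume "a < dim_vec v"
  then have "a < offset m N" using assms by (simp add: q_def)
  then obtain j b where a: "j < N" "b < m j" "a = offset m j + b" by (rule offset_cases)
  have "(transpose_mat (E j) *\<^sub>v v) $ b = v $ (offset m j + b)"
    using assms a by (subst block_embed_transpose_mult) (auto simp: q_def)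
  then show "stack_vec N (\<lambda>i. (E i)\<^sup>T *\<^sub>v v) $ a = v $ a"
    unfolding a(3) using stack_vec_index[of N "\<lambda>i. (E i)\<^sup>T *\<^sub>v v" m j b] c a by simp
qed

lemma ustar_stack_util:
  assumes x: "x \<in> carrier_vec d"
  shows "ustar w x = ubar x + stack_vec N (\<lambda>i. util i x w)"
proof -
  let ?v = "\<lambda>i. Ki i *\<^sub>v (Atil i w *\<^sub>v x)"
  have v: "?v i \<in> carrier_vec (m i)" if "i < N" for i
    using mv_carrier[OF Ki_carrier[OF that] Atil_mult_carrier[OF x]] .
  have "stack_mat d N (\<lambda>i. Ki i * Atil i w) *\<^sub>v x = stack_vec N (\<lambda>i. (Ki i * Atil i w) *\<^sub>v x)"
    using mult_carrier_mat[OF Ki_carrier Atil_carrier] x by (intro stack_mat_mult_vec[of _ _ m]) auto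
  also have "\<dots> = stack_vec N ?v"
    using assoc_mult_mat_vec[OF Ki_carrier Atil_carrier x] by (intro stack_vec_cong) simp
  finally have "ustar w x = ubar x - stack_vec N ?v"
    unfolding ustar_def ubar_def using assoc_mult_mat_vec[OF K_carrier Abar_carrier x] by simp
  also have "\<dots> = ubar x + - stack_vec N ?v"
    using ubar_carrier[OF x] stack_vec_carrier[of N ?v m, OF v] unfolding q_def by (rule minus_add_uminus_vec)
  finally show ?thesis unfolding util_def using stack_vec_uminus[of N ?v m, OF v] by simp
qed

lemma ustar_eq_stack:
  assumes w: "w \<in> space M" and x: "x \<in> carrier_vec d"
  shows "ustar w x = stack_vec N (\<lambda>i. ufun i x (blk i w))"
proof -
  have "ustar w x = stack_vec N (\<lambda>i. (E i)\<^sup>T *\<^sub>v ubar x) + stack_vec N (\<lambda>i. util i x w)"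
    using ustar_stack_util[OF x] stack_blocks_eq[OF ubar_carrier[OF x]] by simp
  also have "\<dots> = stack_vec N (\<lambda>i. (E i)\<^sup>T *\<^sub>v ubar x + util i x w)"
    using block_ubar_carrier[OF x] util_carrier[OF x] by (intro stack_vec_add[of _ _ m]) auto
  also have "\<dots> = stack_vec N (\<lambda>i. ufun i x (blk i w))"
    using ufun_blk[OF assms] by (intro stack_vec_cong) simp
  finally show ?thesis .
qed

lemma ustar_carrier:
  assumes w: "w \<in> space M" and x: "x \<in> carrier_vec d"
  shows "ustar w x \<in> carrier_vec q"
  unfolding ustar_stack_util[OF x] using ubar_carrier[OF x] stack_vec_carrier[of N "\<lambda>i. util i x w" m] util_carrier[OF x]
  by (simp add: q_def)

lemma u_square_integrable:
  assumes x: "x \<in> carrier_vec d" and i: "i < N"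
  shows "square_integrable_vec M (m i) (\<lambda>w. ufun i x (blk i w))"
proof -
  have "square_integrable_vec M (m i) (\<lambda>w. (E i)\<^sup>T *\<^sub>v ubar x + - (Ki i *\<^sub>v (Atil i w *\<^sub>v x)))"
    by (intro square_integrable_add square_integrable_uminus square_integrable_const
        square_integrable_mult[OF _ Ki_carrier[OF i]] y_square_integrable block_ubar_carrier x i)
  then show ?thesis
    by (rule square_integrable_cong[THEN iffD1, rotated]) (simp add: ufun_blk[OF _ x i] util_def)
qed

text \<open>
  The optimally controlled successor differs from its mean by the sum of the vectors
  \<open>zmat i *\<^sub>v (Atil i w *\<^sub>v x)\<close>, see \<open>successor_decomp\<close>. The vector \<open>grad\<close> is half the gradient of the
  one-step cost at the optimal input; its mean vanishes, and it is the sum of the vectors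
  \<open>hmat i *\<^sub>v (Atil i w *\<^sub>v x)\<close>, see \<open>grad_decomp\<close>.
\<close>

definition zmat :: "nat \<Rightarrow> real mat" where
  "zmat i = 1\<^sub>m d - Bi i * Ki i"

definition hmat :: "nat \<Rightarrow> real mat" where
  "hmat i = B\<^sup>T * (P * zmat i) - R * (E i * Ki i)"

definition grad :: "'w \<Rightarrow> real vec \<Rightarrow> real vec" where
  "grad w x = R *\<^sub>v ustar w x + B\<^sup>T *\<^sub>v (P *\<^sub>v (A w *\<^sub>v x + B *\<^sub>v ustar w x))"

lemma zmat_carrier: "i < N \<Longrightarrow> zmat i \<in> carrier_mat d d"
  unfolding zmat_def by (intro minus_carrier_mat mult_carrier_mat[OF Bi_carrier Ki_carrier])

lemma hess_carrier: "hess \<in> carrier_mat q q"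
  using hess_pd by (simp add: pd_mat_def)

lemma hmat_carrier: "i < N \<Longrightarrow> hmat i \<in> carrier_mat q d"
  unfolding hmat_def by (intro minus_carrier_mat mult_carrier_mat[OF R_carrier] mult_carrier_mat[OF E_carrier Ki_carrier])

lemma zmat_mult:
  assumes "y \<in> carrier_vec d" "i < N"
  shows "zmat i *\<^sub>v y = y + Bi i *\<^sub>v (- (Ki i *\<^sub>v y))"
proof -
  note KB = Ki_carrier[OF assms(2)] Bi_carrier[OF assms(2)]
  have w: "Ki i *\<^sub>v y \<in> carrier_vec (m i)" using mv_carrier[OF KB(1) assms(1)] .
  then have w2: "Bi i *\<^sub>v (Ki i *\<^sub>v y) \<in> carrier_vec d" using KB(2) by simp
  have "zmat i *\<^sub>v y = 1\<^sub>m d *\<^sub>v y - Bi i * Ki i *\<^sub>v y"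
    unfolding zmat_def by (rule minus_mult_distrib_mat_vec[OF one_carrier_mat mult_carrier_mat[OF KB(2,1)] assms(1)])
  also have "\<dots> = y - Bi i *\<^sub>v (Ki i *\<^sub>v y)" using KB assms by (simp add: assoc_mult_mat_vec[OF KB(2,1)])
  also have "\<dots> = y + - (Bi i *\<^sub>v (Ki i *\<^sub>v y))" using assms w2 by (intro minus_add_uminus_vec[of _ d]) auto
  finally show ?thesis using mult_mat_uminus_vec[OF KB(2) w] by simp
qed

lemma hmat_mult:
  assumes y: "y \<in> carrier_vec d" and i: "i < N"
  shows "hmat i *\<^sub>v y = R *\<^sub>v (E i *\<^sub>v (- (Ki i *\<^sub>v y))) + B\<^sup>T *\<^sub>v (P *\<^sub>v (zmat i *\<^sub>v y))"
proof -
  note K = Ki_carrier[OF i] and Z = zmat_carrier[OF i]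
  have Ky: "Ki i *\<^sub>v y \<in> carrier_vec (m i)" using mv_carrier[OF K y] .
  have EKy: "E i *\<^sub>v (Ki i *\<^sub>v y) \<in> carrier_vec q" using mv_carrier[OF E_carrier Ky] .
  have "hmat i *\<^sub>v y = B\<^sup>T * (P * zmat i) *\<^sub>v y - R * (E i * Ki i) *\<^sub>v y"
    unfolding hmat_def
    by (rule minus_mult_distrib_mat_vec[OF mult_carrier_mat[OF tB_carrier mult_carrier_mat[OF P_carrier Z]]
          mult_carrier_mat[OF R_carrier mult_carrier_mat[OF E_carrier K]] y])
  also have "\<dots> = B\<^sup>T *\<^sub>v (P *\<^sub>v (zmat i *\<^sub>v y)) - R *\<^sub>v (E i *\<^sub>v (Ki i *\<^sub>v y))"
    unfolding assoc_mult_mat_vec[OF tB_carrier mult_carrier_mat[OF P_carrier Z] y] assoc_mult_mat_vec[OF P_carrier Z y]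
      assoc_mult_mat_vec[OF R_carrier mult_carrier_mat[OF E_carrier K] y] assoc_mult_mat_vec[OF E_carrier K y] ..
  also have "\<dots> = R *\<^sub>v (E i *\<^sub>v (- (Ki i *\<^sub>v y))) + B\<^sup>T *\<^sub>v (P *\<^sub>v (zmat i *\<^sub>v y))"
    unfolding mult_mat_uminus_vec[OF E_carrier Ky] mult_mat_uminus_vec[OF R_carrier EKy]
    using carrier_matD[OF R_carrier] carrier_matD[OF B_carrier]
    by (intro eq_vecI) (auto simp del: index_mult_mat_vec)
  finally show ?thesis .
qed

text \<open>
  The \<open>i\<close>-th centred block row contributes nothing to block \<open>i\<close> of the gradient: this is the
  stationarity equation for the gain \<open>Ki i\<close>.
\<close>

lemma block_hmat_zero:
  assumes y: "y \<in> carrier_vec d" and i: "i < N"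
  shows "(E i)\<^sup>T * hmat i *\<^sub>v y = 0\<^sub>v (m i)"
proof -
  define w where "w = - (Ki i *\<^sub>v y)"
  have w: "w \<in> carrier_vec (m i)" unfolding w_def using mv_carrier[OF Ki_carrier[OF i] y] by simp
  have Ew: "E i *\<^sub>v w \<in> carrier_vec q" using mv_carrier[OF E_carrier w] .
  have Pz: "P *\<^sub>v (zmat i *\<^sub>v y) \<in> carrier_vec d"
    using mv_carrier[OF P_carrier mv_carrier[OF zmat_carrier[OF i] y]] .
  have tBi: "(Bi i)\<^sup>T = (E i)\<^sup>T * B\<^sup>T"
    unfolding Bi_eq[OF i] by (rule transpose_mult[OF B_carrier E_carrier])
  have "(E i)\<^sup>T * hmat i *\<^sub>v y = (E i)\<^sup>T *\<^sub>v (hmat i *\<^sub>v y)"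
    by (rule assoc_mult_mat_vec[OF tE_carrier hmat_carrier[OF i] y])
  also have "\<dots> = (E i)\<^sup>T *\<^sub>v (R *\<^sub>v (E i *\<^sub>v w)) + (E i)\<^sup>T *\<^sub>v (B\<^sup>T *\<^sub>v (P *\<^sub>v (zmat i *\<^sub>v y)))"
    unfolding hmat_mult[OF y i] w_def[symmetric]
    by (rule mult_add_distrib_mat_vec[OF tE_carrier mv_carrier[OF R_carrier Ew] mv_carrier[OF tB_carrier Pz]])
  also have "(E i)\<^sup>T *\<^sub>v (R *\<^sub>v (E i *\<^sub>v w)) = Rd i *\<^sub>v w"
    unfolding Rd_eq[OF i, symmetric]
      assoc_mult_mat_vec[OF mult_carrier_mat[OF tE_carrier R_carrier] E_carrier w] assoc_mult_mat_vec[OF tE_carrier R_carrier Ew] ..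
  also have "(E i)\<^sup>T *\<^sub>v (B\<^sup>T *\<^sub>v (P *\<^sub>v (zmat i *\<^sub>v y))) = (Bi i)\<^sup>T *\<^sub>v (P *\<^sub>v (y + Bi i *\<^sub>v w))"
    unfolding tBi zmat_mult[OF y i, folded w_def, symmetric] assoc_mult_mat_vec[OF tE_carrier tB_carrier Pz] ..
  also have "Rd i *\<^sub>v w + (Bi i)\<^sup>T *\<^sub>v (P *\<^sub>v (y + Bi i *\<^sub>v w)) = 0\<^sub>v (m i)"
    unfolding w_def by (rule gain_stationary[OF block_hess_pd P_carrier Bi_carrier Rd_carrier y]) (fact i)+
  finally show ?thesis .
qed

lemma stack_util_sum:
  assumes x: "x \<in> carrier_vec d"
  shows "stack_vec N (\<lambda>i. util i x w) = vec_sum q (\<lambda>i. E i *\<^sub>v util i x w) N"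
  unfolding q_def using util_carrier[OF x] by (rule stack_vec_eq_vec_sum)

lemma zmat_Atil_mult:
  assumes x: "x \<in> carrier_vec d" and i: "i < N"
  shows "zmat i *\<^sub>v (Atil i w *\<^sub>v x) = Atil i w *\<^sub>v x + B *\<^sub>v (E i *\<^sub>v util i x w)"
proof -
  have "B *\<^sub>v (E i *\<^sub>v util i x w) = Bi i *\<^sub>v util i x w"
    unfolding Bi_eq[OF i] by (rule assoc_mult_mat_vec[OF B_carrier E_carrier util_carrier[OF x i], symmetric])
  then show ?thesis using zmat_mult[OF Atil_mult_carrier[OF x] i] by (simp add: util_def)
qed

lemma successor_decomp:
  assumes w: "w \<in> space M" and x: "x \<in> carrier_vec d"
  shows "A w *\<^sub>v x + B *\<^sub>v ustar w x =
    (Abar *\<^sub>v x + B *\<^sub>v ubar x) + vec_sum d (\<lambda>i. zmat i *\<^sub>v (Atil i w *\<^sub>v x)) N"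
proof -
  let ?y = "\<lambda>i. Atil i w *\<^sub>v x" and ?Eu = "\<lambda>i. E i *\<^sub>v util i x w"
  have Eu: "?Eu i \<in> carrier_vec q" if "i < N" for i
    using mv_carrier[OF E_carrier util_carrier[OF x that]] .
  have "B *\<^sub>v ustar w x = B *\<^sub>v ubar x + B *\<^sub>v vec_sum q ?Eu N"
    unfolding ustar_stack_util[OF x] stack_util_sum[OF x]
    by (rule mult_add_distrib_mat_vec[OF B_carrier ubar_carrier[OF x] vec_sum_carrier])
  also have "B *\<^sub>v vec_sum q ?Eu N = vec_sum d (\<lambda>i. B *\<^sub>v ?Eu i) N"
    by (rule mult_mat_vec_sum[OF B_carrier Eu])
  finally have 1: "B *\<^sub>v ustar w x = B *\<^sub>v ubar x + vec_sum d (\<lambda>i. B *\<^sub>v ?Eu i) N" .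
  have "vec_sum d ?y N + vec_sum d (\<lambda>i. B *\<^sub>v ?Eu i) N = vec_sum d (\<lambda>i. ?y i + B *\<^sub>v ?Eu i) N"
    using Atil_mult_carrier[OF x] mv_carrier[OF B_carrier Eu] by (intro vec_sum_add) auto
  also have "\<dots> = vec_sum d (\<lambda>i. zmat i *\<^sub>v ?y i) N"
  proof -
    have "?y i + B *\<^sub>v ?Eu i = zmat i *\<^sub>v ?y i" if "i < N" for i
      using zmat_Atil_mult[OF x that] by simp
    then show ?thesis by (simp add: vec_sum_def)
  qed
  finally have 2: "vec_sum d ?y N + vec_sum d (\<lambda>i. B *\<^sub>v ?Eu i) N = vec_sum d (\<lambda>i. zmat i *\<^sub>v ?y i) N" .
  have c: "Abar *\<^sub>v x \<in> carrier_vec d" "B *\<^sub>v ubar x \<in> carrier_vec d"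
    using mv_carrier[OF Abar_carrier x] mv_carrier[OF B_carrier ubar_carrier[OF x]] by auto
  have "a + v + (b + y) = a + b + (v + y)" if "a \<in> carrier_vec d" "b \<in> carrier_vec d" "v \<in> carrier_vec d" "y \<in> carrier_vec d"
    for a b v y :: "real vec" using that by (intro eq_vecI) auto
  then show ?thesis unfolding A_mult_decomp[OF assms] 1 2[symmetric] using c by simp
qed

lemma grad_decomp:
  assumes w: "w \<in> space M" and x: "x \<in> carrier_vec d"
  shows "grad w x = vec_sum q (\<lambda>i. hmat i *\<^sub>v (Atil i w *\<^sub>v x)) N"
proof -
  let ?y = "\<lambda>i. Atil i w *\<^sub>v x" and ?Eu = "\<lambda>i. E i *\<^sub>v util i x w"
  let ?z = "\<lambda>i. zmat i *\<^sub>v ?y i"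
  have Eu: "?Eu i \<in> carrier_vec q" if "i < N" for i
    using mv_carrier[OF E_carrier util_carrier[OF x that]] .
  have z: "?z i \<in> carrier_vec d" if "i < N" for i
    using mv_carrier[OF zmat_carrier[OF that] Atil_mult_carrier[OF x]] .
  define c where "c = Abar *\<^sub>v x + B *\<^sub>v ubar x"
  have cc: "c \<in> carrier_vec d"
    unfolding c_def using mv_carrier[OF Abar_carrier x] mv_carrier[OF B_carrier ubar_carrier[OF x]] by auto
  have 1: "R *\<^sub>v ustar w x = R *\<^sub>v ubar x + vec_sum q (\<lambda>i. R *\<^sub>v ?Eu i) N"
    unfolding ustar_stack_util[OF x] stack_util_sum[OF x]
      mult_add_distrib_mat_vec[OF R_carrier ubar_carrier[OF x] vec_sum_carrier]
    using mult_mat_vec_sum[OF R_carrier Eu, of N "\<lambda>i. i"] by simp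
  have "P *\<^sub>v (A w *\<^sub>v x + B *\<^sub>v ustar w x) = P *\<^sub>v c + vec_sum d (\<lambda>i. P *\<^sub>v ?z i) N"
    unfolding successor_decomp[OF assms] c_def[symmetric]
      mult_add_distrib_mat_vec[OF P_carrier cc vec_sum_carrier]
    using mult_mat_vec_sum[OF P_carrier z, of N "\<lambda>i. i"] by simp
  then have 2: "B\<^sup>T *\<^sub>v (P *\<^sub>v (A w *\<^sub>v x + B *\<^sub>v ustar w x))
      = B\<^sup>T *\<^sub>v (P *\<^sub>v c) + vec_sum q (\<lambda>i. B\<^sup>T *\<^sub>v (P *\<^sub>v ?z i)) N"
    using mult_add_distrib_mat_vec[OF tB_carrier mv_carrier[OF P_carrier cc] vec_sum_carrier]
      mult_mat_vec_sum[OF tB_carrier mv_carrier[OF P_carrier z]] by simp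
  have 3: "R *\<^sub>v ubar x + B\<^sup>T *\<^sub>v (P *\<^sub>v c) = 0\<^sub>v q"
    unfolding c_def ubar_def
    by (rule gain_stationary[OF hess_pd P_carrier B_carrier R_carrier mv_carrier[OF Abar_carrier x]])
  have 4: "vec_sum q (\<lambda>i. R *\<^sub>v ?Eu i) N + vec_sum q (\<lambda>i. B\<^sup>T *\<^sub>v (P *\<^sub>v ?z i)) N
     = vec_sum q (\<lambda>i. R *\<^sub>v ?Eu i + B\<^sup>T *\<^sub>v (P *\<^sub>v ?z i)) N"
    using mv_carrier[OF R_carrier Eu] mv_carrier[OF tB_carrier mv_carrier[OF P_carrier z]]
    by (intro vec_sum_add) auto
  have 5: "R *\<^sub>v ?Eu i + B\<^sup>T *\<^sub>v (P *\<^sub>v ?z i) = hmat i *\<^sub>v ?y i" if "i < N" for i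
    unfolding hmat_mult[OF Atil_mult_carrier[OF x] that] util_def ..
  have "a + v + (b + y) = a + b + (v + y)" if "a \<in> carrier_vec q" "b \<in> carrier_vec q" "v \<in> carrier_vec q" "y \<in> carrier_vec q"
    for a b v y :: "real vec" using that by (intro eq_vecI) auto
  then have "grad w x = (R *\<^sub>v ubar x + B\<^sup>T *\<^sub>v (P *\<^sub>v c)) + vec_sum q (\<lambda>i. R *\<^sub>v ?Eu i + B\<^sup>T *\<^sub>v (P *\<^sub>v ?z i)) N"
    unfolding grad_def 1 2 4[symmetric]
    using mv_carrier[OF R_carrier ubar_carrier[OF x]] mv_carrier[OF tB_carrier mv_carrier[OF P_carrier cc]]
    by simp
  also have "\<dots> = vec_sum q (\<lambda>i. hmat i *\<^sub>v ?y i) N"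
    unfolding 3 using 5 by (simp add: vec_sum_def)
  finally show ?thesis .
qed

text \<open>
  The key fact: in expectation the gradient is orthogonal to every input whose block \<open>i\<close> depends on
  block row \<open>i\<close> only.
\<close>

lemma grad_orthogonal:
  assumes f: "\<And>i. i < N \<Longrightarrow> f i \<in> block_laws i"
    and X: "\<And>i. i < N \<Longrightarrow> square_integrable_vec M (m i) (\<lambda>w. f i (blk i w))"
    and x: "x \<in> carrier_vec d"
  shows "integrable M (\<lambda>w. stack_vec N (\<lambda>i. f i (blk i w)) \<bullet> grad w x)"
    and "(\<integral>w. stack_vec N (\<lambda>i. f i (blk i w)) \<bullet> grad w x \<partial>M) = 0"
proof -
  let ?t = "\<lambda>i j w. f i (blk i w) \<bullet> (((E i)\<^sup>T * hmat j) *\<^sub>v (Atil j w *\<^sub>v x))"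
  have G: "(E i)\<^sup>T * hmat j \<in> carrier_mat (m i) d" if "j < N" for i j
    using mult_carrier_mat[OF tE_carrier hmat_carrier[OF that]] .
  have fc: "f i (blk i w) \<in> carrier_vec (m i)" if "i < N" "w \<in> space M" for i w
    using measurable_space[OF f[OF that(1)]] measurable_space[OF blk_measurable[OF that(1)] that(2)] by simp
  have eq: "stack_vec N (\<lambda>i. f i (blk i w)) \<bullet> grad w x = (\<Sum>i<N. \<Sum>j<N. ?t i j w)" if w: "w \<in> space M" for w
  proof -
    have h: "hmat j *\<^sub>v (Atil j w *\<^sub>v x) \<in> carrier_vec q" if "j < N" for j
      using mv_carrier[OF hmat_carrier[OF that] Atil_mult_carrier[OF x]] .
    have g: "grad w x \<in> carrier_vec (offset m N)" unfolding grad_decomp[OF w x] q_def[symmetric] by simp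
    have "stack_vec N (\<lambda>i. f i (blk i w)) \<bullet> grad w x = (\<Sum>i<N. f i (blk i w) \<bullet> ((E i)\<^sup>T *\<^sub>v grad w x))"
      by (rule stack_vec_scalar_prod[OF fc[OF _ w] g])
    also have "\<dots> = (\<Sum>i<N. \<Sum>j<N. ?t i j w)"
    proof (intro sum.cong refl)
      fix i assume i: "i \<in> {..<N}"
      have "(E i)\<^sup>T *\<^sub>v grad w x = vec_sum (m i) (\<lambda>j. (E i)\<^sup>T *\<^sub>v (hmat j *\<^sub>v (Atil j w *\<^sub>v x))) N"
        unfolding grad_decomp[OF w x] by (rule mult_mat_vec_sum[OF tE_carrier h])
      then have "f i (blk i w) \<bullet> ((E i)\<^sup>T *\<^sub>v grad w x) = f i (blk i w) \<bullet> vec_sum (m i) (\<lambda>j. (E i)\<^sup>T *\<^sub>v (hmat j *\<^sub>v (Atil j w *\<^sub>v x))) N"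
        by simp
      also have "\<dots> = (\<Sum>j<N. f i (blk i w) \<bullet> ((E i)\<^sup>T *\<^sub>v (hmat j *\<^sub>v (Atil j w *\<^sub>v x))))"
        using i fc w by (intro scalar_prod_vec_sum mv_carrier[OF tE_carrier h]) auto
      also have "\<dots> = (\<Sum>j<N. ?t i j w)"
        using assoc_mult_mat_vec[OF tE_carrier hmat_carrier Atil_mult_carrier[OF x]] by (intro sum.cong) auto
      finally show "f i (blk i w) \<bullet> ((E i)\<^sup>T *\<^sub>v grad w x) = (\<Sum>j<N. ?t i j w)" .
    qed
    finally show ?thesis .
  qed
  have int: "integrable M (?t i j)" if "i < N" "j < N" for i j
    using square_integrable_form(1)[OF X[OF that(1)] y_square_integrable[OF x that(2)] G[OF that(2)]] .
  \<comment> \<open>On the diagonal the factor itself vanishes; off the diagonal independence applies.\<close>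
  have zero: "(\<integral>w. ?t i j w \<partial>M) = 0" if "i < N" "j < N" for i j
  proof (cases "i = j")
    case True
    have "?t i j w = 0" if "w \<in> space M" for w
      unfolding True block_hmat_zero[OF Atil_mult_carrier[OF x] \<open>j < N\<close>] using fc[OF \<open>j < N\<close> that] by simp
    then show ?thesis by (simp cong: lint_congs)
  next
    case False
    then show ?thesis using cross_term_zero[OF f[OF that(1)] X[OF that(1)] that _ x G[OF that(2)]] by simp
  qed
  show "integrable M (\<lambda>w. stack_vec N (\<lambda>i. f i (blk i w)) \<bullet> grad w x)"
    using integral_double_sum(1)[of N N M ?t, OF int] by (simp add: eq cong: lint_congs)
  have "(\<integral>w. stack_vec N (\<lambda>i. f i (blk i w)) \<bullet> grad w x \<partial>M) = (\<integral>w. (\<Sum>i<N. \<Sum>j<N. ?t i j w) \<partial>M)"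
    by (intro lint_congs(2) refl eq)
  also have "\<dots> = (\<Sum>i<N. \<Sum>j<N. \<integral>w. ?t i j w \<partial>M)"
    by (rule integral_double_sum(2)[of N N M ?t, OF int])
  also have "\<dots> = 0" using zero by simp
  finally show "(\<integral>w. stack_vec N (\<lambda>i. f i (blk i w)) \<bullet> grad w x \<partial>M) = 0" .
qed

lemma riccati_Atil_carrier: "i < N \<Longrightarrow> ric i w \<in> carrier_mat d d"
  by (rule riccati_carrier[OF block_hess_pd P_carrier Bi_carrier Atil_carrier])

lemma riccati_Atil_form:
  assumes v: "v \<in> carrier_vec d" and y: "y \<in> carrier_vec d" and i: "i < N"
  shows "v \<bullet> (ric i w *\<^sub>v y)
    = (Atil i w *\<^sub>v v) \<bullet> ((P * zmat i) *\<^sub>v (Atil i w *\<^sub>v y))"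
  unfolding riccati_form[OF block_hess_pd[OF i] P_carrier Bi_carrier[OF i] Atil_carrier v y]
    assoc_mult_mat_vec[OF P_carrier zmat_carrier[OF i] Atil_mult_carrier[OF y]]
    zmat_mult[OF Atil_mult_carrier[OF y] i] ..

lemma riccati_Atil_integrable:
  assumes i: "i < N" and ab: "a < d" "b < d"
  shows "integrable M (\<lambda>w. ric i w $$ (a, b))"
proof -
  have "integrable M (\<lambda>w. (Atil i w *\<^sub>v unit_vec d a) \<bullet> ((P * zmat i) *\<^sub>v (Atil i w *\<^sub>v unit_vec d b)))"
    by (intro square_integrable_form(1)[OF y_square_integrable y_square_integrable] i
        mult_carrier_mat[OF P_carrier zmat_carrier]) auto
  then show ?thesis
    unfolding riccati_Atil_form[OF unit_vec_carrier unit_vec_carrier i, symmetric]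
      unit_vec_form[OF riccati_Atil_carrier[OF i] ab] .
qed

lemma cost_to_go_carrier: "cost_to_go \<in> carrier_mat d d"
  unfolding cost_to_go_def by (intro add_carrier_mat) (simp add: mat_sum_def)

lemma cost_to_go_sym: "transpose_mat cost_to_go = cost_to_go"
proof -
  let ?S = "mat_sum d d (\<lambda>i. expect_mat M d d (ric i)) {..<N}"
  have "ric i w $$ (a, b) = ric i w $$ (b, a)" if "i < N" "a < d" "b < d" for i w a b
    using riccati_sym[OF block_hess_pd[OF that(1)] P_carrier P_sym Bi_carrier[OF that(1)] Atil_carrier, of i w]
      riccati_Atil_carrier[OF that(1), of w] that by (metis carrier_matD index_transpose_mat(1))
  then have "transpose_mat ?S = ?S"
    by (intro eq_matI) (auto simp: mat_sum_def expect_mat_def intro!: sum.cong)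
  moreover have "transpose_mat (riccati Abar P B R) = riccati Abar P B R"
    by (rule riccati_sym[OF hess_pd P_carrier P_sym B_carrier Abar_carrier])
  ultimately show ?thesis
    unfolding cost_to_go_def
    using transpose_add[OF riccati_carrier[OF hess_pd P_carrier B_carrier Abar_carrier], of ?S] by (simp add: mat_sum_def)
qed

text \<open>
  The term of the optimal cost that does not contain the gradient. Expanding both factors around
  their means, only the product of the means and the products of equal indices survive.
\<close>

lemma uncontrolled_term:
  assumes x: "x \<in> carrier_vec d"
  shows "integrable M (\<lambda>w. (A w *\<^sub>v x) \<bullet> (P *\<^sub>v (A w *\<^sub>v x + B *\<^sub>v ustar w x)))"
    and "(\<integral>w. (A w *\<^sub>v x) \<bullet> (P *\<^sub>v (A w *\<^sub>v x + B *\<^sub>v ustar w x)) \<partial>M) = x \<bullet> (cost_to_go *\<^sub>v x)"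
proof -
  let ?y = "\<lambda>i w. Atil i w *\<^sub>v x"
  define a where "a = Abar *\<^sub>v x"
  define c where "c = a + B *\<^sub>v ubar x"
  have a: "a \<in> carrier_vec d" unfolding a_def using mv_carrier[OF Abar_carrier x] .
  have c: "c \<in> carrier_vec d" unfolding c_def using a mv_carrier[OF B_carrier ubar_carrier[OF x]] by simp
  have PZ: "P * zmat j \<in> carrier_mat d d" if "j < N" for j by (rule mult_carrier_mat[OF P_carrier zmat_carrier[OF that]])
  have y: "?y i w \<in> carrier_vec d" for i w by (rule Atil_mult_carrier[OF x])
  define t1 where "t1 j w = a \<bullet> ((P * zmat j) *\<^sub>v ?y j w)" for j w
  define t2 where "t2 i w = c \<bullet> (P *\<^sub>v ?y i w)" for i w
  define t3 where "t3 i j w = ?y i w \<bullet> ((P * zmat j) *\<^sub>v ?y j w)" for i j w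
  have eq: "(A w *\<^sub>v x) \<bullet> (P *\<^sub>v (A w *\<^sub>v x + B *\<^sub>v ustar w x)) =
      a \<bullet> (P *\<^sub>v c) + (\<Sum>j<N. t1 j w) + ((\<Sum>i<N. t2 i w) + (\<Sum>i<N. \<Sum>j<N. t3 i j w))" if w: "w \<in> space M" for w
  proof -
    have z: "zmat i *\<^sub>v ?y i w \<in> carrier_vec d" if "i < N" for i
      using mv_carrier[OF zmat_carrier[OF that] y] .
    have Pc: "P *\<^sub>v c \<in> carrier_vec d" using mv_carrier[OF P_carrier c] .
    have "P *\<^sub>v (A w *\<^sub>v x + B *\<^sub>v ustar w x) = P *\<^sub>v c + P *\<^sub>v vec_sum d (\<lambda>i. zmat i *\<^sub>v ?y i w) N"
      unfolding successor_decomp[OF w x] a_def[symmetric] c_def[symmetric]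
      by (rule mult_add_distrib_mat_vec[OF P_carrier c vec_sum_carrier])
    also have "P *\<^sub>v vec_sum d (\<lambda>i. zmat i *\<^sub>v ?y i w) N = vec_sum d (\<lambda>i. P *\<^sub>v (zmat i *\<^sub>v ?y i w)) N"
      by (rule mult_mat_vec_sum[OF P_carrier z])
    also have "\<dots> = vec_sum d (\<lambda>i. (P * zmat i) *\<^sub>v ?y i w) N" (is "_ = ?s")
      using assoc_mult_mat_vec[OF P_carrier zmat_carrier y] by (simp add: vec_sum_def)
    finally have 1: "P *\<^sub>v (A w *\<^sub>v x + B *\<^sub>v ustar w x) = P *\<^sub>v c + ?s" .
    have pz: "(P * zmat j) *\<^sub>v ?y j w \<in> carrier_vec d" if "j < N" for j using mv_carrier[OF PZ[OF that] y] .
    have s: "v \<bullet> (P *\<^sub>v c + ?s) = v \<bullet> (P *\<^sub>v c) + (\<Sum>j<N. v \<bullet> ((P * zmat j) *\<^sub>v ?y j w))" if v: "v \<in> carrier_vec d" for v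
      using scalar_prod_add_distrib[OF v Pc vec_sum_carrier] scalar_prod_vec_sum[OF pz v, of N "\<lambda>j. j"] by simp
    have "(A w *\<^sub>v x) \<bullet> (P *\<^sub>v c + ?s) = a \<bullet> (P *\<^sub>v c + ?s) + vec_sum d (\<lambda>i. ?y i w) N \<bullet> (P *\<^sub>v c + ?s)"
      unfolding A_mult_decomp[OF w x] a_def[symmetric]
      by (rule add_scalar_prod_distrib[OF a vec_sum_carrier]) (use Pc in simp)
    also have "vec_sum d (\<lambda>i. ?y i w) N \<bullet> (P *\<^sub>v c + ?s) = (\<Sum>i<N. ?y i w \<bullet> (P *\<^sub>v c + ?s))"
      using vec_sum_form[OF one_carrier_mat[of d], where f = "\<lambda>i. ?y i w" and N = N and w = "P *\<^sub>v c + ?s"] y Pc by simp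
    also have "\<dots> = (\<Sum>i<N. t2 i w) + (\<Sum>i<N. \<Sum>j<N. t3 i j w)"
      using s[OF y] sym_form_swap[OF P_carrier P_sym c y] by (simp add: t2_def t3_def sum.distrib)
    finally show ?thesis unfolding 1 using s[OF a] by (simp add: t1_def)
  qed
  have i1: "integrable M (t1 j)" "(\<integral>w. t1 j w \<partial>M) = 0" if "j < N" for j
    unfolding t1_def
    using square_integrable_form(1)[OF square_integrable_const[OF a] y_square_integrable[OF x that] PZ[OF that]]
      form_expectation_zero_const[OF a y_square_integrable[OF x that] PZ[OF that] y_mean[OF x that]] by auto
  have i2: "integrable M (t2 j)" "(\<integral>w. t2 j w \<partial>M) = 0" if "j < N" for j
    unfolding t2_def
    using square_integrable_form(1)[OF square_integrable_const[OF c] y_square_integrable[OF x that] P_carrier]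
      form_expectation_zero_const[OF c y_square_integrable[OF x that] P_carrier y_mean[OF x that]] by auto
  have i3: "integrable M (t3 i j)" if "i < N" "j < N" for i j
    unfolding t3_def
    using square_integrable_form(1)[OF y_square_integrable[OF x that(1)] y_square_integrable[OF x that(2)] PZ[OF that(2)]] .
  have z3: "(\<integral>w. t3 i j w \<partial>M) = (if j = i then x \<bullet> (expect_mat M d d (ric i) *\<^sub>v x) else 0)"
    if ij: "i < N" "j < N" for i j
  proof (cases "i = j")
    case True
    have "(\<integral>w. t3 i j w \<partial>M) = (\<integral>w. x \<bullet> (ric i w *\<^sub>v x) \<partial>M)"
      unfolding t3_def True riccati_Atil_form[OF x x ij(2)] ..
    also have "\<dots> = x \<bullet> (expect_mat M d d (ric i) *\<^sub>v x)"
      by (rule expect_mat_form[OF riccati_Atil_carrier[OF ij(1)] riccati_Atil_integrable[OF ij(1)] x x])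
    finally show ?thesis using True by simp
  next
    case False
    have "square_integrable_vec M d (\<lambda>w. yfun i x (blk i w))"
      using y_square_integrable[OF x ij(1)]
      by (rule square_integrable_cong[THEN iffD1, rotated]) (simp add: yfun_blk[OF _ x ij(1)])
    from cross_term_zero[OF yfun_measurable[OF x ij(1)] this ij False x PZ[OF ij(2)]]
    have "(\<integral>w. t3 i j w \<partial>M) = 0" unfolding t3_def
      by (simp add: yfun_blk[OF _ x ij(1)] cong: lint_congs)
    then show ?thesis using False by auto
  qed
  note i4 = integral_double_sum[of N N M t3, OF i3]
  have i5: "integrable M (\<lambda>w. \<Sum>j<N. t1 j w)" "(\<integral>w. (\<Sum>j<N. t1 j w) \<partial>M) = 0"
    using i1 by (auto intro!: Bochner_Integration.integrable_sum simp: Bochner_Integration.integral_sum)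
  have i6: "integrable M (\<lambda>w. \<Sum>i<N. t2 i w)" "(\<integral>w. (\<Sum>i<N. t2 i w) \<partial>M) = 0"
    using i2 by (auto intro!: Bochner_Integration.integrable_sum simp: Bochner_Integration.integral_sum)
  have "integrable M (\<lambda>w. a \<bullet> (P *\<^sub>v c) + (\<Sum>j<N. t1 j w) + ((\<Sum>i<N. t2 i w) + (\<Sum>i<N. \<Sum>j<N. t3 i j w)))"
    using i4(1) i5(1) i6(1) by simp
  then show "integrable M (\<lambda>w. (A w *\<^sub>v x) \<bullet> (P *\<^sub>v (A w *\<^sub>v x + B *\<^sub>v ustar w x)))"
    by (simp add: eq cong: lint_congs)
  have "(\<integral>w. (A w *\<^sub>v x) \<bullet> (P *\<^sub>v (A w *\<^sub>v x + B *\<^sub>v ustar w x)) \<partial>M)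
      = (\<integral>w. a \<bullet> (P *\<^sub>v c) + (\<Sum>j<N. t1 j w) + ((\<Sum>i<N. t2 i w) + (\<Sum>i<N. \<Sum>j<N. t3 i j w)) \<partial>M)"
    by (intro lint_congs(2) refl eq)
  also have "\<dots> = a \<bullet> (P *\<^sub>v c) + (\<Sum>i<N. \<Sum>j<N. \<integral>w. t3 i j w \<partial>M)"
    using i4 i5 i6 by (simp add: prob_space)
  also have "(\<Sum>i<N. \<Sum>j<N. \<integral>w. t3 i j w \<partial>M)
      = (\<Sum>i<N. \<Sum>j<N. if j = i then x \<bullet> (expect_mat M d d (ric i) *\<^sub>v x) else 0)"
    using z3 by (intro sum.cong refl) auto
  also have "\<dots> = (\<Sum>i<N. x \<bullet> (expect_mat M d d (ric i) *\<^sub>v x))" by simp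
  also have "a \<bullet> (P *\<^sub>v c) + \<dots> = x \<bullet> (cost_to_go *\<^sub>v x)"
  proof -
    let ?S = "mat_sum d d (\<lambda>i. expect_mat M d d (ric i)) {..<N}"
    have S: "?S \<in> carrier_mat d d" by (simp add: mat_sum_def)
    have r: "riccati Abar P B R \<in> carrier_mat d d" by (rule riccati_carrier[OF hess_pd P_carrier B_carrier Abar_carrier])
    have "x \<bullet> (cost_to_go *\<^sub>v x) = x \<bullet> (riccati Abar P B R *\<^sub>v x) + x \<bullet> (?S *\<^sub>v x)"
      unfolding cost_to_go_def add_mult_distrib_mat_vec[OF r S x]
      by (rule scalar_prod_add_distrib[OF x mv_carrier[OF r x] mv_carrier[OF S x]])
    also have "x \<bullet> (riccati Abar P B R *\<^sub>v x) = a \<bullet> (P *\<^sub>v c)"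
      unfolding riccati_form[OF hess_pd P_carrier B_carrier Abar_carrier x x] c_def a_def ubar_def ..
    also have "x \<bullet> (?S *\<^sub>v x) = (\<Sum>i<N. x \<bullet> (expect_mat M d d (ric i) *\<^sub>v x))"
      by (rule mat_sum_form[OF x x]) (simp add: expect_mat_def)
    finally show ?thesis by simp
  qed
  finally show "(\<integral>w. (A w *\<^sub>v x) \<bullet> (P *\<^sub>v (A w *\<^sub>v x + B *\<^sub>v ustar w x)) \<partial>M) = x \<bullet> (cost_to_go *\<^sub>v x)" .
qed

section \<open>Optimality in the one-step problem\<close>

text \<open>The input cost of one step from state \<open>x\<close> with input blocks \<open>u i\<close>, plus the cost of the successor.\<close>

definition step_cost :: "'w \<Rightarrow> real vec \<Rightarrow> (nat \<Rightarrow> real vec) \<Rightarrow> real" where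
  "step_cost w x u = (\<Sum>j<N. u j \<bullet> (Rd j *\<^sub>v u j)) +
     (A w *\<^sub>v x + B *\<^sub>v stack_vec N u) \<bullet> (P *\<^sub>v (A w *\<^sub>v x + B *\<^sub>v stack_vec N u))"

lemma input_cost: "(\<And>i. i < N \<Longrightarrow> u i \<in> carrier_vec (m i)) \<Longrightarrow>
    (\<Sum>j<N. u j \<bullet> (Rd j *\<^sub>v u j)) = stack_vec N u \<bullet> (R *\<^sub>v stack_vec N u)"
  using Rd_carrier by (intro diag_blocks_form[symmetric]) auto

lemma R_nonneg: "v \<in> carrier_vec q \<Longrightarrow> 0 \<le> v \<bullet> (R *\<^sub>v v)"
  by (rule pd_form_nonneg[OF R_pd])

lemma step_cost_nonneg:
  assumes "w \<in> space M" "x \<in> carrier_vec d" "\<And>i. i < N \<Longrightarrow> u i \<in> carrier_vec (m i)"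
  shows "stack_vec N u \<bullet> (R *\<^sub>v stack_vec N u) \<le> step_cost w x u" "0 \<le> step_cost w x u"
proof -
  have s: "stack_vec N u \<in> carrier_vec q" unfolding q_def using assms(3) by (rule stack_vec_carrier)
  have "A w *\<^sub>v x + B *\<^sub>v stack_vec N u \<in> carrier_vec d"
    using mv_carrier[OF A_carrier[OF assms(1)] assms(2)] mv_carrier[OF B_carrier s] by simp
  from P_nonneg[OF this] R_nonneg[OF s]
  show "stack_vec N u \<bullet> (R *\<^sub>v stack_vec N u) \<le> step_cost w x u" "0 \<le> step_cost w x u"
    by (simp_all add: step_cost_def input_cost[OF assms(3)])
qed

lemma ufun_carrier: "x \<in> carrier_vec d \<Longrightarrow> i < N \<Longrightarrow> w \<in> space M \<Longrightarrow> ufun i x (blk i w) \<in> carrier_vec (m i)"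
  using measurable_space[OF ufun_measurable] measurable_space[OF blk_measurable] by simp

context
  fixes \<phi> :: "nat \<Rightarrow> real mat \<Rightarrow> real vec" and x :: "real vec"
  assumes \<phi>: "\<And>i. i < N \<Longrightarrow> \<phi> i \<in> block_laws i"
    and x: "x \<in> carrier_vec d"
begin

text \<open>For fixed \<open>x\<close>, an admissible input is a family \<open>\<phi>\<close> of functions of the single block rows.\<close>

abbreviation "u w i \<equiv> \<phi> i (blk i w)"

text \<open>The deviation from the optimal input.\<close>

definition dev :: "'w \<Rightarrow> real vec" where
  "dev w = stack_vec N (\<lambda>i. \<phi> i (blk i w) + - ufun i x (blk i w))"

lemma phi_carrier: "i < N \<Longrightarrow> w \<in> space M \<Longrightarrow> \<phi> i (blk i w) \<in> carrier_vec (m i)"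
  using measurable_space[OF \<phi>] measurable_space[OF blk_measurable] by simp

lemma dev_carrier: "w \<in> space M \<Longrightarrow> dev w \<in> carrier_vec q"
  unfolding dev_def q_def using phi_carrier ufun_carrier[OF x] by (intro stack_vec_carrier) auto

lemma input_eq_dev: "w \<in> space M \<Longrightarrow> stack_vec N (u w) = ustar w x + dev w"
proof -
  assume w: "w \<in> space M"
  have "ustar w x + dev w = stack_vec N (\<lambda>i. ufun i x (blk i w) + (\<phi> i (blk i w) + - ufun i x (blk i w)))"
    unfolding ustar_eq_stack[OF w x] dev_def using phi_carrier[OF _ w] ufun_carrier[OF x _ w]
    by (intro stack_vec_add[of _ _ m]) auto
  also have "\<dots> = stack_vec N (u w)"
  proof (rule stack_vec_cong)
    fix i assume "i < N"
    then have "ufun i x (blk i w) \<in> carrier_vec (m i)" "\<phi> i (blk i w) \<in> carrier_vec (m i)"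
      using phi_carrier ufun_carrier[OF x] w by auto
    then show "ufun i x (blk i w) + (\<phi> i (blk i w) + - ufun i x (blk i w)) = \<phi> i (blk i w)"
      by (intro eq_vecI) auto
  qed
  finally show ?thesis by simp
qed

lemma dev_zero_iff:
  assumes "w \<in> space M"
  shows "stack_vec N (u w) = ustar w x \<longleftrightarrow> dev w = 0\<^sub>v q"
proof
  assume "stack_vec N (u w) = ustar w x"
  then have "ustar w x + dev w = ustar w x" using input_eq_dev[OF assms] by simp
  then have "(ustar w x + dev w) $ a = ustar w x $ a" for a by simp
  then show "dev w = 0\<^sub>v q" using dev_carrier[OF assms] ustar_carrier[OF assms x]
    by (intro eq_vecI) (auto, metis add_cancel_right_right carrier_vecD index_add_vec(1))
next
  assume "dev w = 0\<^sub>v q"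
  then show "stack_vec N (u w) = ustar w x"
    using input_eq_dev[OF assms] ustar_carrier[OF assms x] by simp
qed

lemma input_cost_phi: "w \<in> space M \<Longrightarrow> (\<Sum>j<N. \<phi> j (blk j w) \<bullet> (Rd j *\<^sub>v \<phi> j (blk j w)))
    = stack_vec N (u w) \<bullet> (R *\<^sub>v stack_vec N (u w))"
  using phi_carrier by (intro input_cost)

lemma step_cost_measurable: "(\<lambda>w. step_cost w x (u w)) \<in> borel_measurable M"
proof -
  have u: "(\<lambda>w. \<phi> i (blk i w)) \<in> M \<rightarrow>\<^sub>M vec_borel (m i)" if "i < N" for i
    using measurable_compose[OF blk_measurable[OF that] \<phi>[OF that]] by simp
  have s: "(\<lambda>w. stack_vec N (u w)) \<in> M \<rightarrow>\<^sub>M vec_borel q"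
    unfolding q_def using measurable_stack_vec[of N "\<lambda>i w. \<phi> i (blk i w)" M m] u by simp
  have z: "(\<lambda>w. A w *\<^sub>v x + B *\<^sub>v stack_vec N (u w)) \<in> M \<rightarrow>\<^sub>M vec_borel d"
    by (intro measurable_vec_add measurable_mult_mat_vec[OF A_meas] measurable_vec_const[OF x] measurable_const_mult_vec[OF B_carrier] s)
  show ?thesis unfolding step_cost_def
    by (intro borel_measurable_add borel_measurable_sum measurable_scalar_prod[OF u] measurable_scalar_prod[OF z]
        measurable_const_mult_vec[OF Rd_carrier u] measurable_const_mult_vec[OF P_carrier z]) auto
qed

lemma finite_step_cost_imp_square_integrable:
  assumes fin: "(\<integral>\<^sup>+w. ennreal (step_cost w x (u w)) \<partial>M) < \<infinity>" and i: "i < N"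
  shows "square_integrable_vec M (m i) (\<lambda>w. \<phi> i (blk i w))"
proof -
  have u: "(\<lambda>w. \<phi> i (blk i w)) \<in> M \<rightarrow>\<^sub>M vec_borel (m i)"
    using measurable_compose[OF blk_measurable[OF i] \<phi>[OF i]] by simp
  have int: "integrable M (\<lambda>w. step_cost w x (u w))"
    using step_cost_measurable fin step_cost_nonneg(2)[OF _ x] phi_carrier
    by (intro integrableI_nonneg) auto
  have "integrable M (\<lambda>w. (\<phi> i (blk i w) $ a)\<^sup>2)" if a: "a < m i" for a
  proof -
    have aq: "offset m i + a < q" unfolding q_def using i a by (rule offset_add_less)
    obtain c where c: "c > 0" "\<And>u. u \<in> carrier_vec q \<Longrightarrow> (u $ (offset m i + a))\<^sup>2 \<le> c * (u \<bullet> (R *\<^sub>v u))"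
      using pd_coercive[OF R_pd aq] by blast
    show ?thesis
    proof (rule Bochner_Integration.integrable_bound)
      show "integrable M (\<lambda>w. c * step_cost w x (u w))" using int by simp
      show "(\<lambda>w. (\<phi> i (blk i w) $ a)\<^sup>2) \<in> borel_measurable M" using measurable_vec_entry[OF u a] by simp
      show "AE w in M. norm ((\<phi> i (blk i w) $ a)\<^sup>2) \<le> norm (c * step_cost w x (u w))"
      proof (rule AE_I2)
        fix w assume w: "w \<in> space M"
        let ?u = "stack_vec N (u w)"
        have "?u \<in> carrier_vec q" unfolding q_def using phi_carrier[OF _ w] by (intro stack_vec_carrier)
        from c(2)[OF this] have "(\<phi> i (blk i w) $ a)\<^sup>2 \<le> c * (?u \<bullet> (R *\<^sub>v ?u))"
          using stack_vec_index[of N "\<lambda>i. \<phi> i (blk i w)" m i a] phi_carrier[OF _ w] i a by simp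
        also have "\<dots> \<le> c * step_cost w x (u w)"
          using step_cost_nonneg(1)[OF w x phi_carrier[OF _ w]] c(1) by (intro mult_left_mono) auto
        finally show "norm ((\<phi> i (blk i w) $ a)\<^sup>2) \<le> norm (c * step_cost w x (u w))" by simp
      qed
    qed
  qed
  then show ?thesis using u by (simp add: square_integrable_vec_def)
qed

lemma step_cost_expectation:
  assumes sq: "\<And>i. i < N \<Longrightarrow> square_integrable_vec M (m i) (\<lambda>w. \<phi> i (blk i w))"
  defines "D \<equiv> \<lambda>w. dev w \<bullet> (hess *\<^sub>v dev w)"
  shows "integrable M D"
    and "(\<integral>\<^sup>+w. ennreal (step_cost w x (u w)) \<partial>M) = ennreal (x \<bullet> (cost_to_go *\<^sub>v x) + (\<integral>w. D w \<partial>M))"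
    and "0 \<le> x \<bullet> (cost_to_go *\<^sub>v x) + (\<integral>w. D w \<partial>M)"
proof -
  define e where "e i S = \<phi> i S + - ufun i x S" for i S
  have em: "e i \<in> block_laws i" if "i < N" for i
    unfolding e_def by (intro measurable_vec_add measurable_vec_uminus \<phi> ufun_measurable x that)
  have esq: "square_integrable_vec M (m i) (\<lambda>w. e i (blk i w))" if "i < N" for i
    unfolding e_def by (intro square_integrable_add square_integrable_uminus sq u_square_integrable x that)
  have dev_e: "dev w = stack_vec N (\<lambda>i. e i (blk i w))" for w unfolding dev_def e_def ..
  have dev_sq: "square_integrable_vec M q dev"
    unfolding q_def dev_e[abs_def] by (rule square_integrable_stack[OF esq])
  show D: "integrable M D" unfolding D_def by (rule square_integrable_form(1)[OF dev_sq dev_sq hess_carrier])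
  let ?g1 = "\<lambda>w. dev w \<bullet> grad w x" and ?g2 = "\<lambda>w. ustar w x \<bullet> grad w x"
  let ?V = "\<lambda>w. (A w *\<^sub>v x) \<bullet> (P *\<^sub>v (A w *\<^sub>v x + B *\<^sub>v ustar w x))"
  have g1: "integrable M ?g1" "(\<integral>w. ?g1 w \<partial>M) = 0"
    unfolding dev_e using grad_orthogonal[OF em esq x] by auto
  have "integrable M ?g2 \<and> (\<integral>w. ?g2 w \<partial>M) = 0"
    using grad_orthogonal[OF ufun_measurable[OF x] u_square_integrable[OF x] x]
    by (simp add: ustar_eq_stack[OF _ x] cong: lint_congs)
  then have g2: "integrable M ?g2" "(\<integral>w. ?g2 w \<partial>M) = 0" by auto
  have eq: "step_cost w x (u w) = D w + 2 * ?g1 w + ?g2 w + ?V w" if w: "w \<in> space M" for w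
    unfolding step_cost_def input_cost_phi[OF w] input_eq_dev[OF w] D_def
    by (rule one_step_cost_expand[OF P_carrier P_sym R_carrier R_sym B_carrier
          mv_carrier[OF A_carrier[OF w] x] ustar_carrier[OF w x] dev_carrier[OF w] grad_def])
  note V = uncontrolled_term[OF x]
  have int: "integrable M (\<lambda>w. step_cost w x (u w))"
    using D g1 g2 V by (simp add: eq cong: lint_congs)
  have val: "(\<integral>w. step_cost w x (u w) \<partial>M) = x \<bullet> (cost_to_go *\<^sub>v x) + (\<integral>w. D w \<partial>M)"
    using D g1 g2 V by (simp add: eq cong: lint_congs)
  have nn: "0 \<le> step_cost w x (u w)" if "w \<in> space M" for w
    using step_cost_nonneg(2)[OF that x phi_carrier[OF _ that]] .
  show "(\<integral>\<^sup>+w. ennreal (step_cost w x (u w)) \<partial>M) = ennreal (x \<bullet> (cost_to_go *\<^sub>v x) + (\<integral>w. D w \<partial>M))"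
    unfolding val[symmetric] using nn by (intro nn_integral_eq_integral int AE_I2)
  show "0 \<le> x \<bullet> (cost_to_go *\<^sub>v x) + (\<integral>w. D w \<partial>M)"
    unfolding val[symmetric] using nn by (intro Bochner_Integration.integral_nonneg)
qed

end

lemma dev_ufun: "x \<in> carrier_vec d \<Longrightarrow> w \<in> space M \<Longrightarrow> dev (\<lambda>i. ufun i x) x w = 0\<^sub>v q"
  by (rule dev_zero_iff[THEN iffD1]) (simp_all add: ufun_measurable ustar_eq_stack)

lemma step_cost_ustar:
  assumes x: "x \<in> carrier_vec d"
  shows "(\<integral>\<^sup>+w. ennreal (step_cost w x (\<lambda>i. ufun i x (blk i w))) \<partial>M) = ennreal (x \<bullet> (cost_to_go *\<^sub>v x))"
    and cost_to_go_nonneg: "0 \<le> x \<bullet> (cost_to_go *\<^sub>v x)"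
proof -
  note e = step_cost_expectation[OF ufun_measurable[OF x] x u_square_integrable[OF x]]
  have "(\<integral>w. dev (\<lambda>i. ufun i x) x w \<bullet> (hess *\<^sub>v dev (\<lambda>i. ufun i x) x w) \<partial>M) = (\<integral>w. 0 \<partial>M)"
    using mv_carrier[OF hess_carrier zero_carrier_vec]
    by (intro lint_congs(2) refl) (simp add: dev_ufun[OF x])
  then show "(\<integral>\<^sup>+w. ennreal (step_cost w x (\<lambda>i. ufun i x (blk i w))) \<partial>M) = ennreal (x \<bullet> (cost_to_go *\<^sub>v x))"
    "0 \<le> x \<bullet> (cost_to_go *\<^sub>v x)"
    using e(2,3) by auto
qed

lemma one_step_optimal:
  assumes \<phi>: "\<And>i. i < N \<Longrightarrow> \<phi> i \<in> block_laws i"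
    and x: "x \<in> carrier_vec d"
  defines "J \<equiv> \<integral>\<^sup>+w. ennreal (step_cost w x (\<lambda>i. \<phi> i (blk i w))) \<partial>M"
  shows "ennreal (x \<bullet> (cost_to_go *\<^sub>v x)) \<le> J"
    and "J = ennreal (x \<bullet> (cost_to_go *\<^sub>v x)) \<longleftrightarrow> (AE w in M. stack_vec N (\<lambda>i. \<phi> i (blk i w)) = ustar w x)"
proof -
  let ?V = "x \<bullet> (cost_to_go *\<^sub>v x)"
  define D where "D w = dev \<phi> x w \<bullet> (hess *\<^sub>v dev \<phi> x w)" for w
  have Dnn: "0 \<le> D w" if "w \<in> space M" for w
    unfolding D_def by (rule pd_form_nonneg[OF hess_pd dev_carrier[OF \<phi> x that]])
  have fin: "integrable M D" "J = ennreal (?V + (\<integral>w. D w \<partial>M))" if "J < \<infinity>"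
    using step_cost_expectation(1,2)[OF \<phi> x finite_step_cost_imp_square_integrable[OF \<phi> x that[unfolded J_def]]]
    unfolding J_def D_def by auto
  \<comment> \<open>If \<open>J\<close> is infinite, the input need not be square integrable, but the claim is trivial.\<close>
  show "ennreal ?V \<le> J"
  proof (cases "J < \<infinity>")
    case True
    have "0 \<le> (\<integral>w. D w \<partial>M)" using Dnn by (intro Bochner_Integration.integral_nonneg)
    then show ?thesis unfolding fin(2)[OF True] by (intro ennreal_leI) simp
  next
    case False
    then have "J = \<top>" by (metis infinity_ennreal_def less_top)
    then show ?thesis by simp
  qed
  show "J = ennreal ?V \<longleftrightarrow> (AE w in M. stack_vec N (\<lambda>i. \<phi> i (blk i w)) = ustar w x)"
  proof
    assume J: "J = ennreal ?V"
    then have lt: "J < \<infinity>" by simp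
    have nn: "0 \<le> (\<integral>w. D w \<partial>M)" using Dnn by (intro Bochner_Integration.integral_nonneg)
    have "ennreal (?V + (\<integral>w. D w \<partial>M)) = ennreal ?V" using fin(2)[OF lt] J by simp
    then have "?V + (\<integral>w. D w \<partial>M) = ?V"
      using ennreal_inj[OF add_nonneg_nonneg[OF cost_to_go_nonneg[OF x] nn] cost_to_go_nonneg[OF x]] by blast
    then have "(\<integral>w. D w \<partial>M) = 0" by simp
    then have "AE w in M. D w = 0"
      using integral_nonneg_eq_0_iff_AE[OF fin(1)[OF lt]] Dnn by auto
    then show "AE w in M. stack_vec N (\<lambda>i. \<phi> i (blk i w)) = ustar w x"
    proof (rule AE_mp, intro AE_I2 impI)
      fix w assume w: "w \<in> space M" and D0: "D w = 0"
      have "dev \<phi> x w = 0\<^sub>v q"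
        using hess_pd dev_carrier[OF \<phi> x w] D0 unfolding pd_mat_def D_def by force
      then show "stack_vec N (\<lambda>i. \<phi> i (blk i w)) = ustar w x" using dev_zero_iff[OF \<phi> x w] by simp
    qed
  next
    assume ae: "AE w in M. stack_vec N (\<lambda>i. \<phi> i (blk i w)) = ustar w x"
    have "J = (\<integral>\<^sup>+w. ennreal (step_cost w x (\<lambda>i. ufun i x (blk i w))) \<partial>M)"
      unfolding J_def
    proof (rule nn_integral_cong_AE, use ae in \<open>rule AE_mp\<close>, intro AE_I2 impI)
      fix w assume w: "w \<in> space M" and eq: "stack_vec N (\<lambda>i. \<phi> i (blk i w)) = ustar w x"
      show "ennreal (step_cost w x (\<lambda>i. \<phi> i (blk i w))) = ennreal (step_cost w x (\<lambda>i. ufun i x (blk i w)))"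
        using input_cost_phi[OF \<phi> x w] input_cost_phi[OF ufun_measurable[OF x] x w]
        unfolding step_cost_def eq ustar_eq_stack[OF w x] by simp
    qed
    then show "J = ennreal ?V" using step_cost_ustar[OF x] by simp
  qed
qed

end

section \<open>Measurability of the closed loop\<close>

lemma state_cong:
  "(\<And>t. t < k \<Longrightarrow> S t = S' t) \<Longrightarrow> state N n S B x0 \<psi> k = state N n S' B x0 \<psi> k"
proof (induction k rule: less_induct)
  case (less k)
  show ?case
  proof (cases k)
    case (Suc j)
    have st: "state N n S B x0 \<psi> t = state N n S' B x0 \<psi> t" if "t \<le> j" for t
      using less.IH[of t] less.prems that Suc by simp
    then have "restrict (\<lambda>t. state N n S B x0 \<psi> t) {..j} = restrict (\<lambda>t. state N n S' B x0 \<psi> t) {..j}"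
      by (auto simp: restrict_def)
    then show ?thesis using st[of j] less.prems[of j] Suc by simp
  qed simp
qed

lemma measurable_control:
  assumes \<psi>: "\<psi> \<in> limited_info_laws N n m T" and k: "k < T" and i: "i < N"
    and S: "S \<in> \<Omega> \<rightarrow>\<^sub>M mat_borel (offset n N) (offset n N)"
    and X: "X \<in> \<Omega> \<rightarrow>\<^sub>M (\<Pi>\<^sub>M t\<in>{..k}. vec_borel (offset n N))"
  shows "(\<lambda>w. \<psi> k i (block_row n i (S w)) (X w)) \<in> \<Omega> \<rightarrow>\<^sub>M vec_borel (m i)"
proof -
  have "(\<lambda>(S, xs). \<psi> k i S xs) \<in> mat_borel (n i) (offset n N) \<Otimes>\<^sub>M (\<Pi>\<^sub>M t\<in>{..k}. vec_borel (offset n N)) \<rightarrow>\<^sub>M vec_borel (m i)"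
    using \<psi> k i by (auto simp: limited_info_laws_def)
  from measurable_compose[OF measurable_Pair[OF measurable_block_row[OF S i] X] this]
  show ?thesis by simp
qed

lemma state_measurable:
  assumes \<psi>: "\<psi> \<in> limited_info_laws N n m T" and k: "k \<le> T"
    and x0: "x0 \<in> carrier_vec (offset n N)"
    and B: "\<And>k. B k \<in> carrier_mat (offset n N) (offset m N)"
    and S: "\<And>t. t < k \<Longrightarrow> S t \<in> \<Omega> \<rightarrow>\<^sub>M mat_borel (offset n N) (offset n N)"
  shows "(\<lambda>w. state N n (\<lambda>t. S t w) B x0 \<psi> k) \<in> \<Omega> \<rightarrow>\<^sub>M vec_borel (offset n N)"
  using k S
proof (induction k rule: less_induct)
  case (less k)
  show ?case
  proof (cases k)
    case 0
    then show ?thesis using x0 by (simp add: measurable_vec_const)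
  next
    case (Suc j)
    have st: "(\<lambda>w. state N n (\<lambda>t. S t w) B x0 \<psi> t) \<in> \<Omega> \<rightarrow>\<^sub>M vec_borel (offset n N)" if "t \<le> j" for t
      using less.IH[of t] less.prems that Suc by simp
    have X: "(\<lambda>w. restrict (\<lambda>t. state N n (\<lambda>t. S t w) B x0 \<psi> t) {..j}) \<in> \<Omega> \<rightarrow>\<^sub>M (\<Pi>\<^sub>M t\<in>{..j}. vec_borel (offset n N))"
      using st by (intro measurable_restrict) auto
    have Sj: "S j \<in> \<Omega> \<rightarrow>\<^sub>M mat_borel (offset n N) (offset n N)" using less.prems Suc by simp
    have "(\<lambda>w. S j w *\<^sub>v state N n (\<lambda>t. S t w) B x0 \<psi> j +
        B j *\<^sub>v stack_vec N (\<lambda>i. \<psi> j i (block_row n i (S j w)) (restrict (\<lambda>t. state N n (\<lambda>t. S t w) B x0 \<psi> t) {..j})))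
      \<in> \<Omega> \<rightarrow>\<^sub>M vec_borel (offset n N)"
      using less.prems Suc
      by (intro measurable_vec_add measurable_mult_mat_vec[OF Sj st] measurable_const_mult_vec[OF B]
          measurable_stack_vec measurable_control[OF \<psi> _ _ Sj X]) auto
    then show ?thesis unfolding Suc by simp
  qed
qed

lemmas ennreal_measurable = measurable_compose[OF _ measurable_ennreal]

section \<open>Independence of the past\<close>

text \<open>Of two independent variables, one may be frozen while the other is integrated.\<close>

lemma (in prob_space) nn_integral_indep_var:
  assumes ind: "indep_var S X T Y" and F: "F \<in> borel_measurable (S \<Otimes>\<^sub>M T)"
  shows "(\<integral>\<^sup>+w. F (X w, Y w) \<partial>M) = (\<integral>\<^sup>+w. (\<integral>\<^sup>+w'. F (X w, Y w') \<partial>M) \<partial>M)"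
    and "(\<lambda>w. \<integral>\<^sup>+w'. F (X w, Y w') \<partial>M) \<in> borel_measurable M"
proof -
  have X: "X \<in> M \<rightarrow>\<^sub>M S" and Y: "Y \<in> M \<rightarrow>\<^sub>M T"
    and eq: "distr M S X \<Otimes>\<^sub>M distr M T Y = distr M (S \<Otimes>\<^sub>M T) (\<lambda>w. (X w, Y w))"
    using ind unfolding indep_var_distribution_eq by auto
  interpret Y: prob_space "distr M T Y" by (rule prob_space_distr[OF Y])
  have F': "F \<in> borel_measurable (distr M S X \<Otimes>\<^sub>M distr M T Y)"
    using F by (simp cong: measurable_cong_sets sets_pair_measure_cong)
  have F'': "F \<in> borel_measurable (S \<Otimes>\<^sub>M distr M T Y)"
    using F by (simp cong: measurable_cong_sets sets_pair_measure_cong)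
  have inner: "(\<integral>\<^sup>+y. F (x, y) \<partial>distr M T Y) = (\<integral>\<^sup>+w'. F (x, Y w') \<partial>M)" if "x \<in> space S" for x
    using Y measurable_compose[OF measurable_Pair1'[OF that] F] by (intro nn_integral_distr) auto
  have meas: "(\<lambda>x. \<integral>\<^sup>+y. F (x, y) \<partial>distr M T Y) \<in> borel_measurable S"
    by (rule Y.borel_measurable_nn_integral_fst[OF F''])
  have XS: "w \<in> space M \<Longrightarrow> X w \<in> space S" for w using measurable_space[OF X] .
  have "(\<integral>\<^sup>+w. F (X w, Y w) \<partial>M) = (\<integral>\<^sup>+p. F p \<partial>distr M (S \<Otimes>\<^sub>M T) (\<lambda>w. (X w, Y w)))"
    using X Y F by (intro nn_integral_distr[symmetric]) auto
  also have "\<dots> = (\<integral>\<^sup>+x. (\<integral>\<^sup>+y. F (x, y) \<partial>distr M T Y) \<partial>distr M S X)"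
    unfolding eq[symmetric] by (rule Y.nn_integral_fst[OF F', symmetric])
  also have "\<dots> = (\<integral>\<^sup>+w. (\<integral>\<^sup>+y. F (X w, y) \<partial>distr M T Y) \<partial>M)"
    using X meas by (intro nn_integral_distr) auto
  also have "\<dots> = (\<integral>\<^sup>+w. (\<integral>\<^sup>+w'. F (X w, Y w') \<partial>M) \<partial>M)"
    by (intro nn_integral_cong inner XS)
  finally show "(\<integral>\<^sup>+w. F (X w, Y w) \<partial>M) = (\<integral>\<^sup>+w. (\<integral>\<^sup>+w'. F (X w, Y w') \<partial>M) \<partial>M)" .
  have "(\<lambda>w. \<integral>\<^sup>+y. F (X w, y) \<partial>distr M T Y) \<in> borel_measurable M"
    using measurable_compose[OF X meas] .
  then show "(\<lambda>w. \<integral>\<^sup>+w'. F (X w, Y w') \<partial>M) \<in> borel_measurable M"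
    by (rule measurable_cong[THEN iffD1, rotated]) (rule inner[OF XS])
qed

lemma nn_integral_eq_imp_AE_eq:
  assumes [measurable]: "f \<in> borel_measurable M" "g \<in> borel_measurable M"
    and le: "AE w in M. f w \<le> g w" and fin: "(\<integral>\<^sup>+w. f w \<partial>M) < \<infinity>"
    and eq: "(\<integral>\<^sup>+w. g w \<partial>M) = (\<integral>\<^sup>+w. f w \<partial>M)"
  shows "AE w in M. g w = f w"
proof -
  have "(\<integral>\<^sup>+w. g w - f w \<partial>M) = (\<integral>\<^sup>+w. g w \<partial>M) - (\<integral>\<^sup>+w. f w \<partial>M)"
    using fin le by (intro nn_integral_diff) auto
  also have "\<dots> = 0" unfolding eq using fin by (intro ennreal_diff_self) auto
  finally have "AE w in M. g w - f w = 0" by (subst (asm) nn_integral_0_iff_AE) auto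
  then show ?thesis using le
  proof eventually_elim
    case (elim w)
    then have "g w \<le> f w" by (simp add: diff_eq_0_iff_ennreal)
    then show ?case using elim by simp
  qed
qed

text \<open>
  The control problem on the whole horizon. The sequence \<open>P\<close> satisfies the backward recursion on
  \<open>{..T}\<close>; its positive semidefiniteness, which makes each time an instance of the one-step problem,
  is derived in \<open>P_psd\<close>.
\<close>

locale lq_system = prob_space M
  for M :: "'w measure" +
  fixes N T :: nat and n m :: "nat \<Rightarrow> nat" and A :: "nat \<Rightarrow> 'w \<Rightarrow> real mat"
    and B :: "nat \<Rightarrow> real mat" and Rd :: "nat \<Rightarrow> nat \<Rightarrow> real mat" and Q P :: "nat \<Rightarrow> real mat"
    and x0 :: "real vec" and d q :: nat
  defines "d \<equiv> offset n N" and "q \<equiv> offset m N"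
  assumes x0: "x0 \<in> carrier_vec d"
    and B_carrier: "\<And>k. B k \<in> carrier_mat d q"
    and A_meas: "\<And>k. A k \<in> M \<rightarrow>\<^sub>M mat_borel d d"
    and A_int: "\<And>k a b. a < d \<Longrightarrow> b < d \<Longrightarrow> integrable M (\<lambda>w. A k w $$ (a, b))"
    and A_sq: "\<And>k a b. a < d \<Longrightarrow> b < d \<Longrightarrow> integrable M (\<lambda>w. (A k w $$ (a, b))\<^sup>2)"
    and A_indep: "indep_vars (\<lambda>(k, i). mat_borel (n i) d)
           (\<lambda>(k, i) w. block_row n i (A k w)) (UNIV \<times> {..<N})"
    and Q_psd: "\<And>k. k \<le> T \<Longrightarrow> psd_mat d (Q k)"
    and Rd_carrier: "\<And>k i. k < T \<Longrightarrow> i < N \<Longrightarrow> Rd k i \<in> carrier_mat (m i) (m i)"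
    and R_pd: "\<And>k. k < T \<Longrightarrow> pd_mat q (diag_blocks N (Rd k))"
    and P_T: "P T = Q T"
    and P_rec: "\<And>k. k < T \<Longrightarrow> P k = Q k +
           riccati (expect_mat M d d (A k)) (P (Suc k)) (B k) (diag_blocks N (Rd k)) +
           mat_sum d d (\<lambda>i. expect_mat M d d
             (\<lambda>w. riccati (centred_row M N n i (A k) w) (P (Suc k)) (block_col m i (B k)) (Rd k i))) {..<N}"
begin

text \<open>
  \<open>ctg k\<close>, \<open>us k\<close> and \<open>uf k\<close> are the value matrix, the optimal input and its blocks in the one-step
  problem at time \<open>k\<close>. For a law \<open>\<psi>\<close>, \<open>st \<psi> k\<close>, \<open>traj \<psi> k\<close> and \<open>inp \<psi> k\<close> are the closed-loop state, the
  trajectory up to time \<open>k\<close> and the input blocks; \<open>xform\<close> and \<open>uform\<close> are the quadratic forms in the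
  state and in the input that enter the cost.
\<close>

abbreviation "ctg k \<equiv> one_step.cost_to_go M N n m (A k) (B k) (P (Suc k)) (Rd k)"
abbreviation "us k \<equiv> one_step.ustar M N n m (A k) (B k) (P (Suc k)) (Rd k)"
abbreviation "uf k \<equiv> one_step.ufun M N n m (A k) (B k) (P (Suc k)) (Rd k)"
abbreviation "laws \<equiv> limited_info_laws N n m T"
abbreviation "st \<psi> k w \<equiv> state N n (\<lambda>t. A t w) B x0 \<psi> k"
abbreviation "traj \<psi> k w \<equiv> restrict (\<lambda>t. st \<psi> t w) {..k}"
abbreviation "traj_space (k::nat) \<equiv> (\<Pi>\<^sub>M t\<in>{..k}. vec_borel d)"
abbreviation "inp \<psi> k i w \<equiv> input N n (\<lambda>t. A t w) B x0 \<psi> k i"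
abbreviation "xform S \<psi> k w \<equiv> st \<psi> k w \<bullet> (S *\<^sub>v st \<psi> k w)"
abbreviation "uform \<psi> k w \<equiv> \<Sum>j<N. inp \<psi> k j w \<bullet> (Rd k j *\<^sub>v inp \<psi> k j w)"

lemma A_carrier: "w \<in> space M \<Longrightarrow> A k w \<in> carrier_mat d d"
  by (rule measurable_matD[OF A_meas])

lemma A_indep_step: "indep_vars (\<lambda>i. mat_borel (n i) d) (\<lambda>i w. block_row n i (A k w)) {..<N}"
proof -
  let ?M = "\<lambda>(k::nat, i). mat_borel (n i) d" and ?X = "\<lambda>(k, i) w. block_row n i (A k w)"
  have "indep_vars (\<lambda>i. PiM {(k, i)} ?M) (\<lambda>i w. restrict (\<lambda>p. ?X p w) {(k, i)}) {..<N}"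
    by (rule indep_vars_restrict[OF A_indep]) (auto simp: disjoint_family_on_def)
  moreover have "(\<lambda>h. h (k, i)) \<in> PiM {(k, i)} ?M \<rightarrow>\<^sub>M mat_borel (n i) d" for i
    using measurable_component_singleton[of "(k, i)" "{(k, i)}" ?M] by simp
  ultimately have "indep_vars (\<lambda>i. mat_borel (n i) d) (\<lambda>i w. (restrict (\<lambda>p. ?X p w) {(k, i)}) (k, i)) {..<N}"
    by (rule indep_vars_compose2)
  then show ?thesis by simp
qed

lemma one_step:
  assumes "k < T" "psd_mat d (P (Suc k))"
  shows "one_step M N n m (A k) (B k) (P (Suc k)) (Rd k)"
  by unfold_locales
    (use assms A_meas A_int A_sq A_indep_step B_carrier Rd_carrier R_pd in \<open>auto simp: d_def q_def\<close>)

lemma P_eq: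
  assumes k: "k < T" and s: "one_step M N n m (A k) (B k) (P (Suc k)) (Rd k)"
  shows "P k = Q k + ctg k"
proof -
  interpret s: one_step M N n m "A k" "B k" "P (Suc k)" "Rd k" d q
    using s by (simp_all add: d_def q_def)
  have Q: "Q k \<in> carrier_mat d d" using Q_psd[of k] k by (simp add: psd_mat_def)
  show ?thesis
    unfolding P_rec[OF k] s.cost_to_go_def
    by (rule assoc_add_mat[OF Q riccati_carrier[OF s.hess_pd s.P_carrier s.B_carrier s.Abar_carrier]]) (simp add: mat_sum_def)
qed

lemma P_psd: "k \<le> T \<Longrightarrow> psd_mat d (P k)"
proof (induction rule: inc_induct)
  case base
  show ?case unfolding P_T by (rule Q_psd) simp
next
  case (step k)
  then have k: "k < T" by simp
  interpret s: one_step M N n m "A k" "B k" "P (Suc k)" "Rd k" d q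
    using one_step[OF k step.IH] by (simp_all add: d_def q_def)
  note P_step = P_eq[OF k s.one_step_axioms, folded d_def]
  have Q: "Q k \<in> carrier_mat d d" "transpose_mat (Q k) = Q k" "\<And>v. v \<in> carrier_vec d \<Longrightarrow> 0 \<le> v \<bullet> (Q k *\<^sub>v v)"
    using Q_psd[of k] k by (auto simp: psd_mat_def)
  \<comment> \<open>The form of \<open>ctg k\<close> is nonnegative because it is an expected cost.\<close>
  have "0 \<le> v \<bullet> (P k *\<^sub>v v)" if v: "v \<in> carrier_vec d" for v
  proof -
    have "v \<bullet> (P k *\<^sub>v v) = v \<bullet> (Q k *\<^sub>v v) + v \<bullet> (ctg k *\<^sub>v v)"
      unfolding P_step add_mult_distrib_mat_vec[OF Q(1) s.cost_to_go_carrier v]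
      by (rule scalar_prod_add_distrib[OF v mv_carrier[OF Q(1) v] mv_carrier[OF s.cost_to_go_carrier v]])
    then show ?thesis using Q(3)[OF v] s.cost_to_go_nonneg[OF v] by simp
  qed
  moreover have "transpose_mat (P k) = P k"
    unfolding P_step transpose_add[OF Q(1) s.cost_to_go_carrier] Q(2) s.cost_to_go_sym ..
  ultimately show ?case
    using Q(1) s.cost_to_go_carrier unfolding psd_mat_def by (auto simp: P_step)
qed

lemma step: "k < T \<Longrightarrow> one_step M N n m (A k) (B k) (P (Suc k)) (Rd k)"
  using one_step P_psd by simp

lemma P_step: "k < T \<Longrightarrow> P k = Q k + ctg k"
  using P_eq step by simp

lemma st_measurable: "\<psi> \<in> laws \<Longrightarrow> k \<le> T \<Longrightarrow> st \<psi> k \<in> M \<rightarrow>\<^sub>M vec_borel d"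
  using x0 B_carrier A_meas unfolding d_def q_def by (intro state_measurable)

lemma traj_measurable: "\<psi> \<in> laws \<Longrightarrow> k \<le> T \<Longrightarrow> traj \<psi> k \<in> M \<rightarrow>\<^sub>M traj_space k"
  using st_measurable by (intro measurable_restrict) auto

lemma st_carrier: "\<psi> \<in> laws \<Longrightarrow> k \<le> T \<Longrightarrow> w \<in> space M \<Longrightarrow> st \<psi> k w \<in> carrier_vec d"
  by (rule measurable_vecD[OF st_measurable])

lemma inp_measurable: "\<psi> \<in> laws \<Longrightarrow> k < T \<Longrightarrow> i < N \<Longrightarrow> inp \<psi> k i \<in> M \<rightarrow>\<^sub>M vec_borel (m i)"
  using measurable_control[of \<psi> N n m T k i "A k" M "traj \<psi> k"] A_meas traj_measurable[of \<psi> k]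
  by (simp add: input_def d_def)

text \<open>As \<open>A k\<close> is independent of the trajectory up to time \<open>k\<close>, the latter may be frozen.\<close>

lemma past_integral:
  assumes \<psi>: "\<psi> \<in> laws" and k: "k < T"
    and F: "F \<in> borel_measurable (traj_space k \<Otimes>\<^sub>M mat_borel d d)"
  shows "(\<integral>\<^sup>+w. F (traj \<psi> k w, A k w) \<partial>M) = (\<integral>\<^sup>+w. (\<integral>\<^sup>+w'. F (traj \<psi> k w, A k w') \<partial>M) \<partial>M)" (is ?eq)
    and "(\<lambda>w. \<integral>\<^sup>+w'. F (traj \<psi> k w, A k w') \<partial>M) \<in> borel_measurable M" (is ?meas)
proof -
  let ?M = "\<lambda>(k::nat, i). mat_borel (n i) d" and ?X = "\<lambda>(k, i) w. block_row n i (A k w)"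
  let ?I = "{..<k} \<times> {..<N}" and ?J = "{k} \<times> {..<N}"
  \<comment> \<open>Trajectory and matrix are rebuilt from the block rows before time \<open>k\<close> and at time \<open>k\<close>, to which
    the independence assumption applies.\<close>
  define asm where "asm h s = stack_mat d N (\<lambda>i. h (s, i))" for h :: "nat \<times> nat \<Rightarrow> real mat" and s
  define Y1 where "Y1 h = restrict (\<lambda>t. state N n (\<lambda>s. asm h s) B x0 \<psi> t) {..k}" for h
  have asm: "(\<lambda>h. asm h s) \<in> PiM K ?M \<rightarrow>\<^sub>M mat_borel d d" if "{s} \<times> {..<N} \<subseteq> K" for s K
    unfolding asm_def d_def
  proof (rule measurable_stack_mat)
    fix i assume "i < N"
    then have "(s, i) \<in> K" using that by auto
    from measurable_component_singleton[OF this, of ?M]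
    show "(\<lambda>h. h (s, i)) \<in> PiM K (\<lambda>(k, i). mat_borel (n i) (offset n N)) \<rightarrow>\<^sub>M mat_borel (n i) (offset n N)"
      by (simp add: d_def)
  qed
  have Y1: "Y1 \<in> PiM ?I ?M \<rightarrow>\<^sub>M traj_space k"
    unfolding Y1_def
  proof (rule measurable_restrict)
    fix t assume "t \<in> {..k}"
    then have t: "t \<le> k" by simp
    show "(\<lambda>h. state N n (\<lambda>s. asm h s) B x0 \<psi> t) \<in> PiM ?I ?M \<rightarrow>\<^sub>M vec_borel d"
      unfolding d_def
    proof (rule state_measurable[OF \<psi>])
      fix s assume "s < t"
      then have "{s} \<times> {..<N} \<subseteq> ?I" using t by auto
      from asm[OF this] show "(\<lambda>h. asm h s) \<in> PiM ?I (\<lambda>(k, i). mat_borel (n i) (offset n N)) \<rightarrow>\<^sub>M mat_borel (offset n N) (offset n N)"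
        by (simp add: d_def)
    qed (use k t x0 B_carrier in \<open>auto simp: d_def q_def\<close>)
  qed
  have Y2: "(\<lambda>h. asm h k) \<in> PiM ?J ?M \<rightarrow>\<^sub>M mat_borel d d" by (rule asm) simp
  have "indep_var (PiM ?I ?M) (\<lambda>w. restrict (\<lambda>p. ?X p w) ?I) (PiM ?J ?M) (\<lambda>w. restrict (\<lambda>p. ?X p w) ?J)"
    by (rule indep_var_restrict[OF A_indep]) auto
  moreover have "(\<lambda>p. F (Y1 (fst p), asm (snd p) k)) \<in> borel_measurable (PiM ?I ?M \<Otimes>\<^sub>M PiM ?J ?M)"
    by (rule measurable_compose[OF measurable_Pair[OF measurable_compose[OF measurable_fst Y1] measurable_compose[OF measurable_snd Y2]] F])
  ultimately
  have 1: "(\<integral>\<^sup>+w. F (Y1 (restrict (\<lambda>p. ?X p w) ?I), asm (restrict (\<lambda>p. ?X p w) ?J) k) \<partial>M) =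
      (\<integral>\<^sup>+w. \<integral>\<^sup>+w'. F (Y1 (restrict (\<lambda>p. ?X p w) ?I), asm (restrict (\<lambda>p. ?X p w') ?J) k) \<partial>M \<partial>M)"
    and 2: "(\<lambda>w. \<integral>\<^sup>+w'. F (Y1 (restrict (\<lambda>p. ?X p w) ?I), asm (restrict (\<lambda>p. ?X p w') ?J) k) \<partial>M) \<in> borel_measurable M"
    using nn_integral_indep_var[of "PiM ?I ?M" _ "PiM ?J ?M" _ "\<lambda>p. F (Y1 (fst p), asm (snd p) k)"] by (simp_all only: fst_conv snd_conv)
  have asm_eq: "asm (restrict (\<lambda>p. ?X p w) K) s = A s w" if "w \<in> space M" "{s} \<times> {..<N} \<subseteq> K" for w s K
  proof -
    have "asm (restrict (\<lambda>p. ?X p w) K) s = stack_mat d N (\<lambda>i. block_row n i (A s w))"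
    proof -
      have "map (\<lambda>i. restrict (\<lambda>p. ?X p w) K (s, i)) [0..<N] = map (\<lambda>i. block_row n i (A s w)) [0..<N]"
        using that(2) by (intro map_cong) auto
      then show ?thesis unfolding asm_def stack_mat_def by (simp only:)
    qed
    also have "\<dots> = A s w" using A_carrier[OF that(1)] unfolding d_def by (rule stack_mat_block_row)
    finally show ?thesis .
  qed
  have Y1_eq: "Y1 (restrict (\<lambda>p. ?X p w) ?I) = traj \<psi> k w" if w: "w \<in> space M" for w
  proof -
    have "state N n (\<lambda>s. asm (restrict (\<lambda>p. ?X p w) ?I) s) B x0 \<psi> t = st \<psi> t w" if "t \<le> k" for t
      using that by (intro state_cong asm_eq w) auto
    then show ?thesis unfolding Y1_def by (auto simp: restrict_def)
  qed
  have Y2_eq: "asm (restrict (\<lambda>p. ?X p w) ?J) k = A k w" if "w \<in> space M" for w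
    by (rule asm_eq[OF that]) simp
  show ?eq using 1 by (simp add: Y1_eq Y2_eq cong: nn_integral_cong)
  show ?meas using 2 by (simp add: Y1_eq Y2_eq cong: nn_integral_cong measurable_cong)
qed

section \<open>Dynamic programming\<close>

text \<open>The optimal law: input block \<open>i\<close> as a function of block row \<open>i\<close> and the current state.\<close>

definition opt :: control_law where
  "opt k i S xs = uf k i (xs k) S"

lemma opt_measurable:
  assumes k: "k < T" and i: "i < N" and S: "S \<in> \<Omega> \<rightarrow>\<^sub>M mat_borel (n i) d" and X: "X \<in> \<Omega> \<rightarrow>\<^sub>M vec_borel d"
  shows "(\<lambda>w. uf k i (X w) (S w)) \<in> \<Omega> \<rightarrow>\<^sub>M vec_borel (m i)"
proof -
  interpret s: one_step M N n m "A k" "B k" "P (Suc k)" "Rd k" d q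
    using step[OF k] by (simp_all add: d_def q_def)
  have E: "(block_embed m N i)\<^sup>T \<in> carrier_mat (m i) q" using s.E_carrier by simp
  have b: "block_row n i (expect_mat M d d (A k)) \<in> carrier_mat (n i) d" using s.Abar_carrier by (rule block_row_carrier)
  have G: "block_embed n N i \<in> carrier_mat d (n i)" by (simp add: d_def)
  show ?thesis
    unfolding s.ufun_def s.ubar_def s.yfun_def
    by (intro measurable_vec_minus measurable_const_mult_vec[OF E] measurable_vec_uminus measurable_const_mult_vec[OF s.K_carrier]
        measurable_const_mult_vec[OF s.Abar_carrier] X measurable_const_mult_vec[OF s.Ki_carrier[OF i]]
        measurable_const_mult_vec[OF G] measurable_mult_mat_vec[OF S X] measurable_const_mult_vec[OF b])
qed

lemma opt_law: "opt \<in> laws"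
  unfolding limited_info_laws_def mem_Collect_eq
proof (intro allI impI)
  fix k i assume k: "k < T" and i: "i < N"
  have "(\<lambda>p. uf k i (snd p k) (fst p)) \<in> mat_borel (n i) d \<Otimes>\<^sub>M (traj_space k) \<rightarrow>\<^sub>M vec_borel (m i)"
    by (intro opt_measurable[OF k i] measurable_fst measurable_compose[OF measurable_snd measurable_component_singleton]) simp
  then show "(\<lambda>(S, xs). opt k i S xs) \<in> mat_borel (n i) (offset n N) \<Otimes>\<^sub>M (\<Pi>\<^sub>M t\<in>{..k}. vec_borel (offset n N)) \<rightarrow>\<^sub>M vec_borel (m i)"
    by (simp add: opt_def d_def case_prod_beta)
qed

lemma opt_input:
  assumes "w \<in> space M" "k < T"
  shows "stack_vec N (\<lambda>i. inp opt k i w) = us k w (st opt k w)"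
proof -
  interpret s: one_step M N n m "A k" "B k" "P (Suc k)" "Rd k" d q
    using step[OF assms(2)] by (simp_all add: d_def q_def)
  show ?thesis
    using s.ustar_eq_stack[OF assms(1) st_carrier[OF opt_law _ assms(1), of k]] assms(2)
    by (simp add: input_def opt_def)
qed

text \<open>
  The one-step result integrated over the closed loop of a law \<open>\<psi>\<close>. The converse in the third claim
  needs a finite value, as infinite integrals carry no information on equality almost everywhere.
\<close>

lemma dynamic_programming_step:
  assumes \<psi>: "\<psi> \<in> laws" and k: "k < T"
  defines "V \<equiv> \<integral>\<^sup>+w. ennreal (xform (ctg k) \<psi> k w) \<partial>M"
    and "Z \<equiv> \<integral>\<^sup>+w. ennreal (uform \<psi> k w +
      xform (P (Suc k)) \<psi> (Suc k) w) \<partial>M"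
    and "opt_AE \<equiv> AE w in M. stack_vec N (\<lambda>i. inp \<psi> k i w) = us k w (st \<psi> k w)"
  shows "V \<le> Z" and "opt_AE \<Longrightarrow> Z = V" and "V < \<infinity> \<Longrightarrow> Z = V \<Longrightarrow> opt_AE"
proof -
  interpret s: one_step M N n m "A k" "B k" "P (Suc k)" "Rd k" d q
    using step[OF k] by (simp_all add: d_def q_def)
  let ?S = "(traj_space k) \<Otimes>\<^sub>M mat_borel d d"
  \<comment> \<open>On pairs of a trajectory and a system matrix: the input, its deviation from the optimal one, the
    successor state, the cost \<open>F\<close> and the squared deviation \<open>F2\<close>. The latter encodes almost sure
    optimality as the vanishing of an integral, which can be evaluated by freezing the trajectory.\<close>
  define u where "u = (\<lambda>(p :: (nat \<Rightarrow> real vec) \<times> real mat) i. \<psi> k i (block_row n i (snd p)) (fst p))"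
  define e where "e p = stack_vec N (u p) - stack_vec N (\<lambda>i. uf k i (fst p k) (block_row n i (snd p)))" for p :: "(nat \<Rightarrow> real vec) \<times> real mat"
  define z where "z p = snd p *\<^sub>v fst p k + B k *\<^sub>v stack_vec N (u p)" for p
  define F where "F p = ennreal ((\<Sum>j<N. u p j \<bullet> (Rd k j *\<^sub>v u p j)) + z p \<bullet> (P (Suc k) *\<^sub>v z p))" for p
  define F2 where "F2 p = ennreal (e p \<bullet> e p)" for p
  have um: "(\<lambda>p. u p i) \<in> ?S \<rightarrow>\<^sub>M vec_borel (m i)" if "i < N" for i
    unfolding u_def d_def by (rule measurable_control[OF \<psi> k that measurable_snd measurable_fst])
  have xm: "(\<lambda>p. fst p k) \<in> ?S \<rightarrow>\<^sub>M vec_borel d"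
    by (rule measurable_compose[OF measurable_fst measurable_component_singleton]) simp
  have usm: "(\<lambda>p. stack_vec N (u p)) \<in> ?S \<rightarrow>\<^sub>M vec_borel q"
    unfolding q_def using measurable_stack_vec[of N "\<lambda>i p. u p i"] um by simp
  have om: "(\<lambda>p. stack_vec N (\<lambda>i. uf k i (fst p k) (block_row n i (snd p)))) \<in> ?S \<rightarrow>\<^sub>M vec_borel q"
    unfolding q_def
    by (intro measurable_stack_vec opt_measurable[OF k] xm measurable_block_row[of _ _ n N])
      (auto simp: d_def)
  have em: "e \<in> ?S \<rightarrow>\<^sub>M vec_borel q" unfolding e_def by (rule measurable_vec_minus[OF usm om])
  have zm: "z \<in> ?S \<rightarrow>\<^sub>M vec_borel d"
    unfolding z_def by (intro measurable_vec_add measurable_mult_mat_vec[OF measurable_snd xm] measurable_const_mult_vec[OF B_carrier usm])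
  have F: "F \<in> borel_measurable ?S"
    unfolding F_def
    by (intro ennreal_measurable borel_measurable_add borel_measurable_sum
        measurable_scalar_prod[OF um measurable_const_mult_vec[OF Rd_carrier[OF k] um]]
        measurable_scalar_prod[OF zm measurable_const_mult_vec[OF s.P_carrier zm]]) auto
  have F2: "F2 \<in> borel_measurable ?S"
    unfolding F2_def by (intro ennreal_measurable measurable_scalar_prod[OF em em])
  have kT: "k \<le> T" using k by simp
  note stc = st_carrier[OF \<psi> kT]
  have tr: "traj \<psi> k w \<in> space (traj_space k)" if "w \<in> space M" for w
    using measurable_space[OF traj_measurable[OF \<psi> kT] that] .
  have pS: "(traj \<psi> k w, A k w') \<in> space ?S" if "w \<in> space M" "w' \<in> space M" for w w'
    using tr[OF that(1)] A_carrier[OF that(2)] by (simp add: space_pair_measure)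
  have e0: "F2 (traj \<psi> k w, A k w') = 0 \<longleftrightarrow> stack_vec N (u (traj \<psi> k w, A k w')) = us k w' (st \<psi> k w)"
    if w: "w \<in> space M" "w' \<in> space M" for w w'
  proof -
    let ?p = "(traj \<psi> k w, A k w')"
    have c: "stack_vec N (u ?p) \<in> carrier_vec q" using measurable_vecD[OF usm pS[OF w]] .
    have o: "us k w' (st \<psi> k w) \<in> carrier_vec q" by (rule s.ustar_carrier[OF w(2) stc[OF w(1)]])
    have e: "e ?p = stack_vec N (u ?p) - us k w' (st \<psi> k w)"
      unfolding e_def s.ustar_eq_stack[OF w(2) stc[OF w(1)]] by simp
    have "F2 ?p = 0 \<longleftrightarrow> e ?p \<bullet> e ?p \<le> 0" by (simp add: F2_def ennreal_eq_0_iff)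
    also have "\<dots> \<longleftrightarrow> e ?p \<bullet> e ?p = 0" using real_scalar_prod_nonneg[of "e ?p"] by linarith
    also have "\<dots> \<longleftrightarrow> e ?p = 0\<^sub>v q"
      using real_scalar_prod_eq_0[OF measurable_vecD[OF em pS[OF w]]] by auto
    also have "\<dots> \<longleftrightarrow> stack_vec N (u ?p) = us k w' (st \<psi> k w)"
    proof
      assume "e ?p = 0\<^sub>v q"
      then have "(stack_vec N (u ?p) - us k w' (st \<psi> k w)) $ a = 0" if "a < q" for a using that by (simp add: e)
      then show "stack_vec N (u ?p) = us k w' (st \<psi> k w)" using c o by (intro eq_vecI) auto
    next
      assume "stack_vec N (u ?p) = us k w' (st \<psi> k w)"
      then show "e ?p = 0\<^sub>v q" unfolding e using o by simp
    qed
    finally show ?thesis .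
  qed
  define G where "G w = (\<integral>\<^sup>+w'. F (traj \<psi> k w, A k w') \<partial>M)" for w
  define H where "H w = (\<integral>\<^sup>+w'. F2 (traj \<psi> k w, A k w') \<partial>M)" for w
  let ?v = "\<lambda>w. ennreal (xform (ctg k) \<psi> k w)"
  have vm: "?v \<in> borel_measurable M"
    by (intro ennreal_measurable measurable_scalar_prod[of _ _ d] st_measurable[OF \<psi> kT]
        measurable_const_mult_vec[OF s.cost_to_go_carrier])
  have Gm: "G \<in> borel_measurable M" unfolding G_def by (rule past_integral(2)[OF \<psi> k F])
  have Hm: "H \<in> borel_measurable M" unfolding H_def by (rule past_integral(2)[OF \<psi> k F2])
  have Z: "Z = (\<integral>\<^sup>+w. G w \<partial>M)"
  proof -
    have "Z = (\<integral>\<^sup>+w. F (traj \<psi> k w, A k w) \<partial>M)"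
      unfolding Z_def F_def z_def u_def by (simp add: input_def)
    then show ?thesis unfolding G_def using past_integral(1)[OF \<psi> k F] by simp
  qed
  have GH: "?v w \<le> G w" "G w = ?v w \<longleftrightarrow> H w = 0" if w: "w \<in> space M" for w
  proof -
    let ?\<phi> = "\<lambda>i S. \<psi> k i S (traj \<psi> k w)"
    have \<phi>: "?\<phi> i \<in> mat_borel (n i) d \<rightarrow>\<^sub>M vec_borel (m i)" if "i < N" for i
    proof -
      have "(\<lambda>(S, xs). \<psi> k i S xs) \<in> mat_borel (n i) d \<Otimes>\<^sub>M (traj_space k) \<rightarrow>\<^sub>M vec_borel (m i)"
        using \<psi> k that by (auto simp: limited_info_laws_def d_def)
      from measurable_compose[OF measurable_Pair2'[OF tr[OF w]] this] show ?thesis by simp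
    qed
    have Geq: "G w = (\<integral>\<^sup>+w'. ennreal (s.step_cost w' (st \<psi> k w) (\<lambda>i. ?\<phi> i (block_row n i (A k w')))) \<partial>M)"
      unfolding G_def F_def z_def u_def s.step_cost_def by simp
    show "?v w \<le> G w" unfolding Geq by (rule s.one_step_optimal(1)[OF \<phi> stc[OF w]])
    have "G w = ?v w \<longleftrightarrow> (AE w' in M. stack_vec N (\<lambda>i. ?\<phi> i (block_row n i (A k w'))) = us k w' (st \<psi> k w))"
      unfolding Geq by (rule s.one_step_optimal(2)[OF \<phi> stc[OF w]])
    also have "\<dots> \<longleftrightarrow> (AE w' in M. F2 (traj \<psi> k w, A k w') = 0)"
      using e0[OF w] by (intro AE_cong) (simp add: u_def)
    also have "\<dots> \<longleftrightarrow> H w = 0"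
      unfolding H_def
      using measurable_compose[OF A_meas[of k] measurable_compose[OF measurable_Pair1'[OF tr[OF w]] F2]]
      by (intro nn_integral_0_iff_AE[symmetric]) simp
    finally show "G w = ?v w \<longleftrightarrow> H w = 0" .
  qed
  have opt_H: "opt_AE \<longleftrightarrow> (AE w in M. H w = 0)"
  proof -
    have "opt_AE \<longleftrightarrow> (AE w in M. F2 (traj \<psi> k w, A k w) = 0)"
      unfolding opt_AE_def using e0 by (intro AE_cong) (simp add: u_def input_def)
    also have "\<dots> \<longleftrightarrow> (\<integral>\<^sup>+w. F2 (traj \<psi> k w, A k w) \<partial>M) = 0"
      using measurable_compose[OF measurable_Pair[OF traj_measurable[OF \<psi> kT] A_meas[of k]] F2]
      by (intro nn_integral_0_iff_AE[symmetric])
    also have "\<dots> \<longleftrightarrow> (\<integral>\<^sup>+w. H w \<partial>M) = 0" unfolding past_integral(1)[OF \<psi> k F2] H_def ..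
    also have "\<dots> \<longleftrightarrow> (AE w in M. H w = 0)" by (rule nn_integral_0_iff_AE[OF Hm])
    finally show ?thesis .
  qed
  show "V \<le> Z" unfolding V_def Z by (intro nn_integral_mono GH(1))
  show "Z = V" if opt_AE
  proof -
    have "AE w in M. G w = ?v w"
      using that[unfolded opt_H] by (rule AE_mp) (intro AE_I2 impI GH(2)[THEN iffD2])
    then show ?thesis unfolding Z V_def by (rule nn_integral_cong_AE)
  qed
  show opt_AE if "V < \<infinity>" "Z = V"
  proof -
    have "AE w in M. G w = ?v w"
      using that GH(1) unfolding Z V_def by (intro nn_integral_eq_imp_AE_eq[OF vm Gm]) auto
    then show ?thesis unfolding opt_H by (rule AE_mp) (intro AE_I2 impI GH(2)[THEN iffD1])
  qed
qed

text \<open>The expected costs at time \<open>k\<close>, the expected value at time \<open>k\<close>, and almost sure optimality at time \<open>k\<close>.\<close>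

abbreviation "state_cost \<psi> k \<equiv> \<integral>\<^sup>+w. ennreal (xform (Q k) \<psi> k w) \<partial>M"
abbreviation "input_cost \<psi> k \<equiv> \<integral>\<^sup>+w. ennreal (uform \<psi> k w) \<partial>M"
abbreviation "value_at \<psi> k \<equiv> \<integral>\<^sup>+w. ennreal (xform (P k) \<psi> k w) \<partial>M"
abbreviation "opt_AE \<psi> k \<equiv> AE w in M. stack_vec N (\<lambda>i. inp \<psi> k i w) = us k w (st \<psi> k w)"
abbreviation "total_cost \<psi> \<equiv> cost M N n T A B Q Rd x0 \<psi>"
abbreviation "opt_value \<equiv> x0 \<bullet> (P 0 *\<^sub>v x0)"

text \<open>The cost accumulated before time \<open>k\<close> plus the optimal cost from time \<open>k\<close> on.\<close>

definition bellman :: "control_law \<Rightarrow> nat \<Rightarrow> ennreal" where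
  "bellman \<psi> k = (\<Sum>t<k. state_cost \<psi> t + input_cost \<psi> t) + value_at \<psi> k"

lemma psd_form_nonneg: "psd_mat d S \<Longrightarrow> v \<in> carrier_vec d \<Longrightarrow> 0 \<le> v \<bullet> (S *\<^sub>v v)"
  by (simp add: psd_mat_def)

lemma psd_form_measurable:
  "psd_mat d S \<Longrightarrow> \<psi> \<in> laws \<Longrightarrow> k \<le> T \<Longrightarrow> xform S \<psi> k \<in> borel_measurable M"
  by (intro measurable_scalar_prod[of _ _ d] st_measurable measurable_const_mult_vec[of S d d])
    (auto simp: psd_mat_def)

lemma input_form_measurable:
  "\<psi> \<in> laws \<Longrightarrow> k < T \<Longrightarrow> uform \<psi> k \<in> borel_measurable M"
  by (intro borel_measurable_sum measurable_scalar_prod[OF inp_measurable measurable_const_mult_vec[OF Rd_carrier inp_measurable]]) auto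

lemma input_form_nonneg:
  assumes "\<psi> \<in> laws" "k < T" "w \<in> space M"
  shows "0 \<le> uform \<psi> k w"
proof -
  interpret s: one_step M N n m "A k" "B k" "P (Suc k)" "Rd k" d q
    using step[OF assms(2)] by (simp_all add: d_def q_def)
  have c: "inp \<psi> k i w \<in> carrier_vec (m i)" if "i < N" for i
    using measurable_vecD[OF inp_measurable[OF assms(1,2) that] assms(3)] .
  have "stack_vec N (\<lambda>i. inp \<psi> k i w) \<in> carrier_vec q"
    unfolding q_def using c by (rule stack_vec_carrier)
  from s.R_nonneg[OF this] show ?thesis using s.input_cost[of "\<lambda>i. inp \<psi> k i w"] c by simp
qed

lemma bellman_0: "bellman \<psi> 0 = ennreal opt_value"
  by (simp add: bellman_def emeasure_space_1)

lemma bellman_T: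
  assumes \<psi>: "\<psi> \<in> laws"
  shows "total_cost \<psi> = enn2ereal (bellman \<psi> T)"
proof -
  define q where "q k w = xform (Q k) \<psi> k w" for k w
  define r where "r k w = uform \<psi> k w" for k w
  have q: "q k \<in> borel_measurable M" "w \<in> space M \<Longrightarrow> 0 \<le> q k w" if "k \<le> T" for k w
    unfolding q_def using psd_form_measurable[OF Q_psd \<psi>] psd_form_nonneg[OF Q_psd st_carrier[OF \<psi>]] that by auto
  have r: "r k \<in> borel_measurable M" "w \<in> space M \<Longrightarrow> 0 \<le> r k w" if "k < T" for k w
    unfolding r_def using input_form_measurable[OF \<psi> that] input_form_nonneg[OF \<psi> that] by auto
  have "(\<integral>\<^sup>+w. ennreal (q T w + (\<Sum>k<T. q k w + r k w)) \<partial>M)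
      = (\<integral>\<^sup>+w. ennreal (q T w) + (\<Sum>k<T. ennreal (q k w) + ennreal (r k w)) \<partial>M)"
  proof (rule nn_integral_cong)
    fix w assume w: "w \<in> space M"
    have nn: "0 \<le> q k w + r k w" if "k < T" for k
      using q(2)[OF _ w, of k] r(2)[OF that w] that by simp
    have "ennreal (q T w + (\<Sum>k<T. q k w + r k w)) = ennreal (q T w) + ennreal (\<Sum>k<T. q k w + r k w)"
      using q(2)[OF _ w, of T] sum_nonneg[of "{..<T}" "\<lambda>k. q k w + r k w"] nn by (intro ennreal_plus) auto
    also have "ennreal (\<Sum>k<T. q k w + r k w) = (\<Sum>k<T. ennreal (q k w + r k w))"
      by (intro sum_ennreal[symmetric] nn) auto
    also have "\<dots> = (\<Sum>k<T. ennreal (q k w) + ennreal (r k w))"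
      by (intro sum.cong refl ennreal_plus q(2)[OF _ w] r(2)[OF _ w]) auto
    finally show "ennreal (q T w + (\<Sum>k<T. q k w + r k w)) = ennreal (q T w) + (\<Sum>k<T. ennreal (q k w) + ennreal (r k w))" .
  qed
  also have "\<dots> = (\<integral>\<^sup>+w. ennreal (q T w) \<partial>M) + (\<integral>\<^sup>+w. (\<Sum>k<T. ennreal (q k w) + ennreal (r k w)) \<partial>M)"
    using q(1) r(1) by (intro nn_integral_add borel_measurable_sum borel_measurable_add ennreal_measurable) auto
  also have "(\<integral>\<^sup>+w. (\<Sum>k<T. ennreal (q k w) + ennreal (r k w)) \<partial>M) = (\<Sum>k<T. \<integral>\<^sup>+w. ennreal (q k w) + ennreal (r k w) \<partial>M)"
    using q(1) r(1) by (intro nn_integral_sum borel_measurable_add ennreal_measurable) auto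
  also have "\<dots> = (\<Sum>k<T. (\<integral>\<^sup>+w. ennreal (q k w) \<partial>M) + (\<integral>\<^sup>+w. ennreal (r k w) \<partial>M))"
    using q(1) r(1) by (intro sum.cong refl nn_integral_add ennreal_measurable) auto
  finally show ?thesis
    unfolding cost_def Let_def bellman_def P_T q_def r_def by (simp add: add.commute)
qed

lemma bellman_step:
  assumes \<psi>: "\<psi> \<in> laws" and k: "k < T"
  shows "bellman \<psi> k \<le> bellman \<psi> (Suc k)"
    and "opt_AE \<psi> k \<Longrightarrow> bellman \<psi> (Suc k) = bellman \<psi> k"
    and "bellman \<psi> k < \<infinity> \<Longrightarrow> bellman \<psi> (Suc k) = bellman \<psi> k \<Longrightarrow> opt_AE \<psi> k"
proof -
  interpret s: one_step M N n m "A k" "B k" "P (Suc k)" "Rd k" d q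
    using step[OF k] by (simp_all add: d_def q_def)
  note kT = less_imp_le[OF k]
  define c where "c = (\<integral>\<^sup>+w. ennreal (xform (ctg k) \<psi> k w) \<partial>M)"
  define S where "S = (\<Sum>t<k. state_cost \<psi> t + input_cost \<psi> t) + state_cost \<psi> k"
  have Q: "Q k \<in> carrier_mat d d" using Q_psd[OF kT] by (simp add: psd_mat_def)
  have ctg_psd: "psd_mat d (ctg k)"
    using s.cost_to_go_carrier s.cost_to_go_sym s.cost_to_go_nonneg by (simp add: psd_mat_def)
  have "value_at \<psi> k = (\<integral>\<^sup>+w. ennreal (xform (Q k) \<psi> k w) + ennreal (xform (ctg k) \<psi> k w) \<partial>M)"
  proof (rule nn_integral_cong)
    fix w assume w: "w \<in> space M"
    note x = st_carrier[OF \<psi> kT w]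
    have "xform (P k) \<psi> k w = xform (Q k) \<psi> k w + xform (ctg k) \<psi> k w"
      unfolding P_step[OF k] add_mult_distrib_mat_vec[OF Q s.cost_to_go_carrier x]
      by (rule scalar_prod_add_distrib[OF x mv_carrier[OF Q x] mv_carrier[OF s.cost_to_go_carrier x]])
    then show "ennreal (xform (P k) \<psi> k w)
        = ennreal (xform (Q k) \<psi> k w) + ennreal (xform (ctg k) \<psi> k w)"
      using psd_form_nonneg[OF Q_psd[OF kT] x] s.cost_to_go_nonneg[OF x] by (simp add: ennreal_plus)
  qed
  also have "\<dots> = state_cost \<psi> k + c"
    unfolding c_def
    by (intro nn_integral_add ennreal_measurable psd_form_measurable Q_psd ctg_psd \<psi> kT)
  finally have 1: "bellman \<psi> k = S + c" by (simp add: bellman_def S_def add.assoc)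
  have "(\<integral>\<^sup>+w. ennreal (uform \<psi> k w +
      xform (P (Suc k)) \<psi> (Suc k) w) \<partial>M) =
      (\<integral>\<^sup>+w. ennreal (uform \<psi> k w) +
      ennreal (xform (P (Suc k)) \<psi> (Suc k) w) \<partial>M)"
    using k by (intro nn_integral_cong ennreal_plus input_form_nonneg[OF \<psi> k] psd_form_nonneg P_psd st_carrier[OF \<psi>]) auto
  also have "\<dots> = input_cost \<psi> k + value_at \<psi> (Suc k)"
    using k by (intro nn_integral_add ennreal_measurable psd_form_measurable P_psd input_form_measurable \<psi>) auto
  finally have Z: "(\<integral>\<^sup>+w. ennreal (uform \<psi> k w +
      xform (P (Suc k)) \<psi> (Suc k) w) \<partial>M) = input_cost \<psi> k + value_at \<psi> (Suc k)" .
  have 2: "bellman \<psi> (Suc k) = S + (input_cost \<psi> k + value_at \<psi> (Suc k))"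
    by (simp add: bellman_def S_def add.assoc)
  note dp = dynamic_programming_step[OF \<psi> k, folded c_def, unfolded Z]
  show "bellman \<psi> k \<le> bellman \<psi> (Suc k)" unfolding 1 2 by (rule add_left_mono[OF dp(1)])
  show "opt_AE \<psi> k \<Longrightarrow> bellman \<psi> (Suc k) = bellman \<psi> k" unfolding 1 2 using dp(2) by simp
  assume fin: "bellman \<psi> k < \<infinity>" and eq: "bellman \<psi> (Suc k) = bellman \<psi> k"
  \<comment> \<open>\<open>S\<close> can only be cancelled because it is finite.\<close>
  have "S < \<infinity>" "c < \<infinity>" using fin unfolding 1 by (auto simp: ennreal_add_less_top infinity_ennreal_def)
  moreover have "input_cost \<psi> k + value_at \<psi> (Suc k) = c"
    using eq \<open>S < \<infinity>\<close> unfolding 1 2 by (auto simp: ennreal_add_left_cancel)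
  ultimately show "opt_AE \<psi> k" using dp(3) by simp
qed

lemma bellman_mono:
  assumes \<psi>: "\<psi> \<in> laws" and k: "k \<le> T"
  shows "ennreal opt_value \<le> bellman \<psi> k" and "bellman \<psi> k \<le> bellman \<psi> T"
proof -
  have mono: "bellman \<psi> j \<le> bellman \<psi> l" if "j \<le> l" "l \<le> T" for j l
    using that
  proof (induction l rule: dec_induct)
    case (step l)
    then show ?case using bellman_step(1)[OF \<psi>, of l] by simp
  qed simp
  show "ennreal opt_value \<le> bellman \<psi> k" using mono[of 0 k] k by (simp add: bellman_0)
  show "bellman \<psi> k \<le> bellman \<psi> T" using mono[of k T] k by simp
qed

lemma opt_value_nonneg: "0 \<le> opt_value"
  by (rule psd_form_nonneg[OF P_psd x0]) simp

lemma total_cost_ge: "\<psi> \<in> laws \<Longrightarrow> ereal opt_value \<le> total_cost \<psi>"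
  using bellman_mono(1)[of \<psi> T] opt_value_nonneg
  by (simp add: bellman_T less_eq_ennreal.rep_eq)

lemma total_cost_eq_iff:
  assumes \<psi>: "\<psi> \<in> laws"
  shows "total_cost \<psi> = ereal opt_value \<longleftrightarrow> (\<forall>k<T. opt_AE \<psi> k)"
proof -
  have "total_cost \<psi> = ereal opt_value \<longleftrightarrow> bellman \<psi> T = ennreal opt_value"
    unfolding bellman_T[OF \<psi>] using opt_value_nonneg by (metis enn2ereal_ennreal enn2ereal_inject)
  also have "\<dots> \<longleftrightarrow> (\<forall>k<T. opt_AE \<psi> k)"
  proof (intro iffI allI impI)
    fix k assume eq: "bellman \<psi> T = ennreal opt_value" and k: "k < T"
    have b: "bellman \<psi> j = ennreal opt_value" if "j \<le> T" for j
      using bellman_mono[OF \<psi> that] eq by simp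
    show "opt_AE \<psi> k" using bellman_step(3)[OF \<psi> k] b[of k] b[of "Suc k"] k by simp
  next
    assume a: "\<forall>k<T. opt_AE \<psi> k"
    have "bellman \<psi> k = ennreal opt_value" if "k \<le> T" for k
      using that
    proof (induction k)
      case 0
      show ?case by (rule bellman_0)
    next
      case (Suc k)
      then show ?case using bellman_step(2)[OF \<psi>, of k] a by simp
    qed
    then show "bellman \<psi> T = ennreal opt_value" by simp
  qed
  finally show ?thesis .
qed

lemma total_cost_opt: "total_cost opt = ereal opt_value"
  unfolding total_cost_eq_iff[OF opt_law] using opt_input by (auto intro!: AE_I2)

lemma argmin_iff:
  assumes \<psi>: "\<psi> \<in> laws"
  shows "is_arg_min total_cost (\<lambda>\<phi>. \<phi> \<in> laws) \<psi> \<longleftrightarrow> (\<forall>k<T. opt_AE \<psi> k)"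
proof -
  have "is_arg_min total_cost (\<lambda>\<phi>. \<phi> \<in> laws) \<psi> \<longleftrightarrow> total_cost \<psi> = ereal opt_value"
    using total_cost_ge \<psi> opt_law total_cost_opt unfolding is_arg_min_def
    by (metis antisym_conv2 leD)
  then show ?thesis using total_cost_eq_iff[OF \<psi>] by simp
qed

lemma inf_cost: "(INF \<psi>\<in>laws. total_cost \<psi>) = ereal opt_value"
proof (rule antisym)
  show "(INF \<psi>\<in>laws. total_cost \<psi>) \<le> ereal opt_value"
    unfolding total_cost_opt[symmetric] by (rule INF_lower[OF opt_law])
  show "ereal opt_value \<le> (INF \<psi>\<in>laws. total_cost \<psi>)"
    by (rule INF_greatest[OF total_cost_ge])
qed

end

theorem theorem1:
  fixes M :: "'w measure"
    and N T :: nat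
    and n m :: "nat \<Rightarrow> nat"
    and A :: "nat \<Rightarrow> 'w \<Rightarrow> real mat"
    and Bd Rd :: "nat \<Rightarrow> nat \<Rightarrow> real mat"
    and B R Q P :: "nat \<Rightarrow> real mat"
    and x0 :: "real vec"
    and J :: "control_law \<Rightarrow> ereal"
    and laws :: "control_law set"
    and d :: nat
    and Abar :: "nat \<Rightarrow> real mat"
    and Atil :: "nat \<Rightarrow> nat \<Rightarrow> 'w \<Rightarrow> real mat"
    and ustar :: "nat \<Rightarrow> 'w \<Rightarrow> real vec \<Rightarrow> real vec"
  defines "d \<equiv> offset n N"
    and "B \<equiv> (\<lambda>k. diag_blocks N (Bd k))"
    and "R \<equiv> (\<lambda>k. diag_blocks N (Rd k))"
    and "Abar \<equiv> (\<lambda>k. expect_mat M d d (A k))"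
    and "Atil \<equiv> (\<lambda>k i. centred_row M N n i (A k))"
    and "ustar \<equiv> (\<lambda>k \<omega> x.
           - (gain (P (Suc k)) (B k) (R k) * Abar k *\<^sub>v x)
           - stack_mat d N (\<lambda>i. gain (P (Suc k)) (block_col m i (B k)) (Rd k i) * Atil k i \<omega>) *\<^sub>v x)"
    and "laws \<equiv> limited_info_laws N n m T"
    and "J \<equiv> cost M N n T A B Q Rd x0"
  assumes "prob_space M"
    and "0 < N" and "0 < T"
    and "\<And>i. i < N \<Longrightarrow> 0 < n i" and "\<And>i. i < N \<Longrightarrow> 0 < m i"
    and "x0 \<in> carrier_vec d"
    and "\<And>k i. i < N \<Longrightarrow> Bd k i \<in> carrier_mat (n i) (m i)"
    and "\<And>k. A k \<in> M \<rightarrow>\<^sub>M mat_borel d d"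
    and "\<And>k a b. a < d \<Longrightarrow> b < d \<Longrightarrow> integrable M (\<lambda>\<omega>. A k \<omega> $$ (a, b))"
    and "\<And>k a b. a < d \<Longrightarrow> b < d \<Longrightarrow> integrable M (\<lambda>\<omega>. (A k \<omega> $$ (a, b))\<^sup>2)"
    and "prob_space.indep_vars M (\<lambda>(k, i). mat_borel (n i) d)
           (\<lambda>(k, i) \<omega>. block_row n i (A k \<omega>)) (UNIV \<times> {..<N})"
    and "\<And>k. k \<le> T \<Longrightarrow> psd_mat d (Q k)"
    and "\<And>k i. k < T \<Longrightarrow> i < N \<Longrightarrow> Rd k i \<in> carrier_mat (m i) (m i)"
    and "\<And>k. k < T \<Longrightarrow> pd_mat (offset m N) (R k)"
    and "P T = Q T"
    and "\<And>k. k < T \<Longrightarrow> P k = Q k + riccati (Abar k) (P (Suc k)) (B k) (R k) +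
           mat_sum d d (\<lambda>i. expect_mat M d d
             (\<lambda>\<omega>. riccati (Atil k i \<omega>) (P (Suc k)) (block_col m i (B k)) (Rd k i))) {..<N}"
  shows "(\<exists>\<psi>\<in>laws. \<forall>\<omega>\<in>space M. \<forall>k<T.
            stack_vec N (input N n (\<lambda>t. A t \<omega>) B x0 \<psi> k) =
              ustar k \<omega> (state N n (\<lambda>t. A t \<omega>) B x0 \<psi> k)) \<and>
         (\<forall>\<psi>\<in>laws. is_arg_min J (\<lambda>\<phi>. \<phi> \<in> laws) \<psi> \<longleftrightarrow>
            (AE \<omega> in M. \<forall>k<T.
               stack_vec N (input N n (\<lambda>t. A t \<omega>) B x0 \<psi> k) =
                 ustar k \<omega> (state N n (\<lambda>t. A t \<omega>) B x0 \<psi> k))) \<and>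
         (INF \<psi>\<in>laws. J \<psi>) = ereal (x0 \<bullet> (P 0 *\<^sub>v x0))"
proof -
  have B: "B k \<in> carrier_mat d (offset m N)" for k
    unfolding B_def d_def using assms(15) by (rule diag_blocks_carrier)
  have "lq_system M N T n m A B Rd Q P x0"
  proof (intro lq_system.intro lq_system_axioms.intro)
    show "prob_space M" by fact
  qed (use assms(14,16-) B in \<open>simp_all add: d_def R_def Abar_def Atil_def\<close>)
  then interpret lq_system M N T n m A B Rd Q P x0 d "offset m N"
    by (simp_all add: d_def)
  have us_eq: "us k w x = ustar k w x" if "k < T" for k w x
    using one_step.ustar_def[OF step[OF that]] by (simp add: ustar_def R_def Abar_def Atil_def d_def)
  have AE_eq: "(AE w in M. \<forall>k<T. stack_vec N (input N n (\<lambda>t. A t w) B x0 \<psi> k) =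
      ustar k w (state N n (\<lambda>t. A t w) B x0 \<psi> k)) \<longleftrightarrow> (\<forall>k<T. opt_AE \<psi> k)" for \<psi>
    using AE_ball_countable[of "{..<T}" "\<lambda>w k. stack_vec N (input N n (\<lambda>t. A t w) B x0 \<psi> k) =
      ustar k w (state N n (\<lambda>t. A t w) B x0 \<psi> k)" M] us_eq by (simp add: Ball_def)
  show ?thesis
    unfolding laws_def J_def
  proof (intro conjI ballI)
    show "\<exists>\<psi>\<in>limited_info_laws N n m T. \<forall>w\<in>space M. \<forall>k<T.
        stack_vec N (input N n (\<lambda>t. A t w) B x0 \<psi> k) = ustar k w (state N n (\<lambda>t. A t w) B x0 \<psi> k)"
      using opt_law opt_input us_eq by auto
  next
    fix \<psi> assume "\<psi> \<in> limited_info_laws N n m T"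
    then show "is_arg_min (cost M N n T A B Q Rd x0) (\<lambda>\<phi>. \<phi> \<in> limited_info_laws N n m T) \<psi> \<longleftrightarrow>
      (AE w in M. \<forall>k<T. stack_vec N (input N n (\<lambda>t. A t w) B x0 \<psi> k) =
        ustar k w (state N n (\<lambda>t. A t w) B x0 \<psi> k))"
      unfolding AE_eq by (rule argmin_iff)
  qed (rule inf_cost)
qed

end
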